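(* Let $\Omega$, $P$ be as in the context, let $\omega$ be an open and nonempty subset of $\Omega$, let $\sigma\in(0,1)$, let $T>0$ and let $E\subset(0,T)$ be a measurable set of positive measure. If one of the (equivalent) statements (i)–(iv) of the context holds, then for any $y^0\in L^2(\Omega)$ there is $f\in L^2(\omega\times E)$ such that the solution $y$ to $$\begin{cases}y'(t)+Py(t)=1_{\omega\times E}f,&t\in(0,T),\\ y(0)=y^0,\end{cases}$$ satisfies $y(T)=0$.
   Context: $\Omega$ is a bounded domain of $\mathbb{R}^d$, $d\ge1$, with boundary of class $C^2$, and $H=L^2(\Omega)$ (real Hilbert space) with norm $\|\cdot\|$ and inner product $\langle\cdot,\cdot\rangle$; $\|\cdot\|_\omega$ is the norm of $L^2(\omega)$; $1_{\omega\times E}f$ is the extension of $f$ by $0$ to $\Omega\times(0,T)$. $P:D(P)\subset H\to H$ is a linear self-adjoint operator that is an isomorphism from $D(P)$ (with the graph norm) onto $H$, with $P^{-1}$ compact in $H$ and $\langle P\vartheta,\vartheta\rangle>0$ for all nonzero $\vartheta\in D(P)$; eigenvalues $0<\lambda_1\le\lambda_2\le\dots\to\infty$, orthonormal eigenbasis $\{\Phi_j\}_{j\ge1}$. Below, $u$ is the solution $u(t)=e^{-tP}u(0)$ of $u'+Pu=0$; the solution $y$ is the one in $C([0,T];H)$ given by Duhamel's formula. The four statements (equivalent to each other) are: (i) there is $C_1>0$ such that for all $\Lambda>0$ and real $a_j$: $\sum_{\lambda_j\le\Lambda}|a_j|^2\le e^{C_1(1+\Lambda^\sigma)}\int_\omega|\sum_{\lambda_j\le\Lambda}a_j\Phi_j|^2$;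 (ii) there is $C_2>0$ such that for all $\theta\in(0,1)$, $t>0$, $u(0)\in L^2(\Omega)$: $\|u(t)\|\le e^{C_2(1+(\frac1{\theta t})^{\sigma/(1-\sigma)})}\|u(0)\|^\theta\|u(t)\|_\omega^{1-\theta}$; (iii) there is $C_3>0$ such that for all $\varepsilon>0$, $t>0$, $u(0)\in L^2(\Omega)$: $\|u(t)\|^2\le e^{C_3(1+(\frac1t)^{\sigma/(1-\sigma)})}e^{(\frac{C_3}t\ln(e+\frac1\varepsilon))^\sigma}\|u(t)\|_\omega^2+\varepsilon\|u(0)\|^2$; (iv) there is $C_4>0$ such that for all $t>0$, $u(0)\in L^2(\Omega)\setminus\{0\}$: $\|u(t)\|\le e^{C_4(1+(\frac1t)^{\sigma/(1-\sigma)})}e^{(\frac{C_4}t\ln(\|u(0)\|/\|u(t)\|))^\sigma}\|u(t)\|_\omega$. *)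

theory Defs
  imports "HOL-Analysis.Analysis"
begin

definition square_integrable :: "('a::euclidean_space \<Rightarrow> real) \<Rightarrow> bool" where
  "square_integrable f \<longleftrightarrow> f \<in> borel_measurable lborel \<and> integrable lborel (\<lambda>x. (f x)\<^sup>2)"

definition L2_rel :: "('a::euclidean_space \<Rightarrow> real) \<Rightarrow> ('a \<Rightarrow> real) \<Rightarrow> bool" where
  "L2_rel f g \<longleftrightarrow> square_integrable f \<and> square_integrable g \<and> (AE x in lborel. f x = g x)"

lemma square_integrable_measurable [measurable_dest]:
  "square_integrable f \<Longrightarrow> f \<in> borel_measurable lborel"
  by (simp add: square_integrable_def)

lemma square_integrable_zero [simp]: "square_integrable (\<lambda>_. 0)"
  by (simp add: square_integrable_def)

lemma square_integrable_bound:
  assumes "square_integrable f" "g \<in> borel_measurable lborel" "AE x in lborel. \<bar>g x\<bar> \<le> \<bar>f x\<bar>"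
  shows "square_integrable g"
  unfolding square_integrable_def
proof
  show "g \<in> borel_measurable lborel" by fact
  show "integrable lborel (\<lambda>x. (g x)\<^sup>2)"
  proof (rule Bochner_Integration.integrable_bound)
    show "integrable lborel (\<lambda>x. (f x)\<^sup>2)" using assms by (simp add: square_integrable_def)
    show "(\<lambda>x. (g x)\<^sup>2) \<in> borel_measurable lborel" using assms(2) by measurable
    show "AE x in lborel. norm ((g x)\<^sup>2) \<le> norm ((f x)\<^sup>2)"
      using assms(3) by eventually_elim (simp add: abs_le_square_iff)
  qed
qed

lemma square_integrable_scale:
  assumes "square_integrable f" shows "square_integrable (\<lambda>x. c * f x)"
  using assms by (auto simp: square_integrable_def power_mult_distrib)

lemma square_integrable_mult:
  assumes f: "square_integrable f" and g: "square_integrable g"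
  shows "integrable lborel (\<lambda>x. f x * g x)"
proof (rule Bochner_Integration.integrable_bound)
  show "integrable lborel (\<lambda>x. (f x)\<^sup>2 + (g x)\<^sup>2)" using f g by (simp add: square_integrable_def)
  show "(\<lambda>x. f x * g x) \<in> borel_measurable lborel" using f g by measurable
  have "\<bar>a * b\<bar> \<le> a\<^sup>2 + b\<^sup>2" for a b :: real
    using sum_squares_bound[of a b] sum_squares_bound[of "-a" b]
    by (cases "a * b \<ge> 0") (auto simp: abs_if intro: order_trans)
  then show "AE x in lborel. norm (f x * g x) \<le> norm ((f x)\<^sup>2 + (g x)\<^sup>2)" by simp
qed

lemma square_integrable_add:
  assumes f: "square_integrable f" and g: "square_integrable g"
  shows "square_integrable (\<lambda>x. f x + g x)"
proof -
  have "integrable lborel (\<lambda>x. (f x)\<^sup>2 + (g x)\<^sup>2 + 2 * (f x * g x))"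
    using f g square_integrable_mult[OF f g] by (simp add: square_integrable_def)
  then show ?thesis using f g
    by (auto simp: square_integrable_def power2_sum mult.assoc)
qed

lemma square_integrable_uminus:
  "square_integrable f \<Longrightarrow> square_integrable (\<lambda>x. - f x)"
  by (auto simp: square_integrable_def)

lemma square_integrable_diff:
  "square_integrable f \<Longrightarrow> square_integrable g \<Longrightarrow> square_integrable (\<lambda>x. f x - g x)"
  using square_integrable_add[OF _ square_integrable_uminus[of g]] by simp

text \<open>The real Hilbert space $L^2(\mathbb{R}^d)$: square-integrable functions modulo equality
  almost everywhere; \<^term>\<open>rep_L2 u\<close> is some representative of the class \<^term>\<open>u\<close>.\<close>

quotient_type (overloaded) 'a L2 = "'a::euclidean_space \<Rightarrow> real" / partial: L2_rel
proof (rule part_equivpI)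
  show "\<exists>f::'a \<Rightarrow> real. L2_rel f f"
    by (rule exI[of _ "\<lambda>_. 0"]) (simp add: L2_rel_def)
  show "symp (L2_rel :: ('a \<Rightarrow> real) \<Rightarrow> _)"
    by (rule sympI) (auto simp: L2_rel_def)
  show "transp (L2_rel :: ('a \<Rightarrow> real) \<Rightarrow> _)"
    by (rule transpI) (auto simp: L2_rel_def elim!: eventually_elim2)
qed

instantiation L2 :: (euclidean_space) real_inner
begin

lift_definition zero_L2 :: "'a L2" is "\<lambda>_. 0" by (simp add: L2_rel_def)

lift_definition plus_L2 :: "'a L2 \<Rightarrow> 'a L2 \<Rightarrow> 'a L2" is "\<lambda>f g x. f x + g x"
  by (auto simp: L2_rel_def intro: square_integrable_add elim!: eventually_elim2)

lift_definition uminus_L2 :: "'a L2 \<Rightarrow> 'a L2" is "\<lambda>f x. - f x"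
  by (auto simp: L2_rel_def intro: square_integrable_uminus elim: eventually_mono)

lift_definition minus_L2 :: "'a L2 \<Rightarrow> 'a L2 \<Rightarrow> 'a L2" is "\<lambda>f g x. f x - g x"
  by (auto simp: L2_rel_def intro: square_integrable_diff elim!: eventually_elim2)

lift_definition scaleR_L2 :: "real \<Rightarrow> 'a L2 \<Rightarrow> 'a L2" is "\<lambda>c f x. c * f x"
  by (auto simp: L2_rel_def intro: square_integrable_scale elim: eventually_mono)

lift_definition inner_L2 :: "'a L2 \<Rightarrow> 'a L2 \<Rightarrow> real" is "\<lambda>f g. LINT x|lborel. f x * g x"
proof -
  fix f f' g g' :: "'a \<Rightarrow> real"
  assume *: "L2_rel f f'" "L2_rel g g'"
  then have m: "f \<in> borel_measurable lborel" "f' \<in> borel_measurable lborel"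
    "g \<in> borel_measurable lborel" "g' \<in> borel_measurable lborel"
    by (auto simp: L2_rel_def square_integrable_def)
  show "(LINT x|lborel. f x * g x) = (LINT x|lborel. f' x * g' x)"
    using * m by (intro integral_cong_AE) (auto simp: L2_rel_def elim!: eventually_elim2)
qed

definition norm_L2 :: "'a L2 \<Rightarrow> real" where "norm_L2 u = sqrt (inner u u)"
definition dist_L2 :: "'a L2 \<Rightarrow> 'a L2 \<Rightarrow> real" where "dist_L2 u v = norm (u - v)"
definition sgn_L2 :: "'a L2 \<Rightarrow> 'a L2" where "sgn_L2 u = inverse (norm u) *\<^sub>R u"
definition uniformity_L2 :: "('a L2 \<times> 'a L2) filter" where
  "uniformity_L2 = (INF e\<in>{0 <..}. principal {(u, v). dist u v < e})"
definition open_L2 :: "'a L2 set \<Rightarrow> bool" where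
  "open_L2 U \<longleftrightarrow> (\<forall>u\<in>U. \<forall>\<^sub>F (u', v) in uniformity. u' = u \<longrightarrow> v \<in> U)"

instance
proof
  fix u v w :: "'a L2" and a b :: real
  show "u + v + w = u + (v + w)" by transfer (auto simp: L2_rel_def algebra_simps intro!: square_integrable_add)
  show "u + v = v + u" by transfer (auto simp: L2_rel_def algebra_simps intro!: square_integrable_add)
  show "0 + u = u" by transfer (auto simp: L2_rel_def)
  show "- u + u = 0" by transfer (auto simp: L2_rel_def)
  show "u - v = u + - v"
    by transfer (auto simp: L2_rel_def intro!: square_integrable_diff)
  show "a *\<^sub>R (u + v) = a *\<^sub>R u + a *\<^sub>R v"
    by transfer (auto simp: L2_rel_def distrib_left intro!: square_integrable_add square_integrable_scale)
  show "(a + b) *\<^sub>R u = a *\<^sub>R u + b *\<^sub>R u"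
    by transfer (auto simp: L2_rel_def distrib_right intro!: square_integrable_add square_integrable_scale)
  show "a *\<^sub>R b *\<^sub>R u = (a * b) *\<^sub>R u"
    by transfer (auto simp: L2_rel_def mult.assoc intro!: square_integrable_scale)
  show "1 *\<^sub>R u = u" by transfer (auto simp: L2_rel_def)
  show "dist u v = norm (u - v)" by (simp add: dist_L2_def)
  show "sgn u = inverse (norm u) *\<^sub>R u" by (simp add: sgn_L2_def)
  show "uniformity = (INF e\<in>{0 <..}. principal {(u::'a L2, v). dist u v < e})"
    by (simp add: uniformity_L2_def)
  show "open U \<longleftrightarrow> (\<forall>u\<in>U. \<forall>\<^sub>F (u', v) in uniformity. u' = u \<longrightarrow> v \<in> U)" for U :: "'a L2 set"
    by (simp add: open_L2_def)
  show "inner u v = inner v u" by transfer (simp add: mult.commute)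
  show "inner (u + v) w = inner u w + inner v w"
    by transfer (auto simp: L2_rel_def distrib_right square_integrable_mult)
  show "inner (a *\<^sub>R u) v = a * inner u v"
    by transfer (simp add: mult.assoc)
  show "0 \<le> inner u u" by transfer simp
  show "inner u u = 0 \<longleftrightarrow> u = 0"
  proof transfer
    fix f :: "'a \<Rightarrow> real" assume "L2_rel f f"
    then have sq: "square_integrable f" by (simp add: L2_rel_def)
    have "(LINT x|lborel. f x * f x) = 0 \<longleftrightarrow> (AE x in lborel. f x * f x = 0)"
      using sq by (intro integral_nonneg_eq_0_iff_AE square_integrable_mult) auto
    then show "(LINT x|lborel. f x * f x) = 0 \<longleftrightarrow> L2_rel f (\<lambda>_. 0)"
      using sq by (simp add: L2_rel_def)
  qed
  show "norm u = sqrt (inner u u)" by (simp add: norm_L2_def)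
qed

end


text \<open>The class of a function; the value for functions that are not square-integrable is
  irrelevant.\<close>

definition L2_of :: "('a::euclidean_space \<Rightarrow> real) \<Rightarrow> 'a L2" where
  "L2_of f = (if square_integrable f then abs_L2 f else 0)"

lemma square_integrable_rep [simp, intro]: "square_integrable (rep_L2 u)"
  using Quotient3_rep_reflp[OF Quotient3_L2, of u] by (simp add: L2_rel_def)

lemma rep_L2_measurable [measurable]: "rep_L2 u \<in> borel_measurable lborel"
  by (rule square_integrable_measurable) simp

lemma rep_L2_of:
  assumes "square_integrable f"
  shows "AE x in lborel. rep_L2 (L2_of f) x = f x"
proof -
  have "L2_rel f f" using assms by (simp add: L2_rel_def)
  then have "L2_rel f (rep_L2 (abs_L2 f))" by (rule rep_abs_rsp[OF Quotient3_L2])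
  then show ?thesis
    using assms by (auto simp: L2_rel_def L2_of_def elim: eventually_mono)
qed

lemma L2_of_rep [simp]: "L2_of (rep_L2 u) = u"
  by (simp add: L2_of_def Quotient3_abs_rep[OF Quotient3_L2])

lemma L2_of_cong_AE:
  assumes "square_integrable f" "square_integrable g" "AE x in lborel. f x = g x"
  shows "L2_of f = L2_of g"
  using assms Quotient3_rel_abs[OF Quotient3_L2, of f g] by (simp add: L2_of_def L2_rel_def)

lemma L2_eq_iff: "u = v \<longleftrightarrow> (AE x in lborel. rep_L2 u x = rep_L2 v x)"
  using Quotient3_rel_rep[OF Quotient3_L2, of u v] by (auto simp: L2_rel_def)

lemma
  assumes "square_integrable f" "square_integrable g"
  shows L2_of_add: "L2_of (\<lambda>x. f x + g x) = L2_of f + L2_of g"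
    and L2_of_diff: "L2_of (\<lambda>x. f x - g x) = L2_of f - L2_of g"
    and inner_L2_of: "inner (L2_of f) (L2_of g) = (LINT x|lborel. f x * g x)"
  using assms
  by (simp_all add: L2_of_def square_integrable_add square_integrable_diff plus_L2.abs_eq
      minus_L2.abs_eq inner_L2.abs_eq L2_rel_def)

lemma L2_of_scale:
  "square_integrable f \<Longrightarrow> L2_of (\<lambda>x. c * f x) = c *\<^sub>R L2_of f"
  by (simp add: L2_of_def square_integrable_scale scaleR_L2.abs_eq L2_rel_def)

lemma L2_of_zero [simp]: "L2_of (\<lambda>_. 0) = 0"
  by (simp add: L2_of_def zero_L2_def)

lemma norm_L2_of:
  "square_integrable f \<Longrightarrow> norm (L2_of f) = sqrt (LINT x|lborel. (f x)\<^sup>2)"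
  by (simp add: norm_eq_sqrt_inner inner_L2_of power2_eq_square)

lemma norm_L2_rep: "norm u = sqrt (LINT x|lborel. (rep_L2 u x)\<^sup>2)"
  using norm_L2_of[of "rep_L2 u"] by simp

lemma L2_of_tendsto:
  fixes f :: "nat \<Rightarrow> 'a::euclidean_space \<Rightarrow> real"
  assumes w: "square_integrable w" and f: "\<And>n. f n \<in> borel_measurable lborel"
    and g: "g \<in> borel_measurable lborel"
    and lim: "AE x in lborel. (\<lambda>n. f n x) \<longlonglongrightarrow> g x"
    and bound: "\<And>n. AE x in lborel. \<bar>f n x\<bar> \<le> \<bar>w x\<bar>"
  shows "(\<lambda>n. L2_of (f n)) \<longlonglongrightarrow> L2_of g" "square_integrable g"
proof -
  have sf: "square_integrable (f n)" for n
    by (rule square_integrable_bound[OF w f bound])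
  have "AE x in lborel. \<forall>n. \<bar>f n x\<bar> \<le> \<bar>w x\<bar>"
    using bound by (simp add: AE_all_countable)
  with lim have gb: "AE x in lborel. \<bar>g x\<bar> \<le> \<bar>w x\<bar>"
  proof eventually_elim
    case (elim x)
    then have "(\<lambda>n. \<bar>f n x\<bar>) \<longlonglongrightarrow> \<bar>g x\<bar>" by (intro tendsto_rabs) simp
    with elim show ?case by (intro LIMSEQ_le_const2[where X="\<lambda>n. \<bar>f n x\<bar>"]) auto
  qed
  show sg: "square_integrable g" by (rule square_integrable_bound[OF w g gb])
  have "(\<lambda>n. LINT x|lborel. (f n x - g x)\<^sup>2) \<longlonglongrightarrow> (LINT x::'a|lborel. (0::real))"
  proof (rule integral_dominated_convergence[where w="\<lambda>x. 4 * (w x)\<^sup>2"])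
    show "integrable lborel (\<lambda>x. 4 * (w x)\<^sup>2)" using w by (simp add: square_integrable_def)
    show "(\<lambda>x. (f n x - g x)\<^sup>2) \<in> borel_measurable lborel" for n
      using f g by measurable
    show "AE x in lborel. (\<lambda>n. (f n x - g x)\<^sup>2) \<longlonglongrightarrow> 0"
      using lim by eventually_elim (auto intro!: tendsto_eq_intros)
    show "AE x in lborel. norm ((f n x - g x)\<^sup>2) \<le> 4 * (w x)\<^sup>2" for n
      using bound[of n] gb
    proof eventually_elim
      case (elim x)
      then have "\<bar>f n x - g x\<bar> \<le> \<bar>2 * w x\<bar>" by (auto simp: abs_mult)
      then show ?case using abs_le_square_iff[of "f n x - g x" "2 * w x"]
        by (simp add: power_mult_distrib)
    qed
  qed auto
  then have "(\<lambda>n. sqrt (LINT x|lborel. (f n x - g x)\<^sup>2)) \<longlonglongrightarrow> 0"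
    using tendsto_real_sqrt by fastforce
  then have "(\<lambda>n. norm (L2_of (f n) - L2_of g)) \<longlonglongrightarrow> 0"
    using sf sg by (simp add: norm_L2_of square_integrable_diff flip: L2_of_diff)
  then show "(\<lambda>n. L2_of (f n)) \<longlonglongrightarrow> L2_of g"
    by (simp add: tendsto_norm_zero_iff LIM_zero_iff)
qed

lemma L2_AE_convergent:
  fixes X :: "nat \<Rightarrow> 'a::euclidean_space L2"
  assumes "\<And>n. norm (X (Suc n) - X n) \<le> (1/2) ^ n"
  shows "AE x in lborel. convergent (\<lambda>n. rep_L2 (X n) x)"
proof -
  define d where "d n x = rep_L2 (X (Suc n)) x - rep_L2 (X n) x" for n x
  have sd: "square_integrable (d n)" for n
    unfolding d_def by (intro square_integrable_diff) auto
  have [measurable]: "d n \<in> borel_measurable lborel" for n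
    using sd by (rule square_integrable_measurable)
  have "L2_of (d n) = X (Suc n) - X n" for n
    unfolding d_def by (subst L2_of_diff) auto
  then have "sqrt (LINT x|lborel. (d n x)\<^sup>2) \<le> (1/2) ^ n" for n
    using assms[of n] norm_L2_of[OF sd[of n]] by simp
  then have "(LINT x|lborel. (d n x)\<^sup>2) \<le> ((1/2) ^ n)\<^sup>2" for n
    by (meson real_le_lsqrt sqrt_le_D)
  then have int: "(LINT x|lborel. (d n x)\<^sup>2) \<le> (1/4) ^ n" for n
    by (simp add: power2_eq_square flip: power_mult_distrib)
  have *: "(\<integral>\<^sup>+x. ennreal (2 ^ n * (d n x)\<^sup>2) \<partial>lborel) \<le> ennreal ((1/2) ^ n)" for n
  proof -
    have "(\<integral>\<^sup>+x. ennreal (2 ^ n * (d n x)\<^sup>2) \<partial>lborel) = ennreal (LINT x|lborel. 2 ^ n * (d n x)\<^sup>2)"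
      using sd[of n] by (intro nn_integral_eq_integral) (auto simp: square_integrable_def)
    also have "(LINT x|lborel. 2 ^ n * (d n x)\<^sup>2) \<le> 2 ^ n * (1/4) ^ n"
      using int[of n] by simp
    also have "2 ^ n * (1/4) ^ n = (1/2::real) ^ n"
      by (simp flip: power_mult_distrib)
    finally show ?thesis by (simp add: ennreal_leI)
  qed
  have "(\<integral>\<^sup>+x. (\<Sum>n. ennreal (2 ^ n * (d n x)\<^sup>2)) \<partial>lborel)
      = (\<Sum>n. \<integral>\<^sup>+x. ennreal (2 ^ n * (d n x)\<^sup>2) \<partial>lborel)"
    by (rule nn_integral_suminf) measurable
  also have "\<dots> \<le> (\<Sum>n. ennreal ((1/2) ^ n))"
    by (intro suminf_le * summableI)
  also have "\<dots> = ennreal (\<Sum>n. (1/2) ^ n)"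
    by (intro suminf_ennreal2) auto
  finally have "(\<integral>\<^sup>+x. (\<Sum>n. ennreal (2 ^ n * (d n x)\<^sup>2)) \<partial>lborel) \<noteq> \<infinity>"
    using ennreal_neq_top infinity_ennreal_def neq_top_trans by metis
  then have "AE x in lborel. (\<Sum>n. ennreal (2 ^ n * (d n x)\<^sup>2)) \<noteq> \<infinity>"
    by (intro nn_integral_noteq_infinite) measurable
  then show ?thesis
  proof eventually_elim
    case (elim x)
    define S where "S = (\<Sum>n. ennreal (2 ^ n * (d n x)\<^sup>2))"
    have "S \<noteq> \<infinity>" using elim by (simp only: S_def not_False_eq_True)
    then obtain M where M: "S = ennreal M" "M \<ge> 0" by (cases S) auto
    have le: "2 ^ n * (d n x)\<^sup>2 \<le> M" for n
    proof -
      have "(\<Sum>i\<in>{n}. ennreal (2 ^ i * (d i x)\<^sup>2)) \<le> S"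
        unfolding S_def by (rule sum_le_suminf) auto
      then have "ennreal (2 ^ n * (d n x)\<^sup>2) \<le> ennreal M"
        by (simp only: M sum.insert_remove finite.emptyI Diff_empty sum.empty add_0_right empty_Diff)
      then show ?thesis by (subst (asm) ennreal_le_iff) (use M in auto)
    qed
    have "\<bar>d n x\<bar> \<le> sqrt M * sqrt (1/2) ^ n" for n
    proof -
      have "(d n x)\<^sup>2 \<le> M * (1/2) ^ n"
        using le[of n] by (simp add: field_simps power_divide)
      then have "sqrt ((d n x)\<^sup>2) \<le> sqrt (M * (1/2) ^ n)" by (rule real_sqrt_le_mono)
      then show ?thesis
        unfolding real_sqrt_abs real_sqrt_mult[of M] real_sqrt_power[of "1/2"] .
    qed
    moreover have "summable (\<lambda>n. sqrt M * sqrt (1/2) ^ n)"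
      by (intro summable_mult summable_geometric) (auto simp: real_sqrt_lt_1_iff)
    ultimately have "summable (\<lambda>n. d n x)"
      using summable_comparison_test[of "\<lambda>n. d n x" "\<lambda>n. sqrt M * sqrt (1/2) ^ n"] by auto
    then have "convergent (\<lambda>n. \<Sum>k<n. d k x)" by (simp add: summable_iff_convergent)
    moreover have "(\<Sum>k<n. d k x) = rep_L2 (X n) x - rep_L2 (X 0) x" for n
      unfolding d_def by (rule sum_lessThan_telescope)
    ultimately have "convergent (\<lambda>n. (rep_L2 (X n) x - rep_L2 (X 0) x) + rep_L2 (X 0) x)"
      by (intro convergent_add) (auto intro: convergent_const)
    then show ?case by simp
  qed
qed

instance L2 :: (euclidean_space) complete_space
proof
  fix Y :: "nat \<Rightarrow> 'a L2" assume Y: "Cauchy Y"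
  have "\<exists>r. strict_mono r \<and> (\<forall>n. \<forall>m\<ge>r n. norm (Y m - Y (r n)) \<le> (1/2) ^ n)"
  proof -
    have "\<forall>n. \<exists>N. \<forall>m\<ge>N. \<forall>k\<ge>N. norm (Y m - Y k) < (1/2) ^ n"
      using CauchyD[OF Y] by auto
    then obtain N where N: "\<And>n m k. m \<ge> N n \<Longrightarrow> k \<ge> N n \<Longrightarrow> norm (Y m - Y k) < (1/2) ^ n"
      by metis
    define r where "r n = (\<Sum>i\<le>n. N i) + n" for n
    have "strict_mono r" by (auto simp: strict_mono_Suc_iff r_def)
    moreover have "N n \<le> r n" for n
      unfolding r_def using member_le_sum[of n "{..n}" N] by auto
    ultimately show ?thesis
      by (intro exI[of _ r]) (meson N less_imp_le order_trans order_refl)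
  qed
  then obtain r where r: "strict_mono r"
    and rle: "\<And>n m. m \<ge> r n \<Longrightarrow> norm (Y m - Y (r n)) \<le> (1/2) ^ n" by blast
  define g where "g n = rep_L2 (Y (r n))" for n
  have [measurable]: "g n \<in> borel_measurable lborel" for n by (simp add: g_def)
  have gle: "norm (Y (r n) - Y (r m)) \<le> (1/2) ^ m" if "m \<le> n" for m n
    using rle[of m "r n"] strict_mono_leD[OF r that] by simp
  have conv: "AE x in lborel. convergent (\<lambda>n. g n x)"
    unfolding g_def by (rule L2_AE_convergent[of "\<lambda>n. Y (r n)"]) (simp add: gle)
  define h where "h x = lim (\<lambda>n. g n x)" for x
  have [measurable]: "h \<in> borel_measurable lborel"
    unfolding h_def by (rule borel_measurable_lim_metric) simp
  have lim: "AE x in lborel. (\<lambda>n. g n x) \<longlonglongrightarrow> h x"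
    using conv by eventually_elim (simp add: h_def convergent_LIMSEQ_iff)
  have gg: "(\<integral>\<^sup>+x. ennreal ((g n x - g m x)\<^sup>2) \<partial>lborel) \<le> ennreal (((1/2) ^ m)\<^sup>2)" if "m \<le> n" for m n
  proof -
    have sq: "square_integrable (\<lambda>x. g n x - g m x)"
      unfolding g_def by (intro square_integrable_diff) auto
    have "L2_of (\<lambda>x. g n x - g m x) = Y (r n) - Y (r m)"
      unfolding g_def by (subst L2_of_diff) auto
    then have "sqrt (LINT x|lborel. (g n x - g m x)\<^sup>2) \<le> (1/2) ^ m"
      using gle[OF that] norm_L2_of[OF sq] by simp
    then have "(LINT x|lborel. (g n x - g m x)\<^sup>2) \<le> ((1/2) ^ m)\<^sup>2"
      by (rule sqrt_le_D)
    moreover have "(\<integral>\<^sup>+x. ennreal ((g n x - g m x)\<^sup>2) \<partial>lborel) = ennreal (LINT x|lborel. (g n x - g m x)\<^sup>2)"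
      using sq by (intro nn_integral_eq_integral) (auto simp: square_integrable_def)
    ultimately show ?thesis by (simp add: ennreal_leI)
  qed
  have hg: "(\<integral>\<^sup>+x. ennreal ((h x - g m x)\<^sup>2) \<partial>lborel) \<le> ennreal (((1/2) ^ m)\<^sup>2)" for m
  proof -
    have "(\<integral>\<^sup>+x. ennreal ((h x - g m x)\<^sup>2) \<partial>lborel)
        = (\<integral>\<^sup>+x. liminf (\<lambda>n. ennreal ((g n x - g m x)\<^sup>2)) \<partial>lborel)"
    proof (rule nn_integral_cong_AE)
      show "AE x in lborel. ennreal ((h x - g m x)\<^sup>2) = liminf (\<lambda>n. ennreal ((g n x - g m x)\<^sup>2))"
        using lim
      proof eventually_elim
        case (elim x)
        then have "(\<lambda>n. ennreal ((g n x - g m x)\<^sup>2)) \<longlonglongrightarrow> ennreal ((h x - g m x)\<^sup>2)"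
          by (intro tendsto_ennrealI tendsto_intros)
        then show ?case by (rule lim_imp_Liminf[OF sequentially_bot, symmetric])
      qed
    qed
    also have "\<dots> \<le> liminf (\<lambda>n. \<integral>\<^sup>+x. ennreal ((g n x - g m x)\<^sup>2) \<partial>lborel)"
      by (rule nn_integral_liminf) measurable
    also have "\<dots> \<le> ennreal (((1/2) ^ m)\<^sup>2)"
      by (rule Liminf_le) (use gg in \<open>auto simp: eventually_sequentially intro!: exI[of _ m]\<close>)
    finally show ?thesis .
  qed
  have sq: "square_integrable (\<lambda>x. h x - g m x)" for m
    unfolding square_integrable_def
  proof
    show "integrable lborel (\<lambda>x. (h x - g m x)\<^sup>2)"
      by (rule integrableI_bounded) (use hg[of m] in \<open>auto simp: order_le_less_trans\<close>)
  qed measurable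
  have sh: "square_integrable h"
    using square_integrable_add[OF sq[of 0], of "g 0"] by (simp add: g_def)
  have "norm (Y (r m) - L2_of h) \<le> (1/2) ^ m" for m
  proof -
    have "ennreal (LINT x|lborel. (h x - g m x)\<^sup>2) \<le> ennreal (((1/2) ^ m)\<^sup>2)"
      using hg[of m] sq[of m] by (subst nn_integral_eq_integral[symmetric]) (auto simp: square_integrable_def)
    then have "(LINT x|lborel. (h x - g m x)\<^sup>2) \<le> ((1/2) ^ m)\<^sup>2"
      by (subst (asm) ennreal_le_iff) auto
    then have "norm (L2_of (\<lambda>x. h x - g m x)) \<le> (1/2) ^ m"
      by (simp add: norm_L2_of[OF sq] real_le_lsqrt)
    moreover have "L2_of (\<lambda>x. h x - g m x) = L2_of h - Y (r m)"
      unfolding g_def by (subst L2_of_diff) (auto simp: sh)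
    ultimately show ?thesis by (simp add: norm_minus_commute)
  qed
  then have "(\<lambda>m. norm (Y (r m) - L2_of h)) \<longlonglongrightarrow> 0"
    by (intro tendsto_sandwich[OF _ _ tendsto_const LIMSEQ_realpow_zero[of "1/2::real"]]) auto
  then have "(Y \<circ> r) \<longlonglongrightarrow> L2_of h"
    by (simp add: o_def tendsto_norm_zero_iff LIM_zero_iff)
  then show "convergent Y"
    using Cauchy_converges_subseq[OF Y r] by (auto simp: convergent_def)
qed

instance L2 :: (euclidean_space) banach ..


lemma square_integrable_indicator:
  assumes "A \<in> sets lborel" "emeasure lborel A < \<infinity>"
  shows "square_integrable (indicator A)"
proof -
  have "(\<lambda>x. (indicator A x :: real)\<^sup>2) = indicator A"
    by (auto simp: indicator_def)
  then show ?thesis using assms by (auto simp: square_integrable_def)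
qed

lemma L2_subspace_dense:
  fixes V :: "'a::euclidean_space L2 set"
  assumes V: "subspace V" "closed V"
    and U: "UNIV \<in> G" and G: "Int_stable G" "sigma_sets UNIV G = sets borel"
    and ind: "\<And>A n. A \<in> G \<Longrightarrow> L2_of (indicator (A \<inter> ball 0 (real n))) \<in> V"
  shows "V = UNIV"
proof -
  have fin: "emeasure lborel (A \<inter> ball 0 (real n) :: 'a set) < \<infinity>" for A n
    using emeasure_mono[of "A \<inter> ball 0 (real n)" "ball 0 (real n)" lborel] emeasure_lborel_ball_finite[of "0::'a" "real n"]
    by (auto simp: order_le_less_trans)
  have sqB: "square_integrable (indicator (A \<inter> ball 0 (real n)) :: 'a \<Rightarrow> real)" if "A \<in> sets borel" for A n
    using that fin by (intro square_integrable_indicator) auto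
  have lim: "L2_of g \<in> V"
    if "square_integrable w" "\<And>n. f n \<in> borel_measurable lborel" "g \<in> borel_measurable lborel"
      "AE x in lborel. (\<lambda>n. f n x) \<longlonglongrightarrow> g x" "\<And>n. AE x in lborel. \<bar>f n x\<bar> \<le> \<bar>w x\<bar>"
      "\<And>n. L2_of (f n) \<in> V" for w g :: "'a \<Rightarrow> real" and f :: "nat \<Rightarrow> 'a \<Rightarrow> real"
    using closed_sequentially[OF V(2) _ L2_of_tendsto(1)[OF that(1-5)]] that(6) by blast
  have bounded_sets: "L2_of (indicator (A \<inter> ball 0 (real n))) \<in> V" if "A \<in> sets borel" for A n
  proof -
    have uni: "L2_of (indicator (UNIV \<inter> ball 0 (real n))) \<in> V" by (rule ind[OF U])
    have G': "G \<subseteq> Pow UNIV" by simp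
    from that have "A \<in> sigma_sets UNIV G" by (simp add: G)
    with G(1) G' show ?thesis
    proof (induction rule: sigma_sets_induct_disjoint)
      case (basic A) then show ?case by (rule ind)
    next
      case empty
      have "indicator ({} \<inter> ball 0 (real n)) = (\<lambda>_::'a. 0::real)" by auto
      then show ?case using V by (simp add: subspace_0)
    next
      case (compl A)
      then have A: "A \<in> sets borel" by (simp add: G)
      have "indicator ((UNIV - A) \<inter> ball 0 (real n))
          = (\<lambda>x. indicator (UNIV \<inter> ball 0 (real n)) x - indicator (A \<inter> ball 0 (real n)) x :: real)"
        by (auto simp: indicator_def)
      then have "L2_of (indicator ((UNIV - A) \<inter> ball 0 (real n)))
          = L2_of (indicator (UNIV \<inter> ball 0 (real n))) - L2_of (indicator (A \<inter> ball 0 (real n)))"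
        using L2_of_diff[OF sqB[of UNIV n] sqB[OF A, of n]] by simp
      then show ?case using compl uni V(1) by (simp add: subspace_diff)
    next
      case (union A)
      have A: "A i \<in> sets borel" for i using union(2) by (auto simp: G)
      show ?case
      proof (rule lim[of "indicator (ball 0 (real n))"
            "\<lambda>m x. \<Sum>i<m. indicator (A i \<inter> ball 0 (real n)) x"])
        show "square_integrable (indicator (ball 0 (real n)) :: 'a \<Rightarrow> real)"
          using sqB[of UNIV n] by simp
        have dj: "disjoint_family (\<lambda>i. A i \<inter> ball 0 (real n))"
          using union(1) by (auto simp: disjoint_family_on_def)
        have eq: "(\<Sum>i<m. indicator (A i \<inter> ball 0 (real n)) x)
            = (indicator (\<Union>i<m. A i \<inter> ball 0 (real n)) x :: real)" for m x
          by (rule indicator_UN_disjoint[symmetric])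
            (use dj in \<open>auto simp: disjoint_family_on_def\<close>)
        show "AE x in lborel. (\<lambda>m. \<Sum>i<m. indicator (A i \<inter> ball 0 (real n)) x)
            \<longlonglongrightarrow> (indicator (\<Union> (range A) \<inter> ball 0 (real n)) x :: real)"
          unfolding eq using LIMSEQ_indicator_UN[of "\<lambda>i. A i \<inter> ball 0 (real n)"]
          by (intro AE_I2) simp
        show "AE x in lborel. \<bar>\<Sum>i<m. indicator (A i \<inter> ball 0 (real n)) x :: real\<bar>
            \<le> \<bar>indicator (ball 0 (real n)) x\<bar>" for m
          unfolding eq by (auto simp: indicator_def)
        show "L2_of (\<lambda>x. \<Sum>i<m. indicator (A i \<inter> ball 0 (real n)) x) \<in> V" for m
        proof (induction m)
          case (Suc m)
          have "square_integrable (\<lambda>x. \<Sum>i<m. indicator (A i \<inter> ball 0 (real n)) x :: real)"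
            by (induction m) (auto intro!: square_integrable_add sqB A)
          then show ?case
            using Suc union(3)[of m] V(1) by (simp add: L2_of_add sqB A subspace_add)
        qed (use V in \<open>auto simp: subspace_0\<close>)
      qed (use A in \<open>auto intro!: borel_measurable_indicator borel_measurable_sum\<close>)
    qed
  qed
  have sets: "L2_of (indicator A) \<in> V" if A: "A \<in> sets borel" "emeasure lborel A < \<infinity>" for A
  proof (rule lim[of "indicator A" "\<lambda>n. indicator (A \<inter> ball 0 (real n))"])
    show "square_integrable (indicator A :: 'a \<Rightarrow> real)" using A by (intro square_integrable_indicator) auto
    show "AE x in lborel. (\<lambda>n. indicator (A \<inter> ball 0 (real n)) x) \<longlonglongrightarrow> (indicator A x :: real)"
    proof (rule AE_I2)
      fix x :: 'a
      obtain N :: nat where "norm x < real N" using reals_Archimedean2 by blast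
      then have "\<forall>\<^sub>F n in sequentially. indicator (A \<inter> ball 0 (real n)) x = (indicator A x :: real)"
        by (auto simp: eventually_sequentially indicator_def intro!: exI[of _ N])
      then show "(\<lambda>n. indicator (A \<inter> ball 0 (real n)) x) \<longlonglongrightarrow> (indicator A x :: real)"
        by (rule tendsto_eventually)
    qed
  qed (use A bounded_sets in \<open>auto simp: indicator_def intro!: borel_measurable_indicator\<close>)
  have "u \<in> V" for u
  proof -
    define g where "g = rep_L2 u"
    have g: "square_integrable g" by (simp add: g_def)
    from borel_measurable_implies_sequence_metric[OF square_integrable_measurable[OF g], of 0]
    obtain s where s: "\<And>i. simple_function lborel (s i)" "\<And>x. (\<lambda>i. s i x) \<longlonglongrightarrow> g x"
      "\<And>i x. \<bar>s i x\<bar> \<le> 2 * \<bar>g x\<bar>"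
      by (auto simp: dist_real_def)
    have sV: "L2_of (s i) \<in> V" for i
    proof -
      have [measurable]: "s i \<in> borel_measurable lborel"
        using s(1) by (rule borel_measurable_simple_function)
      have sq: "square_integrable (s i)"
        by (rule square_integrable_bound[OF square_integrable_scale[OF g, of 2]]) (auto simp: s abs_mult)
      define R where "R = s i ` UNIV - {0}"
      have finR: "finite R" using simple_functionD(1)[OF s(1)[of i]] by (simp add: R_def)
      have meas: "s i -` {c} \<in> sets borel" for c
        using measurable_sets[of "s i" lborel borel "{c}"] by simp
      have fin: "emeasure lborel (s i -` {c}) < \<infinity>" if "c \<in> R" for c
      proof -
        have "c \<noteq> 0" using that by (simp add: R_def)
        have "integrable lborel (\<lambda>x. (1 / c\<^sup>2) * (s i x)\<^sup>2)"
          using sq by (simp add: square_integrable_def)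
        then have "integrable lborel (indicator (s i -` {c}) :: 'a \<Rightarrow> real)"
          by (rule Bochner_Integration.integrable_bound)
            (use \<open>c \<noteq> 0\<close> meas in \<open>auto simp: indicator_def\<close>)
        then show ?thesis using meas by (simp add: integrable_indicator_iff)
      qed
      define t where "t c x = c * (indicator (s i -` {c}) x :: real)" for c x
      have eq: "s i x = (\<Sum>c\<in>R. t c x)" for x
      proof (cases "s i x = 0")
        case True then show ?thesis by (auto simp: R_def t_def indicator_def intro!: sum.neutral[symmetric])
      next
        case False
        then have "s i x \<in> R" by (simp add: R_def)
        have "(\<Sum>c\<in>R. t c x) = (\<Sum>c\<in>R. if c = s i x then c else 0)"
          by (intro sum.cong) (auto simp: t_def indicator_def)
        also have "\<dots> = s i x" using finR \<open>s i x \<in> R\<close> by simp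
        finally show ?thesis by simp
      qed
      have "F \<subseteq> R \<Longrightarrow> square_integrable (\<lambda>x. \<Sum>c\<in>F. t c x)
          \<and> L2_of (\<lambda>x. \<Sum>c\<in>F. t c x) \<in> V" for F
      proof (induction F rule: infinite_finite_induct)
        case (infinite F) then show ?case using finR by (meson finite_subset)
      next
        case empty then show ?case using V by (simp add: subspace_0)
      next
        case (insert c F)
        have 1: "square_integrable (indicator (s i -` {c}))"
          using meas fin insert.prems by (intro square_integrable_indicator) auto
        then have 2: "square_integrable (t c)"
          unfolding t_def by (rule square_integrable_scale)
        have 3: "L2_of (indicator (s i -` {c})) \<in> V"
          using meas fin insert.prems by (intro sets) auto
        have 4: "L2_of (t c) \<in> V"
          using 3 V(1) unfolding t_def by (simp add: L2_of_scale[OF 1] subspace_scale)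
        show ?case
          using insert 2 4 V(1) by (simp add: L2_of_add square_integrable_add subspace_add)
      qed
      from this[of R] show ?thesis by (simp flip: eq)
    qed
    have "L2_of g \<in> V"
    proof (rule lim[of "\<lambda>x. 2 * g x" s])
      show "square_integrable (\<lambda>x. 2 * g x)" using g by (rule square_integrable_scale)
      show "s i \<in> borel_measurable lborel" for i
        using s(1) by (rule borel_measurable_simple_function)
      show "g \<in> borel_measurable lborel" using g by (rule square_integrable_measurable)
    qed (use s sV in \<open>auto simp: abs_mult\<close>)
    then show ?thesis by (simp add: g_def)
  qed
  then show ?thesis by auto
qed

lemma L2_separable: "\<exists>D :: 'a::euclidean_space L2 set. countable D \<and> closure D = UNIV"
proof -
  obtain B :: "'a set set" where B: "countable B" "topological_basis B"
    using ex_countable_basis by blast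
  define G where "G = Inter ` {b. finite b \<and> b \<subseteq> B}"
  have cG: "countable G"
    unfolding G_def by (intro countable_image countable_Collect_finite_subset B)
  have "Int_stable G"
  proof (rule Int_stableI)
    fix a b assume "a \<in> G" "b \<in> G"
    then obtain x y where "a = \<Inter>x" "b = \<Inter>y" "finite x" "finite y" "x \<subseteq> B" "y \<subseteq> B"
      by (auto simp: G_def)
    then show "a \<inter> b \<in> G" unfolding G_def by (intro image_eqI[of _ _ "x \<union> y"]) auto
  qed
  have UG: "UNIV \<in> G" unfolding G_def by (intro image_eqI[of _ _ "{}"]) auto
  have oG: "open a" if "a \<in> G" for a
    using that topological_basis_open[OF B(2)] by (auto simp: G_def)
  have "topological_basis G"
  proof (rule topological_basisI)
    fix U :: "'a set" and x assume "open U" "x \<in> U"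
    then obtain b where "b \<in> B" "x \<in> b" "b \<subseteq> U" by (rule topological_basisE[OF B(2)])
    then show "\<exists>b\<in>G. x \<in> b \<and> b \<subseteq> U"
      unfolding G_def by (intro bexI[of _ "\<Inter>{b}"]) auto
  qed (rule oG)
  then have sG: "sigma_sets UNIV G = sets borel"
    by (subst borel_eq_countable_basis[OF cG]) auto
  define S where "S = (\<lambda>(a, n). L2_of (indicator (a \<inter> ball 0 (real n)))) ` (G \<times> UNIV)"
  have cS: "countable S" unfolding S_def using cG by auto
  define D where "D = (\<lambda>l. \<Sum>(q, v)\<leftarrow>l. of_rat q *\<^sub>R v) ` lists (UNIV \<times> S)"
  have cD: "countable D"
    unfolding D_def using cS by (intro countable_image countable_lists) auto
  have D_add: "u + v \<in> D" if u: "u \<in> D" and v: "v \<in> D" for u v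
  proof -
    obtain k where "k \<in> lists (UNIV \<times> S)" "u = (\<Sum>(q, v)\<leftarrow>k. of_rat q *\<^sub>R v)"
      using u unfolding D_def by blast
    moreover obtain l where "l \<in> lists (UNIV \<times> S)" "v = (\<Sum>(q, v)\<leftarrow>l. of_rat q *\<^sub>R v)"
      using v unfolding D_def by blast
    ultimately have "u + v = (\<Sum>(q, v)\<leftarrow>k @ l. of_rat q *\<^sub>R v)" "k @ l \<in> lists (UNIV \<times> S)" by auto
    then show ?thesis unfolding D_def by (rule image_eqI)
  qed
  have D_scale: "of_rat q *\<^sub>R u \<in> D" if u: "u \<in> D" for q u
  proof -
    obtain l where l: "l \<in> lists (UNIV \<times> S)" "u = (\<Sum>(q, v)\<leftarrow>l. of_rat q *\<^sub>R v)"
      using u unfolding D_def by blast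
    have "(\<Sum>(r, v)\<leftarrow>map (\<lambda>(r, v). (q * r, v)) l. of_rat r *\<^sub>R v) = of_rat q *\<^sub>R u"
      unfolding l(2) by (induction l) (auto simp: scaleR_add_right of_rat_mult)
    moreover have "map (\<lambda>(r, v). (q * r, v)) l \<in> lists (UNIV \<times> S)"
      using l(1) by (induction l) auto
    ultimately show ?thesis unfolding D_def by (metis image_eqI)
  qed
  have "0 \<in> D" unfolding D_def by (intro image_eqI[of _ _ "[]"]) auto
  have "subspace (closure D)"
  proof (rule subspaceI)
    show "0 \<in> closure D" using \<open>0 \<in> D\<close> closure_subset by blast
    show "u + v \<in> closure D" if uv: "u \<in> closure D" "v \<in> closure D" for u v
    proof -
      obtain f g where "\<And>n. f n \<in> D" "f \<longlonglongrightarrow> u" "\<And>n. g n \<in> D" "g \<longlonglongrightarrow> v"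
        using uv unfolding closure_sequential by blast
      then show ?thesis unfolding closure_sequential
        by (intro exI[of _ "\<lambda>n. f n + g n"]) (auto intro: D_add tendsto_add)
    qed
    show "c *\<^sub>R u \<in> closure D" if u: "u \<in> closure D" for c u
    proof -
      obtain f where f: "\<And>n. f n \<in> D" "f \<longlonglongrightarrow> u"
        using u unfolding closure_sequential by blast
      have "\<exists>q::rat. \<bar>of_rat q - c\<bar> < 1 / Suc n" for n
      proof -
        obtain r where "c < r" "r < c + 1 / Suc n" "r \<in> \<rat>"
          using Rats_dense_in_real[of c "c + 1 / Suc n"] by auto
        moreover then obtain q :: rat where "r = of_rat q" by (auto elim!: Rats_cases)
        ultimately show ?thesis by (intro exI[of _ q]) (auto simp: abs_less_iff)
      qed
      then obtain q :: "nat \<Rightarrow> rat" where q: "\<And>n. \<bar>of_rat (q n) - c\<bar> < 1 / Suc n" by metis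
      have "(\<lambda>n. of_rat (q n) - c) \<longlonglongrightarrow> 0"
        by (rule tendsto_rabs_zero_cancel, rule tendsto_sandwich[OF _ _ tendsto_const LIMSEQ_Suc[OF lim_1_over_n]])
          (use q in \<open>auto intro!: always_eventually less_imp_le simp del: of_nat_Suc\<close>)
      then have "(\<lambda>n. of_rat (q n)) \<longlonglongrightarrow> c" by (simp add: LIM_zero_iff)
      with f show ?thesis unfolding closure_sequential
        by (intro exI[of _ "\<lambda>n. of_rat (q n) *\<^sub>R f n"]) (auto intro: D_scale tendsto_scaleR)
    qed
  qed
  moreover have "L2_of (indicator (a \<inter> ball 0 (real n))) \<in> closure D" if "a \<in> G" for a n
  proof -
    have "L2_of (indicator (a \<inter> ball 0 (real n))) \<in> S" using that by (auto simp: S_def)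
    then have "L2_of (indicator (a \<inter> ball 0 (real n))) \<in> D"
      unfolding D_def by (intro image_eqI[of _ _ "[(1, L2_of (indicator (a \<inter> ball 0 (real n))))]"]) auto
    then show ?thesis using closure_subset by blast
  qed
  ultimately have "closure D = UNIV"
    by (intro L2_subspace_dense[OF _ _ UG \<open>Int_stable G\<close> sG]) auto
  with cD show ?thesis by blast
qed

instance L2 :: (euclidean_space) second_countable_topology
proof
  obtain D :: "'a L2 set" where D: "countable D" "closure D = UNIV"
    using L2_separable by blast
  define B where "B = (\<lambda>(d, n). ball d (1 / Suc n)) ` (D \<times> UNIV)"
  have "topological_basis B"
  proof (rule topological_basisI)
    fix U :: "'a L2 set" and x assume "open U" "x \<in> U"
    then obtain e where e: "e > 0" "ball x e \<subseteq> U" by (auto simp: open_contains_ball)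
    obtain n where n: "1 / real (Suc n) < e / 2" using nat_approx_posE[of "e / 2"] e by auto
    obtain d where d: "d \<in> D" "dist d x < 1 / Suc n"
      using D(2) closure_approachable[of x D] by (metis UNIV_I divide_pos_pos of_nat_0_less_iff zero_less_Suc zero_less_one)
    have "ball d (1 / Suc n) \<subseteq> ball x e"
    proof
      fix z assume "z \<in> ball d (1 / Suc n)"
      then show "z \<in> ball x e"
        using dist_triangle[of x z d] d(2) n by (simp add: dist_commute del: of_nat_Suc)
    qed
    then show "\<exists>b\<in>B. x \<in> b \<and> b \<subseteq> U"
      using d e by (intro bexI[of _ "ball d (1 / Suc n)"]) (auto simp: B_def simp del: of_nat_Suc)
  qed (auto simp: B_def)
  moreover have "countable B" unfolding B_def using D(1) by auto
  ultimately show "\<exists>B::'a L2 set set. countable B \<and> open = generate_topology B"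
    by (blast intro: topological_basis_imp_subbasis)
qed


section \<open>The spaces $L^2(A)$\<close>

text \<open>\<open>L\<^sup>2(A)\<close> is identified, through extension by zero, with the closed subspace of those
  elements of \<open>L\<^sup>2\<close> of the whole space that vanish almost everywhere outside \<open>A\<close>.\<close>

definition L2_on :: "'a::euclidean_space set \<Rightarrow> 'a L2 set" where
  "L2_on A = {u. AE x in lborel. x \<notin> A \<longrightarrow> rep_L2 u x = 0}"

definition norm_on :: "'a::euclidean_space set \<Rightarrow> 'a L2 \<Rightarrow> real" where
  "norm_on A u = sqrt (LINT x:A|lborel. (rep_L2 u x)\<^sup>2)"


section \<open>Domains with boundary of class $C^2$\<close>

definition C2_function :: "('a::euclidean_space \<Rightarrow> real) \<Rightarrow> bool" where
  "C2_function g \<longleftrightarrow>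
    (\<exists>(g' :: 'a \<Rightarrow> 'a \<Rightarrow>\<^sub>L real) (g'' :: 'a \<Rightarrow> 'a \<Rightarrow>\<^sub>L ('a \<Rightarrow>\<^sub>L real)).
      (\<forall>x. (g has_derivative blinfun_apply (g' x)) (at x)) \<and>
      (\<forall>x. (g' has_derivative blinfun_apply (g'' x)) (at x)) \<and>
      continuous_on UNIV g'')"

text \<open>Near each boundary point, \<open>\<Omega>\<close> is the strict epigraph, in the direction of a unit vector
  \<open>e\<close>, of a \<open>C\<^sup>2\<close> function of the remaining \<open>d - 1\<close> orthogonal coordinates. Such a function is
  given here as a function \<open>g\<close> on the whole space that is only evaluated at the orthogonal
  projection \<open>y - (y \<bullet> e) *\<^sub>R e\<close> of \<open>y\<close> onto the hyperplane \<open>e\<^sup>\<bottom>\<close>; for \<open>d = 1\<close> it is a constant.\<close>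

definition C2_boundary :: "'a::euclidean_space set \<Rightarrow> bool" where
  "C2_boundary \<Omega> \<longleftrightarrow>
    (\<forall>x\<in>frontier \<Omega>. \<exists>r>0. \<exists>e g. norm e = 1 \<and> C2_function g \<and>
      \<Omega> \<inter> ball x r = {y \<in> ball x r. g (y - (y \<bullet> e) *\<^sub>R e) < y \<bullet> e})"

definition bounded_C2_domain :: "'a::euclidean_space set \<Rightarrow> bool" where
  "bounded_C2_domain \<Omega> \<longleftrightarrow>
    open \<Omega> \<and> connected \<Omega> \<and> \<Omega> \<noteq> {} \<and> bounded \<Omega> \<and> C2_boundary \<Omega>"


section \<open>The operator and its semigroup\<close>

text \<open>A densely defined linear operator \<open>P\<close> with domain \<open>D\<close> in the Hilbert space \<open>H\<close> (a closed
  subspace of the ambient type) that coincides, domain included, with its adjoint. The values of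
  \<open>P\<close> outside \<open>D\<close> are irrelevant.\<close>

definition self_adjoint_on ::
    "'h::real_inner set \<Rightarrow> 'h set \<Rightarrow> ('h \<Rightarrow> 'h) \<Rightarrow> bool" where
  "self_adjoint_on H D P \<longleftrightarrow>
    subspace D \<and> D \<subseteq> H \<and> H \<subseteq> closure D \<and> P ` D \<subseteq> H \<and>
    (\<forall>u\<in>D. \<forall>v\<in>D. P (u + v) = P u + P v) \<and>
    (\<forall>c. \<forall>u\<in>D. P (c *\<^sub>R u) = c *\<^sub>R P u) \<and>
    (\<forall>v\<in>H. \<forall>w\<in>H. (\<forall>u\<in>D. P u \<bullet> v = u \<bullet> w) \<longleftrightarrow> v \<in> D \<and> P v = w)"

definition graph_norm :: "('h::real_inner \<Rightarrow> 'h) \<Rightarrow> 'h \<Rightarrow> real" where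
  "graph_norm P u = sqrt ((norm u)\<^sup>2 + (norm (P u))\<^sup>2)"

definition graph_isomorphism ::
    "'h::real_inner set \<Rightarrow> 'h set \<Rightarrow> ('h \<Rightarrow> 'h) \<Rightarrow> bool" where
  "graph_isomorphism H D P \<longleftrightarrow>
    bij_betw P D H \<and>
    (\<exists>c. \<forall>u\<in>D. norm (P u) \<le> c * graph_norm P u) \<and>
    (\<exists>c. \<forall>u\<in>D. graph_norm P u \<le> c * norm (P u))"

definition compact_inverse ::
    "'h::real_inner set \<Rightarrow> 'h set \<Rightarrow> ('h \<Rightarrow> 'h) \<Rightarrow> bool" where
  "compact_inverse H D P \<longleftrightarrow>
    (\<forall>B\<subseteq>H. bounded B \<longrightarrow> compact (closure (inv_into D P ` B)))"

definition admissible_operator ::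
    "'h::real_inner set \<Rightarrow> 'h set \<Rightarrow> ('h \<Rightarrow> 'h) \<Rightarrow> bool" where
  "admissible_operator H D P \<longleftrightarrow>
    self_adjoint_on H D P \<and> graph_isomorphism H D P \<and> compact_inverse H D P \<and>
    (\<forall>u\<in>D. u \<noteq> 0 \<longrightarrow> P u \<bullet> u > 0)"

text \<open>The eigenvalues, in nondecreasing order and with multiplicity, and an orthonormal basis of
  eigenvectors; indices start at \<open>0\<close> instead of \<open>1\<close>.\<close>

definition eigenbasis ::
    "'h::real_inner set \<Rightarrow> 'h set \<Rightarrow> ('h \<Rightarrow> 'h) \<Rightarrow> (nat \<Rightarrow> real) \<Rightarrow> (nat \<Rightarrow> 'h) \<Rightarrow> bool" where
  "eigenbasis H D P \<mu> \<Phi> \<longleftrightarrow>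
    0 < \<mu> 0 \<and> mono \<mu> \<and> filterlim \<mu> at_top sequentially \<and>
    (\<forall>j. \<Phi> j \<in> D \<and> P (\<Phi> j) = \<mu> j *\<^sub>R \<Phi> j) \<and>
    (\<forall>i j. \<Phi> i \<bullet> \<Phi> j = (if i = j then 1 else 0)) \<and>
    closure (span (range \<Phi>)) = H"

text \<open>\<open>heat \<mu> \<Phi> t v\<close> is \<open>e\<^bsup>-tP\<^esup> v\<close>, for \<open>t \<ge> 0\<close>.\<close>

definition heat :: "(nat \<Rightarrow> real) \<Rightarrow> (nat \<Rightarrow> 'h::real_inner) \<Rightarrow> real \<Rightarrow> 'h \<Rightarrow> 'h" where
  "heat \<mu> \<Phi> t v = (\<Sum>j. exp (- \<mu> j * t) *\<^sub>R ((v \<bullet> \<Phi> j) *\<^sub>R \<Phi> j))"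


section \<open>The four observability statements\<close>

definition spectral_inequality ::
    "'a::euclidean_space set \<Rightarrow> real \<Rightarrow> (nat \<Rightarrow> real) \<Rightarrow> (nat \<Rightarrow> 'a L2) \<Rightarrow> bool" where
  "spectral_inequality \<omega> \<sigma> \<mu> \<Phi> \<longleftrightarrow>
    (\<exists>C>0. \<forall>\<Lambda>>0. \<forall>a :: nat \<Rightarrow> real.
      (\<Sum>j | \<mu> j \<le> \<Lambda>. \<bar>a j\<bar>\<^sup>2) \<le>
        exp (C * (1 + \<Lambda> powr \<sigma>)) *
        (LINT x:\<omega>|lborel. \<bar>rep_L2 (\<Sum>j | \<mu> j \<le> \<Lambda>. a j *\<^sub>R \<Phi> j) x\<bar>\<^sup>2))"

definition interpolation_observability ::
    "'a::euclidean_space set \<Rightarrow> 'a set \<Rightarrow> real \<Rightarrow> (nat \<Rightarrow> real) \<Rightarrow> (nat \<Rightarrow> 'a L2) \<Rightarrow> bool" where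
  "interpolation_observability \<Omega> \<omega> \<sigma> \<mu> \<Phi> \<longleftrightarrow>
    (\<exists>C>0. \<forall>\<theta> t. \<forall>u0\<in>L2_on \<Omega>. 0 < \<theta> \<longrightarrow> \<theta> < 1 \<longrightarrow> 0 < t \<longrightarrow>
      norm (heat \<mu> \<Phi> t u0) \<le>
        exp (C * (1 + (1 / (\<theta> * t)) powr (\<sigma> / (1 - \<sigma>)))) *
        norm u0 powr \<theta> * norm_on \<omega> (heat \<mu> \<Phi> t u0) powr (1 - \<theta>))"

definition approximate_observability ::
    "'a::euclidean_space set \<Rightarrow> 'a set \<Rightarrow> real \<Rightarrow> (nat \<Rightarrow> real) \<Rightarrow> (nat \<Rightarrow> 'a L2) \<Rightarrow> bool" where
  "approximate_observability \<Omega> \<omega> \<sigma> \<mu> \<Phi> \<longleftrightarrow>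
    (\<exists>C>0. \<forall>\<epsilon> t. \<forall>u0\<in>L2_on \<Omega>. 0 < \<epsilon> \<longrightarrow> 0 < t \<longrightarrow>
      (norm (heat \<mu> \<Phi> t u0))\<^sup>2 \<le>
        exp (C * (1 + (1 / t) powr (\<sigma> / (1 - \<sigma>)))) *
        exp ((C / t * ln (exp 1 + 1 / \<epsilon>)) powr \<sigma>) *
        (norm_on \<omega> (heat \<mu> \<Phi> t u0))\<^sup>2 + \<epsilon> * (norm u0)\<^sup>2)"

definition logarithmic_observability ::
    "'a::euclidean_space set \<Rightarrow> 'a set \<Rightarrow> real \<Rightarrow> (nat \<Rightarrow> real) \<Rightarrow> (nat \<Rightarrow> 'a L2) \<Rightarrow> bool" where
  "logarithmic_observability \<Omega> \<omega> \<sigma> \<mu> \<Phi> \<longleftrightarrow>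
    (\<exists>C>0. \<forall>t. \<forall>u0\<in>L2_on \<Omega> - {0}. 0 < t \<longrightarrow>
      norm (heat \<mu> \<Phi> t u0) \<le>
        exp (C * (1 + (1 / t) powr (\<sigma> / (1 - \<sigma>)))) *
        exp ((C / t * ln (norm u0 / norm (heat \<mu> \<Phi> t u0))) powr \<sigma>) *
        norm_on \<omega> (heat \<mu> \<Phi> t u0))"


section \<open>Controlled solutions\<close>

text \<open>The time slice, at time \<open>t\<close>, of the extension of \<open>f\<close> by zero outside \<open>\<omega> \<times> E\<close>. By Fubini the
  slice is square-integrable for almost every \<open>t\<close>, and a change of representative of \<open>f\<close> affects
  it for a null set of \<open>t\<close> only.\<close>

definition control_source ::
    "'a::euclidean_space set \<Rightarrow> real set \<Rightarrow> ('a \<times> real) L2 \<Rightarrow> real \<Rightarrow> 'a L2" where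
  "control_source \<omega> E f t = L2_of (\<lambda>x. indicator (\<omega> \<times> E) (x, t) * rep_L2 f (x, t))"

text \<open>The solution in \<open>C([0,T];H)\<close> of \<open>y' + P y = F\<close>, \<open>y 0 = y0\<close>, given by Duhamel's formula with a
  Bochner integral. Integrability is required explicitly, since non-integrable functions have
  integral \<open>0\<close>.\<close>

definition duhamel_solution ::
    "'h::{real_inner, banach, second_countable_topology} set \<Rightarrow> (nat \<Rightarrow> real) \<Rightarrow> (nat \<Rightarrow> 'h) \<Rightarrow>
      real \<Rightarrow> 'h \<Rightarrow> (real \<Rightarrow> 'h) \<Rightarrow> (real \<Rightarrow> 'h) \<Rightarrow> bool" where
  "duhamel_solution H \<mu> \<Phi> T y0 F y \<longleftrightarrow>
    continuous_on {0..T} y \<and> y ` {0..T} \<subseteq> H \<and>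
    (\<forall>t\<in>{0..T}. set_integrable lebesgue {0..t} (\<lambda>s. heat \<mu> \<Phi> (t - s) (F s)) \<and>
      y t = heat \<mu> \<Phi> t y0 + (LINT s:{0..t}|lebesgue. heat \<mu> \<Phi> (t - s) (F s)))"

end

theory Submission
  imports Defs
begin

text \<open>Each of (ii)--(iv) gives back the spectral inequality (i), so a control is built from (i) by the
  method of Lebeau and Robbiano: active phases kill the modes below a frequency \<open>\<Lambda>\<close> at the cost
  \<open>exp (C * (1 + \<Lambda>\<^sup>\<sigma>))\<close>, and passive phases of length \<open>\<tau>\<close> then gain the factor \<open>exp (- \<Lambda> * \<tau>)\<close>.
  The phases are separated by the quantiles of the Lebesgue measure on \<open>E\<close> rather than by times near a
  density point: the \<open>k\<close>-th phase meets \<open>E\<close> in a set of measure \<open>|E| / 2\<^sup>k\<close>, and in particular it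
  lasts at least that long. With frequencies \<open>q\<^sup>n\<close> for a suitable \<open>q\<close> the gains beat the costs, the
  controls have a finite total cost, and the state tends to \<open>0\<close> along the quantiles.\<close>

section \<open>The diagonal semigroup\<close>

text \<open>Since E is merely measurable, no time interval need lie in it, and the control has to
  act through the measure of E alone. Finitely many modes allow this: each one evolves by an
  explicit exponential, which the control can compensate instant by instant. The spectral inequality
  then enters only as a norm bound for functions supported in \<omega> that are biorthogonal to the
  low modes. The frequencies come from comparing exponents. Killing the modes up to
  \<open>q ^ n\<close> costs an exponent of order \<open>(q ^ n) powr \<sigma>\<close>, whereas the
  following passive phase, of length at least \<open>m / 4 ^ (n + 1)\<close> with \<open>m\<close>
  the measure of E, gains \<open>q ^ n * m / 4 ^ (n + 1)\<close>. With
  \<open>q = 8 powr (1 / (1 - \<sigma>))\<close> one has \<open>q = 8 * q powr \<sigma>\<close>, so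
  gain over cost grows like \<open>(8 / 4) ^ n\<close>; a base above 4 is forced by the shrinking of
  the phases. A second difficulty is that the control must be one element of the space over \<omega>
  x E, while the semigroup acts on classes at each time; the control is therefore carried along both
  as a function of (x, s) and as a path of classes.\<close>

locale heat_system =
  fixes \<mu> :: "nat \<Rightarrow> real"
    and \<Phi> :: "nat \<Rightarrow> 'h::{real_inner, banach, second_countable_topology}"
  assumes orthonormal: "\<And>i j. \<Phi> i \<bullet> \<Phi> j = (if i = j then 1 else 0)"
    and eigenvalue_nonneg: "\<And>j. 0 \<le> \<mu> j"
begin

definition state_space :: "'h set" where
  "state_space = closure (span (range \<Phi>))"

lemma inner_sum_basis:
  assumes "finite J"
  shows "(\<Sum>j\<in>J. a j *\<^sub>R \<Phi> j) \<bullet> \<Phi> k = (if k \<in> J then a k else 0)"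
proof -
  have "(\<Sum>j\<in>J. a j *\<^sub>R \<Phi> j) \<bullet> \<Phi> k = (\<Sum>j\<in>J. if j = k then a j else 0)"
    by (simp add: inner_sum_left orthonormal if_distrib cong: if_cong)
  then show ?thesis using assms by simp
qed

lemma norm_sum_basis:
  assumes "finite J"
  shows "(norm (\<Sum>j\<in>J. a j *\<^sub>R \<Phi> j))\<^sup>2 = (\<Sum>j\<in>J. (a j)\<^sup>2)"
proof -
  have "(norm (\<Sum>j\<in>J. a j *\<^sub>R \<Phi> j))\<^sup>2 = (\<Sum>j\<in>J. a j * ((\<Sum>j\<in>J. a j *\<^sub>R \<Phi> j) \<bullet> \<Phi> j))"
    unfolding power2_norm_eq_inner by (subst inner_sum_right) simp
  also have "\<dots> = (\<Sum>j\<in>J. (a j)\<^sup>2)"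
    using assms by (intro sum.cong) (auto simp: inner_sum_basis power2_eq_square)
  finally show ?thesis .
qed

lemma bessel:
  assumes "finite J"
  shows "(\<Sum>j\<in>J. (v \<bullet> \<Phi> j)\<^sup>2) \<le> (norm v)\<^sup>2"
proof -
  define p where "p = (\<Sum>j\<in>J. (v \<bullet> \<Phi> j) *\<^sub>R \<Phi> j)"
  have pp: "p \<bullet> p = (\<Sum>j\<in>J. (v \<bullet> \<Phi> j)\<^sup>2)"
    using norm_sum_basis[OF assms, of "\<lambda>j. v \<bullet> \<Phi> j"] by (simp add: p_def power2_norm_eq_inner)
  have vp: "v \<bullet> p = (\<Sum>j\<in>J. (v \<bullet> \<Phi> j)\<^sup>2)"
    by (simp add: p_def inner_sum_right power2_eq_square)
  have "0 \<le> (v - p) \<bullet> (v - p)" by simp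
  also have "\<dots> = v \<bullet> v - 2 * (v \<bullet> p) + p \<bullet> p"
    by (simp add: inner_diff_left inner_diff_right inner_commute)
  finally show ?thesis using pp vp by (simp add: power2_norm_eq_inner)
qed

lemma summable_coefficients: "summable (\<lambda>j. (v \<bullet> \<Phi> j)\<^sup>2)"
  by (rule bounded_imp_summable[of _ "(norm v)\<^sup>2"]) (auto intro: bessel)

text \<open>Such a series need not converge absolutely; orthogonality turns its Cauchy tails into
  tails of the scalar series of squares.\<close>

lemma summable_basis:
  assumes "summable (\<lambda>j. (a j)\<^sup>2)"
  shows "summable (\<lambda>j. a j *\<^sub>R \<Phi> j)"
  unfolding summable_Cauchy
proof (intro allI impI)
  fix e :: real assume "e > 0"
  then have "e\<^sup>2 > 0" by simp
  then obtain N where N: "\<And>m n. m \<ge> N \<Longrightarrow> norm (sum (\<lambda>j. (a j)\<^sup>2) {m..<n}) < e\<^sup>2"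
    using assms unfolding summable_Cauchy by blast
  have "norm (\<Sum>j\<in>{m..<n}. a j *\<^sub>R \<Phi> j) < e" if "m \<ge> N" for m n
  proof -
    have "(norm (\<Sum>j\<in>{m..<n}. a j *\<^sub>R \<Phi> j))\<^sup>2 < e\<^sup>2"
      using N[OF that, of n] by (simp add: norm_sum_basis sum_nonneg)
    then show ?thesis using \<open>e > 0\<close> by (meson less_eq_real_def power2_less_imp_less)
  qed
  then show "\<exists>N. \<forall>m\<ge>N. \<forall>n. norm (\<Sum>j\<in>{m..<n}. a j *\<^sub>R \<Phi> j) < e" by blast
qed

lemma
  assumes "summable (\<lambda>j. (a j)\<^sup>2)"
  shows inner_suminf_basis: "(\<Sum>j. a j *\<^sub>R \<Phi> j) \<bullet> \<Phi> k = a k"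
    and norm_suminf_basis: "(norm (\<Sum>j. a j *\<^sub>R \<Phi> j))\<^sup>2 = (\<Sum>j. (a j)\<^sup>2)"
    and suminf_basis_in_state_space: "(\<Sum>j. a j *\<^sub>R \<Phi> j) \<in> state_space"
proof -
  have lim: "(\<lambda>n. \<Sum>j<n. a j *\<^sub>R \<Phi> j) \<longlonglongrightarrow> (\<Sum>j. a j *\<^sub>R \<Phi> j)"
    using summable_LIMSEQ[OF summable_basis[OF assms]] .
  have "(\<lambda>n. (\<Sum>j<n. a j *\<^sub>R \<Phi> j) \<bullet> \<Phi> k) \<longlonglongrightarrow> (\<Sum>j. a j *\<^sub>R \<Phi> j) \<bullet> \<Phi> k"
    by (intro tendsto_intros lim)
  moreover have "(\<lambda>n. (\<Sum>j<n. a j *\<^sub>R \<Phi> j) \<bullet> \<Phi> k) \<longlonglongrightarrow> a k"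
    by (rule tendsto_eventually)
      (auto simp: inner_sum_basis eventually_sequentially intro!: exI[of _ "Suc k"])
  ultimately show "(\<Sum>j. a j *\<^sub>R \<Phi> j) \<bullet> \<Phi> k = a k"
    by (rule LIMSEQ_unique)
  have "(\<lambda>n. (norm (\<Sum>j<n. a j *\<^sub>R \<Phi> j))\<^sup>2) \<longlonglongrightarrow> (norm (\<Sum>j. a j *\<^sub>R \<Phi> j))\<^sup>2"
    by (intro tendsto_intros lim)
  then have "(\<lambda>n. \<Sum>j<n. (a j)\<^sup>2) \<longlonglongrightarrow> (norm (\<Sum>j. a j *\<^sub>R \<Phi> j))\<^sup>2"
    by (simp add: norm_sum_basis)
  with summable_LIMSEQ[OF assms]
  show "(norm (\<Sum>j. a j *\<^sub>R \<Phi> j))\<^sup>2 = (\<Sum>j. (a j)\<^sup>2)"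
    by (rule LIMSEQ_unique[symmetric])
  have "(\<Sum>j<n. a j *\<^sub>R \<Phi> j) \<in> span (range \<Phi>)" for n
    by (intro span_sum span_scale span_base) auto
  with lim show "(\<Sum>j. a j *\<^sub>R \<Phi> j) \<in> state_space"
    unfolding state_space_def closure_sequential
    by (intro exI[of _ "\<lambda>n. \<Sum>j<n. a j *\<^sub>R \<Phi> j"]) simp
qed

lemma summable_heat_coefficients:
  assumes "0 \<le> t"
  shows "summable (\<lambda>j. (exp (- \<mu> j * t) * (v \<bullet> \<Phi> j))\<^sup>2)"
proof (rule summable_comparison_test'[OF summable_coefficients[of v], of 0])
  fix j :: nat
  have "exp (- \<mu> j * t) \<le> 1" using assms eigenvalue_nonneg[of j] by simp
  then have "\<bar>exp (- \<mu> j * t) * (v \<bullet> \<Phi> j)\<bar> \<le> \<bar>v \<bullet> \<Phi> j\<bar>"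
    by (simp add: abs_mult mult_left_le_one_le)
  then show "norm ((exp (- \<mu> j * t) * (v \<bullet> \<Phi> j))\<^sup>2) \<le> (v \<bullet> \<Phi> j)\<^sup>2"
    by (simp add: abs_le_square_iff)
qed

lemma heat_eq: "heat \<mu> \<Phi> t v = (\<Sum>j. (exp (- \<mu> j * t) * (v \<bullet> \<Phi> j)) *\<^sub>R \<Phi> j)"
  by (simp add: heat_def)

lemma
  assumes "0 \<le> t"
  shows inner_heat: "heat \<mu> \<Phi> t v \<bullet> \<Phi> k = exp (- \<mu> k * t) * (v \<bullet> \<Phi> k)"
    and norm_heat: "(norm (heat \<mu> \<Phi> t v))\<^sup>2 = (\<Sum>j. (exp (- \<mu> j * t) * (v \<bullet> \<Phi> j))\<^sup>2)"
    and heat_in_state_space: "heat \<mu> \<Phi> t v \<in> state_space"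
  using inner_suminf_basis norm_suminf_basis suminf_basis_in_state_space
    summable_heat_coefficients[OF assms, of v]
  unfolding heat_eq by auto

lemma suminf_coefficients_le: "(\<Sum>j. (v \<bullet> \<Phi> j)\<^sup>2) \<le> (norm v)\<^sup>2"
  by (rule suminf_le_const[OF summable_coefficients]) (auto intro: bessel)

text \<open>The gain of a passive phase: only modes above \<open>\<Lambda>\<close> are left, and
  each coefficient shrinks at least by the stated factor.\<close>

lemma heat_decay:
  assumes "0 \<le> t" and low: "\<And>j. \<mu> j \<le> \<Lambda> \<Longrightarrow> v \<bullet> \<Phi> j = 0"
  shows "norm (heat \<mu> \<Phi> t v) \<le> exp (- \<Lambda> * t) * norm v"
proof -
  have "(norm (heat \<mu> \<Phi> t v))\<^sup>2 \<le> (\<Sum>j. (exp (- \<Lambda> * t))\<^sup>2 * (v \<bullet> \<Phi> j)\<^sup>2)"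
    unfolding norm_heat[OF assms(1)]
  proof (rule suminf_le[OF _ summable_heat_coefficients[OF assms(1)]])
    show "summable (\<lambda>j. (exp (- \<Lambda> * t))\<^sup>2 * (v \<bullet> \<Phi> j)\<^sup>2)"
      by (intro summable_mult summable_coefficients)
    show "(exp (- \<mu> j * t) * (v \<bullet> \<Phi> j))\<^sup>2 \<le> (exp (- \<Lambda> * t))\<^sup>2 * (v \<bullet> \<Phi> j)\<^sup>2" for j
    proof (cases "\<mu> j \<le> \<Lambda>")
      case False
      then have "exp (- \<mu> j * t) \<le> exp (- \<Lambda> * t)" using assms(1) by (simp add: mult_right_mono)
      then show ?thesis
        unfolding power_mult_distrib by (intro mult_right_mono power_mono) auto
    qed (simp add: low)
  qed
  also have "\<dots> = (exp (- \<Lambda> * t))\<^sup>2 * (\<Sum>j. (v \<bullet> \<Phi> j)\<^sup>2)"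
    by (rule suminf_mult[OF summable_coefficients])
  also have "\<dots> \<le> (exp (- \<Lambda> * t))\<^sup>2 * (norm v)\<^sup>2"
    by (intro mult_left_mono suminf_coefficients_le) auto
  finally have "(norm (heat \<mu> \<Phi> t v))\<^sup>2 \<le> (exp (- \<Lambda> * t) * norm v)\<^sup>2"
    by (simp add: power_mult_distrib)
  then show ?thesis by (rule power2_le_imp_le) simp
qed

lemma heat_contraction:
  assumes t: "0 \<le> t"
  shows "norm (heat \<mu> \<Phi> t v) \<le> norm v"
proof -
  have "(norm (heat \<mu> \<Phi> t v))\<^sup>2 \<le> (\<Sum>j. (v \<bullet> \<Phi> j)\<^sup>2)"
    unfolding norm_heat[OF t]
  proof (rule suminf_le[OF _ summable_heat_coefficients[OF t] summable_coefficients])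
    fix j
    have "exp (- \<mu> j * t) \<le> 1" using t eigenvalue_nonneg[of j] by simp
    then have "\<bar>exp (- \<mu> j * t) * (v \<bullet> \<Phi> j)\<bar> \<le> \<bar>v \<bullet> \<Phi> j\<bar>"
      by (simp add: abs_mult mult_left_le_one_le)
    then show "(exp (- \<mu> j * t) * (v \<bullet> \<Phi> j))\<^sup>2 \<le> (v \<bullet> \<Phi> j)\<^sup>2"
      by (simp add: abs_le_square_iff)
  qed
  also note suminf_coefficients_le
  finally show ?thesis by (rule power2_le_imp_le) simp
qed

text \<open>Needed to move the semigroup through the Bochner integral in Duhamel's formula.\<close>

lemma bounded_linear_heat:
  assumes t: "0 \<le> t"
  shows "bounded_linear (heat \<mu> \<Phi> t)"
proof (rule bounded_linear_intro[where K=1])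
  show "heat \<mu> \<Phi> t (u + v) = heat \<mu> \<Phi> t u + heat \<mu> \<Phi> t v" for u v
    unfolding heat_eq
    by (subst suminf_add[OF summable_basis summable_basis])
      (simp_all only: summable_heat_coefficients[OF t] inner_add_left distrib_left scaleR_left_distrib)
  show "heat \<mu> \<Phi> t (c *\<^sub>R v) = c *\<^sub>R heat \<mu> \<Phi> t v" for c v
    unfolding heat_eq
    by (subst suminf_scaleR_right[OF summable_basis])
      (simp_all only: summable_heat_coefficients[OF t] inner_scaleR_left scaleR_scaleR mult.left_commute)
  show "norm (heat \<mu> \<Phi> t v) \<le> norm v * 1" for v
    using heat_contraction[OF t] by simp
qed

lemma heat_heat: "0 \<le> s \<Longrightarrow> heat \<mu> \<Phi> t (heat \<mu> \<Phi> s v) = heat \<mu> \<Phi> (t + s) v"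
  unfolding heat_eq[of t] heat_eq[of "t + s"]
  by (simp only: inner_heat distrib_left exp_add mult.assoc)

lemma heat_basis: "heat \<mu> \<Phi> t (\<Phi> k) = exp (- \<mu> k * t) *\<^sub>R \<Phi> k"
proof -
  have "(\<lambda>j. (exp (- \<mu> j * t) * (\<Phi> k \<bullet> \<Phi> j)) *\<^sub>R \<Phi> j)
      = (\<lambda>j. if j = k then exp (- \<mu> k * t) *\<^sub>R \<Phi> k else 0)"
    by (auto simp: orthonormal)
  then show ?thesis
    unfolding heat_eq using suminf_finite[of "{k}" "\<lambda>j. if j = k then exp (- \<mu> k * t) *\<^sub>R \<Phi> k else 0"]
    by simp
qed

text \<open>The difference is orthogonal to a closed subspace that contains it.\<close>

lemma state_space_eqI:
  assumes "u \<in> state_space" "v \<in> state_space" "\<And>j. u \<bullet> \<Phi> j = v \<bullet> \<Phi> j"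
  shows "u = v"
proof -
  have "span (range \<Phi>) \<subseteq> {w. (u - v) \<bullet> w = 0}"
  proof (rule span_minimal)
    show "range \<Phi> \<subseteq> {w. (u - v) \<bullet> w = 0}" using assms(3) by (auto simp: inner_diff_left)
    show "subspace {w. (u - v) \<bullet> w = 0}" by (rule subspace_hyperplane)
  qed
  then have "state_space \<subseteq> {w. (u - v) \<bullet> w = 0}"
    unfolding state_space_def by (intro closure_minimal closed_hyperplane)
  with assms(1,2) have "(u - v) \<bullet> u = 0" "(u - v) \<bullet> v = 0" by auto
  then have "(u - v) \<bullet> (u - v) = 0" by (simp add: inner_diff_right)
  then show ?thesis by simp
qed

lemma heat_0:
  assumes "v \<in> state_space" shows "heat \<mu> \<Phi> 0 v = v"
  by (rule state_space_eqI[OF heat_in_state_space assms]) (simp_all add: inner_heat)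

lemma heat_finite_sum:
  "0 \<le> t \<Longrightarrow> heat \<mu> \<Phi> t (\<Sum>j\<in>J. a j *\<^sub>R \<Phi> j) = (\<Sum>j\<in>J. (a j * exp (- \<mu> j * t)) *\<^sub>R \<Phi> j)"
  using bounded_linear.linear[OF bounded_linear_heat[of t]]
  by (simp add: linear_sum linear_scale heat_basis)

text \<open>The partial sums converge uniformly in time: the error at time \<open>t\<close> is the
  semigroup applied to the error at time 0, and the semigroup is a contraction.\<close>

lemma continuous_on_heat: "continuous_on {0..} (\<lambda>t. heat \<mu> \<Phi> t v)"
proof (rule uniform_limit_theorem)
  define S where "S n t = (\<Sum>j<n. ((v \<bullet> \<Phi> j) * exp (- \<mu> j * t)) *\<^sub>R \<Phi> j)" for n t
  show "\<forall>\<^sub>F n in sequentially. continuous_on {0..} (S n)"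
    unfolding S_def by (intro always_eventually allI continuous_intros)
  have "(\<lambda>n. S n 0) \<longlonglongrightarrow> heat \<mu> \<Phi> 0 v"
    using summable_LIMSEQ[OF summable_basis[OF summable_heat_coefficients[of 0 v]]]
    unfolding S_def heat_eq by simp
  then have lim: "(\<lambda>n. dist (S n 0) (heat \<mu> \<Phi> 0 v)) \<longlonglongrightarrow> 0"
    by (simp add: tendsto_dist_iff[symmetric])
  show "uniform_limit {0..} S (\<lambda>t. heat \<mu> \<Phi> t v) sequentially"
  proof (rule uniform_limitI)
    fix e :: real assume "e > 0"
    with lim have "\<forall>\<^sub>F n in sequentially. dist (S n 0) (heat \<mu> \<Phi> 0 v) < e"
      by (rule order_tendstoD(2))
    then show "\<forall>\<^sub>F n in sequentially. \<forall>t\<in>{0..}. dist (S n t) (heat \<mu> \<Phi> t v) < e"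
    proof eventually_elim
      case (elim n)
      show ?case
      proof
        fix t :: real assume "t \<in> {0..}"
        then have t: "0 \<le> t" by simp
        have "S n t - heat \<mu> \<Phi> t v = heat \<mu> \<Phi> t (S n 0 - heat \<mu> \<Phi> 0 v)"
          using t linear_diff[OF bounded_linear.linear[OF bounded_linear_heat[OF t]]]
          by (simp add: S_def heat_finite_sum heat_heat)
        then have "dist (S n t) (heat \<mu> \<Phi> t v) \<le> dist (S n 0) (heat \<mu> \<Phi> 0 v)"
          using heat_contraction[OF t] by (simp add: dist_norm)
        with elim show "dist (S n t) (heat \<mu> \<Phi> t v) < e" by simp
      qed
    qed
  qed
qed auto

end

section \<open>Duhamel's formula\<close>

lemma set_integral_bounded_linear:
  assumes "bounded_linear T" "set_integrable M A f"
  shows "(LINT s:A|M. T (f s)) = T (LINT s:A|M. f s)"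
proof -
  have "(LINT s:A|M. T (f s)) = (LINT s|M. T (indicator A s *\<^sub>R f s))"
    unfolding set_lebesgue_integral_def
    using assms(1) by (simp add: linear_scale bounded_linear.linear)
  then show ?thesis
    using integral_bounded_linear[OF assms(1) assms(2)[unfolded set_integrable_def]]
    by (simp add: set_lebesgue_integral_def)
qed

context heat_system
begin

lemma borel_measurable_heat_comp:
  assumes [measurable]: "F \<in> borel_measurable M" "g \<in> borel_measurable M"
    and nonneg: "\<And>s. 0 \<le> g s"
  shows "(\<lambda>s. heat \<mu> \<Phi> (g s) (F s)) \<in> borel_measurable M"
proof (rule borel_measurable_LIMSEQ_metric)
  show "(\<lambda>s. \<Sum>j<n. (exp (- \<mu> j * g s) * (F s \<bullet> \<Phi> j)) *\<^sub>R \<Phi> j) \<in> borel_measurable M" for n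
    by measurable
  show "(\<lambda>n. \<Sum>j<n. (exp (- \<mu> j * g s) * (F s \<bullet> \<Phi> j)) *\<^sub>R \<Phi> j) \<longlonglongrightarrow> heat \<mu> \<Phi> (g s) (F s)" for s
    unfolding heat_eq by (intro summable_LIMSEQ summable_basis summable_heat_coefficients nonneg)
qed

lemma borel_measurable_duhamel_kernel:
  assumes F: "F \<in> borel_measurable lebesgue" and A: "A \<in> sets lebesgue" "A \<subseteq> {..t}"
  shows "(\<lambda>s. indicator A s *\<^sub>R heat \<mu> \<Phi> (t - s) (F s)) \<in> borel_measurable lebesgue"
proof -
  \<comment> \<open>Truncating the elapsed time at 0 makes the heat series converge for every
    \<open>s\<close>; on \<open>A\<close> the truncation changes nothing.\<close>
  have "(\<lambda>s. indicator A s *\<^sub>R heat \<mu> \<Phi> (max 0 (t - s)) (F s)) \<in> borel_measurable lebesgue"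
  proof (intro borel_measurable_scaleR borel_measurable_heat_comp F)
    show "indicator A \<in> borel_measurable lebesgue" using A by simp
    show "(\<lambda>s. max 0 (t - s)) \<in> borel_measurable lebesgue"
      by (rule measurable_completion) measurable
  qed simp
  moreover have "indicator A s *\<^sub>R heat \<mu> \<Phi> (max 0 (t - s)) (F s) = indicator A s *\<^sub>R heat \<mu> \<Phi> (t - s) (F s)" for s
    using A(2) by (auto simp: indicator_def max_def)
  ultimately show ?thesis by simp
qed

lemma set_integrable_duhamel:
  assumes F: "integrable lebesgue F" and A: "A \<in> sets lebesgue" "A \<subseteq> {..t}"
  shows "set_integrable lebesgue A (\<lambda>s. heat \<mu> \<Phi> (t - s) (F s))"
  unfolding set_integrable_def
proof (rule Bochner_Integration.integrable_bound[OF F])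
  show "(\<lambda>s. indicator A s *\<^sub>R heat \<mu> \<Phi> (t - s) (F s)) \<in> borel_measurable lebesgue"
    using F by (intro borel_measurable_duhamel_kernel A) auto
  show "AE s in lebesgue. norm (indicator A s *\<^sub>R heat \<mu> \<Phi> (t - s) (F s)) \<le> norm (F s)"
    using A(2) by (intro AE_I2) (auto simp: indicator_def intro!: heat_contraction)
qed

text \<open>These describe what a source acting during \<open>A\<close> contributes to later states.
  The equalities move a bounded linear map, the semigroup or a coordinate, into the integral; the
  bound is contraction.\<close>

lemma
  assumes F: "integrable lebesgue F" and A: "A \<in> sets lebesgue" "A \<subseteq> {..t}"
  shows heat_duhamel: "t \<le> u \<Longrightarrow> heat \<mu> \<Phi> (u - t) (LINT s:A|lebesgue. heat \<mu> \<Phi> (t - s) (F s))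
      = (LINT s:A|lebesgue. heat \<mu> \<Phi> (u - s) (F s))"
    and inner_duhamel: "(LINT s:A|lebesgue. heat \<mu> \<Phi> (t - s) (F s)) \<bullet> \<Phi> k
      = (LINT s:A|lebesgue. exp (- \<mu> k * (t - s)) * (F s \<bullet> \<Phi> k))"
    and norm_duhamel: "norm (LINT s:A|lebesgue. heat \<mu> \<Phi> (t - s) (F s)) \<le> (LINT s:A|lebesgue. norm (F s))"
proof -
  note int = set_integrable_duhamel[OF F A]
  have As: "s \<in> A \<Longrightarrow> s \<le> t" for s using A by auto
  show "heat \<mu> \<Phi> (u - t) (LINT s:A|lebesgue. heat \<mu> \<Phi> (t - s) (F s))
      = (LINT s:A|lebesgue. heat \<mu> \<Phi> (u - s) (F s))" if "t \<le> u"
  proof -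
    have "heat \<mu> \<Phi> (u - t) (heat \<mu> \<Phi> (t - s) (F s)) = heat \<mu> \<Phi> (u - s) (F s)" if "s \<in> A" for s
      using As[OF that] by (simp add: heat_heat)
    then have "(LINT s:A|lebesgue. heat \<mu> \<Phi> (u - s) (F s))
        = (LINT s:A|lebesgue. heat \<mu> \<Phi> (u - t) (heat \<mu> \<Phi> (t - s) (F s)))"
      using A(1) by (intro set_lebesgue_integral_cong) auto
    then show ?thesis
      using set_integral_bounded_linear[OF bounded_linear_heat int, of "u - t"] that by simp
  qed
  show "(LINT s:A|lebesgue. heat \<mu> \<Phi> (t - s) (F s)) \<bullet> \<Phi> k
      = (LINT s:A|lebesgue. exp (- \<mu> k * (t - s)) * (F s \<bullet> \<Phi> k))"
    unfolding set_integral_bounded_linear[OF bounded_linear_inner_left int, symmetric]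
    using A by (auto intro!: set_lebesgue_integral_cong simp: inner_heat As)
  show "norm (LINT s:A|lebesgue. heat \<mu> \<Phi> (t - s) (F s)) \<le> (LINT s:A|lebesgue. norm (F s))"
    unfolding set_lebesgue_integral_def
  proof (rule order_trans[OF integral_norm_bound integral_mono])
    show "integrable lebesgue (\<lambda>s. norm (indicator A s *\<^sub>R heat \<mu> \<Phi> (t - s) (F s)))"
      using int unfolding set_integrable_def by (rule integrable_norm)
    show "integrable lebesgue (\<lambda>s. indicator A s *\<^sub>R norm (F s))"
      by (rule integrable_mult_indicator) (use A F in auto)
    show "norm (indicator A s *\<^sub>R heat \<mu> \<Phi> (t - s) (F s)) \<le> indicator A s *\<^sub>R norm (F s)" for s
      using As by (auto simp: indicator_def intro!: heat_contraction)
  qed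
qed

section \<open>The mild solution as a function of time\<close>

definition duhamel :: "'h \<Rightarrow> (real \<Rightarrow> 'h) \<Rightarrow> real \<Rightarrow> 'h" where
  "duhamel y0 F t = heat \<mu> \<Phi> t y0 + (LINT s:{0..t}|lebesgue. heat \<mu> \<Phi> (t - s) (F s))"

text \<open>Restart property: the state at time \<open>t\<close> serves as new initial datum. The
  second time set is half-open so that the two are disjoint.\<close>

lemma duhamel_split:
  assumes F: "integrable lebesgue F" and "0 \<le> t" "t \<le> u"
  shows "duhamel y0 F u = heat \<mu> \<Phi> (u - t) (duhamel y0 F t)
    + (LINT s:{t<..u}|lebesgue. heat \<mu> \<Phi> (u - s) (F s))"
proof -
  have "(LINT s:{0..u}|lebesgue. heat \<mu> \<Phi> (u - s) (F s))
      = (LINT s:{0..t} \<union> {t<..u}|lebesgue. heat \<mu> \<Phi> (u - s) (F s))"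
    using assms by (simp add: ivl_disj_un)
  also have "\<dots> = (LINT s:{0..t}|lebesgue. heat \<mu> \<Phi> (u - s) (F s))
      + (LINT s:{t<..u}|lebesgue. heat \<mu> \<Phi> (u - s) (F s))"
    by (rule set_integral_Un) (use assms in \<open>auto intro!: set_integrable_duhamel\<close>)
  also have "(LINT s:{0..t}|lebesgue. heat \<mu> \<Phi> (u - s) (F s))
      = heat \<mu> \<Phi> (u - t) (LINT s:{0..t}|lebesgue. heat \<mu> \<Phi> (t - s) (F s))"
    by (rule heat_duhamel[symmetric]) (use assms in auto)
  finally show ?thesis
    using assms linear_add[OF bounded_linear.linear[OF bounded_linear_heat[of "u - t"]]]
    by (simp add: duhamel_def heat_heat)
qed

text \<open>Restarting at \<open>t\<close> and stopping at \<open>t\<close> writes the state as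
  \<open>heat \<mu> \<Phi> 0\<close> of itself, and values of the semigroup lie in the closed
  span.\<close>

lemma duhamel_in_state_space:
  assumes F: "integrable lebesgue F" and "0 \<le> t"
  shows "duhamel y0 F t \<in> state_space"
proof -
  have "heat \<mu> \<Phi> 0 (duhamel y0 F t) = duhamel y0 F t"
    using duhamel_split[OF F assms(2) order_refl] by (simp add: set_lebesgue_integral_def)
  then show ?thesis using heat_in_state_space[of 0 "duhamel y0 F t"] by simp
qed

lemma continuous_on_duhamel:
  assumes F: "integrable lebesgue F"
  shows "continuous_on {0..} (duhamel y0 F)"
proof -
  have "continuous_on {0..} (\<lambda>t. LINT s:{0..t}|lebesgue. heat \<mu> \<Phi> (t - s) (F s))"
    unfolding continuous_on_sequentially comp_def
  proof (intro allI ballI impI, elim conjE)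
    fix X :: "nat \<Rightarrow> real" and t :: real
    assume t: "t \<in> {0..}" and X: "\<forall>n. X n \<in> {0..}" "X \<longlonglongrightarrow> t"
    show "(\<lambda>n. LINT s:{0..X n}|lebesgue. heat \<mu> \<Phi> (X n - s) (F s))
        \<longlonglongrightarrow> (LINT s:{0..t}|lebesgue. heat \<mu> \<Phi> (t - s) (F s))"
      unfolding set_lebesgue_integral_def
    proof (rule integral_dominated_convergence[where w="\<lambda>s. norm (F s)"])
      show "integrable lebesgue (\<lambda>s. norm (F s))" using F by simp
      show "(\<lambda>s. indicator {0..t} s *\<^sub>R heat \<mu> \<Phi> (t - s) (F s)) \<in> borel_measurable lebesgue" for t
        using F by (intro borel_measurable_duhamel_kernel) auto
      then show "(\<lambda>s. indicator {0..X n} s *\<^sub>R heat \<mu> \<Phi> (X n - s) (F s)) \<in> borel_measurable lebesgue" for n .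
      show "AE s in lebesgue. norm (indicator {0..X n} s *\<^sub>R heat \<mu> \<Phi> (X n - s) (F s)) \<le> norm (F s)" for n
        by (auto simp: indicator_def intro!: heat_contraction)
      \<comment> \<open>At \<open>s = t\<close> the indicators may oscillate along \<open>X\<close>;
        this single time is discarded.\<close>
      have "AE s in lebesgue. s \<noteq> t"
        by (rule AE_completion[OF AE_lborel_singleton])
      then show "AE s in lebesgue. (\<lambda>n. indicator {0..X n} s *\<^sub>R heat \<mu> \<Phi> (X n - s) (F s))
          \<longlonglongrightarrow> indicator {0..t} s *\<^sub>R heat \<mu> \<Phi> (t - s) (F s)"
      proof eventually_elim
        case (elim s)
        consider "t < s" | "s < 0" | "0 \<le> s" "s < t" using elim by linarith
        then show ?case
        proof cases
          case 1
          then have "\<forall>\<^sub>F n in sequentially. X n < s" using X(2) by (auto dest: order_tendstoD(2))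
          then have "\<forall>\<^sub>F n in sequentially. indicator {0..X n} s *\<^sub>R heat \<mu> \<Phi> (X n - s) (F s) = 0"
            by eventually_elim auto
          with 1 show ?thesis by (simp add: tendsto_eventually)
        next
          case 3
          then have ev: "\<forall>\<^sub>F n in sequentially. s < X n" using X(2) by (auto dest: order_tendstoD(1))
          have "(\<lambda>n. heat \<mu> \<Phi> (max 0 (X n - s)) (F s)) \<longlonglongrightarrow> heat \<mu> \<Phi> (max 0 (t - s)) (F s)"
            by (rule continuous_on_tendsto_compose[OF continuous_on_heat])
              (auto intro!: tendsto_intros X)
          then have "(\<lambda>n. heat \<mu> \<Phi> (max 0 (X n - s)) (F s)) \<longlonglongrightarrow> indicator {0..t} s *\<^sub>R heat \<mu> \<Phi> (t - s) (F s)"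
            using 3 by simp
          moreover have "\<forall>\<^sub>F n in sequentially. heat \<mu> \<Phi> (max 0 (X n - s)) (F s)
              = indicator {0..X n} s *\<^sub>R heat \<mu> \<Phi> (X n - s) (F s)"
            using ev by eventually_elim (use 3 in simp)
          ultimately show ?thesis by (rule Lim_transform_eventually)
        qed simp
      qed
    qed
  qed
  then show ?thesis
    unfolding duhamel_def by (intro continuous_intros continuous_on_heat)
qed

end

lemma (in heat_system) duhamel_cong_AE:
  assumes "integrable lebesgue F" "integrable lebesgue G" "A \<in> sets lebesgue" "A \<subseteq> {..t}"
    and "AE s in lebesgue. s \<in> A \<longrightarrow> F s = G s"
  shows "(LINT s:A|lebesgue. heat \<mu> \<Phi> (t - s) (F s)) = (LINT s:A|lebesgue. heat \<mu> \<Phi> (t - s) (G s))"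
  unfolding set_lebesgue_integral_def
proof (rule integral_cong_AE)
  show "AE s in lebesgue. indicator A s *\<^sub>R heat \<mu> \<Phi> (t - s) (F s) = indicator A s *\<^sub>R heat \<mu> \<Phi> (t - s) (G s)"
    using assms(5) by eventually_elim (auto simp: indicator_def)
qed (use assms in \<open>auto intro!: borel_measurable_duhamel_kernel\<close>)

text \<open>\<open>z\<close> holds the states produced phase by phase with the sources
  \<open>G n\<close>. The restart property identifies them, by induction, with the mild solution
  driven by \<open>F\<close> at the times \<open>a n\<close>. Sources enter only through integrals,
  which is why agreement almost everywhere is enough.\<close>

lemma (in heat_system) null_control:
  fixes F :: "real \<Rightarrow> 'h" and a :: "nat \<Rightarrow> real" and G :: "nat \<Rightarrow> real \<Rightarrow> 'h"
  assumes F: "integrable lebesgue F" and G: "\<And>n. integrable lebesgue (G n)"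
    and a: "a 0 = 0" "incseq a" "\<And>n. a n \<le> T"
    and FG: "\<And>n. AE s in lebesgue. s \<in> {a n<..a (Suc n)} \<longrightarrow> F s = G n s"
    and F0: "AE s in lebesgue. (\<forall>n. a n < s) \<longrightarrow> F s = 0"
    and z: "z 0 \<in> state_space"
      "\<And>n. z (Suc n) = heat \<mu> \<Phi> (a (Suc n) - a n) (z n)
        + (LINT s:{a n<..a (Suc n)}|lebesgue. heat \<mu> \<Phi> (a (Suc n) - s) (G n s))"
    and lim: "z \<longlonglongrightarrow> 0"
  shows "duhamel (z 0) F T = 0"
proof -
  have a_nonneg: "0 \<le> a n" for n using incseqD[OF a(2), of 0 n] a(1) by simp
  have yz: "duhamel (z 0) F (a n) = z n" for n
  proof (induction n)
    case 0
    have "(LINT s:{0..0}|lebesgue. heat \<mu> \<Phi> (0 - s) (F s)) = 0"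
    proof -
      have "AE s in lebesgue. s \<noteq> (0::real)" by (rule AE_completion[OF AE_lborel_singleton])
      then have "AE s in lebesgue. indicator {0..0} s *\<^sub>R heat \<mu> \<Phi> (0 - s) (F s) = 0"
        by eventually_elim auto
      then show ?thesis unfolding set_lebesgue_integral_def by (rule integral_eq_zero_AE)
    qed
    then show ?case by (simp add: duhamel_def a(1) heat_0 z(1))
  next
    case (Suc n)
    have "(LINT s:{a n<..a (Suc n)}|lebesgue. heat \<mu> \<Phi> (a (Suc n) - s) (F s))
        = (LINT s:{a n<..a (Suc n)}|lebesgue. heat \<mu> \<Phi> (a (Suc n) - s) (G n s))"
      by (rule duhamel_cong_AE[OF F G _ _ FG]) auto
    then show ?case
      unfolding duhamel_split[OF F a_nonneg incseq_SucD[OF a(2)]] Suc z(2) by simp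
  qed
  \<comment> \<open>The times \<open>a n\<close> may accumulate strictly before \<open>T\<close>.
    Continuity makes the state vanish at their limit, and no source acts afterwards.\<close>
  obtain l where l: "a \<longlonglongrightarrow> l" "\<And>n. a n \<le> l"
    using incseq_convergent[OF a(2), of T] a(3) by blast
  have "0 \<le> l" using l(2)[of 0] a(1) by simp
  have "l \<le> T" using LIMSEQ_le_const2[OF l(1)] a(3) by blast
  have "(\<lambda>n. duhamel (z 0) F (a n)) \<longlonglongrightarrow> duhamel (z 0) F l"
    by (rule continuous_on_tendsto_compose[OF continuous_on_duhamel[OF F] l(1)])
      (use \<open>0 \<le> l\<close> a_nonneg in auto)
  then have "duhamel (z 0) F l = 0" using lim by (simp add: yz LIMSEQ_unique)
  moreover have "(LINT s:{l<..T}|lebesgue. heat \<mu> \<Phi> (T - s) (F s))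
      = (LINT s:{l<..T}|lebesgue. heat \<mu> \<Phi> (T - s) 0)"
  proof (rule duhamel_cong_AE[OF F])
    show "AE s in lebesgue. s \<in> {l<..T} \<longrightarrow> F s = 0"
      using F0 by eventually_elim (use l(2) in \<open>auto intro: le_less_trans\<close>)
  qed auto
  moreover have "heat \<mu> \<Phi> t 0 = 0" for t by (simp add: heat_def)
  ultimately show ?thesis
    unfolding duhamel_split[OF F \<open>0 \<le> l\<close> \<open>l \<le> T\<close>] by simp
qed

section \<open>Steering finitely many modes\<close>

context heat_system
begin

text \<open>Observability of finitely many modes dualizes to their control. The hypotheses on
  \<open>B\<close> say that it is an orthogonal projection, later the restriction to \<omega>;
  coercivity says that the Gram matrix with entries \<open>B (\<Phi> i) \<bullet> \<Phi> j\<close>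
  is invertible with inverse bounded by \<open>\<kappa>\<close>. Inverting that matrix gives the
  family, and the same bound controls its norm.\<close>

lemma dual_family:
  assumes J: "finite J" and B: "linear B" "\<And>u v. B u \<bullet> v = B u \<bullet> B v"
    and "0 \<le> \<kappa>"
    and coercive: "\<And>a. (\<Sum>j\<in>J. (a j)\<^sup>2) \<le> \<kappa> * (norm (B (\<Sum>j\<in>J. a j *\<^sub>R \<Phi> j)))\<^sup>2"
  obtains w where "\<And>i j. i \<in> J \<Longrightarrow> j \<in> J \<Longrightarrow> B (w i) \<bullet> \<Phi> j = (if i = j then 1 else 0)"
    and "\<And>c. (norm (\<Sum>i\<in>J. c i *\<^sub>R B (w i)))\<^sup>2 \<le> \<kappa> * (\<Sum>i\<in>J. (c i)\<^sup>2)"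
proof -
  define C where "C a = (\<Sum>i\<in>J. a i *\<^sub>R \<Phi> i)" for a :: "nat \<Rightarrow> real"
  \<comment> \<open>Column \<open>i\<close> of the Gram matrix, written as a vector in the span of
    the modes, so that invertibility becomes a statement about spans.\<close>
  define \<tau> where "\<tau> i = (\<Sum>j\<in>J. (B (\<Phi> i) \<bullet> \<Phi> j) *\<^sub>R \<Phi> j)" for i
  have BC: "B (C a) = (\<Sum>i\<in>J. a i *\<^sub>R B (\<Phi> i))" for a
    using B(1) by (simp add: C_def linear_sum linear_scale)
  have \<tau>: "(\<Sum>i\<in>J. a i *\<^sub>R \<tau> i) \<bullet> \<Phi> j = B (C a) \<bullet> \<Phi> j" if "j \<in> J" for a j
  proof -
    have "\<tau> i \<bullet> \<Phi> j = B (\<Phi> i) \<bullet> \<Phi> j" for i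
      unfolding \<tau>_def using inner_sum_basis[OF J] that by simp
    then show ?thesis by (simp add: BC inner_sum_left)
  qed
  have norm_BC: "(norm (B (C a)))\<^sup>2 = (\<Sum>i\<in>J. a i * (B (C a) \<bullet> \<Phi> i))" for a
  proof -
    have "(norm (B (C a)))\<^sup>2 = C a \<bullet> B (C a)"
      by (simp add: power2_norm_eq_inner B(2)[symmetric] inner_commute)
    also have "\<dots> = (\<Sum>i\<in>J. a i * (B (C a) \<bullet> \<Phi> i))"
      unfolding inner_commute[of "C a"] by (subst (2) C_def) (simp only: inner_sum_right inner_scaleR_right)
    finally show ?thesis .
  qed
  have zero: "a k = 0" if "(\<Sum>i\<in>J. a i *\<^sub>R \<tau> i) = 0" "k \<in> J" for a k
  proof -
    have "(norm (B (C a)))\<^sup>2 = 0"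
      unfolding norm_BC using \<tau>[of _ a] that(1) by (intro sum.neutral) auto
    then have "(\<Sum>j\<in>J. (a j)\<^sup>2) \<le> 0" using coercive[of a] by (simp add: C_def)
    then have "\<forall>j\<in>J. (a j)\<^sup>2 = 0"
      using sum_nonneg_eq_0_iff[OF J, of "\<lambda>j. (a j)\<^sup>2"] sum_nonneg[of J "\<lambda>j. (a j)\<^sup>2"] by auto
    with that(2) show ?thesis by simp
  qed
  \<comment> \<open>Vectors with different indices must not collapse, since the dimension count
    below compares cardinalities of sets of vectors.\<close>
  have inj: "inj_on \<tau> J"
  proof (rule inj_onI, rule ccontr)
    fix i k assume ik: "i \<in> J" "k \<in> J" "\<tau> i = \<tau> k" "i \<noteq> k"
    have "(\<Sum>j\<in>J. ((if j = i then 1 else 0) - (if j = k then 1 else 0)) *\<^sub>R \<tau> j) = 0"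
    proof -
      have "(\<Sum>j\<in>J. (if j = i then 1 else 0) *\<^sub>R \<tau> j) = \<tau> i" if "i \<in> J" for i
      proof -
        have "(\<Sum>j\<in>J. (if j = i then 1 else 0) *\<^sub>R \<tau> j) = (\<Sum>j\<in>J. if j = i then \<tau> j else 0)"
          by (intro sum.cong) auto
        then show ?thesis using J that by simp
      qed
      then show ?thesis
        unfolding scaleR_left_diff_distrib sum_subtractf using ik by simp
    qed
    from zero[OF this ik(1)] ik(4) show False by simp
  qed
  have indep: "independent (\<tau> ` J)"
  proof (rule independent_if_scalars_zero)
    fix f x assume "(\<Sum>x\<in>\<tau> ` J. f x *\<^sub>R x) = 0" "x \<in> \<tau> ` J"
    then show "f x = 0" using zero[of "f \<circ> \<tau>"] by (auto simp: sum.reindex[OF inj])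
  qed (use J in auto)
  have inj\<Phi>: "inj_on \<Phi> J" 
  proof (rule inj_onI, rule ccontr)
    fix i k assume "\<Phi> i = \<Phi> k" "i \<noteq> k"
    then show False using orthonormal[of i k] orthonormal[of k k] by simp
  qed
  \<comment> \<open>Otherwise the columns together with \<open>\<Phi> k\<close> would be
    \<open>card J + 1\<close> independent vectors in a span of \<open>card J\<close>
    vectors.\<close>
  have in_span: "\<Phi> k \<in> span (\<tau> ` J)" if k: "k \<in> J" for k
  proof (rule ccontr)
    assume no: "\<Phi> k \<notin> span (\<tau> ` J)"
    then have ind: "independent (insert (\<Phi> k) (\<tau> ` J))" using indep by (simp add: independent_insert)
    have \<Phi>_span: "\<Phi> j \<in> span (\<Phi> ` J)" if "j \<in> J" for j
      using that by (intro span_base) simp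
    have "\<tau> i \<in> span (\<Phi> ` J)" for i
      unfolding \<tau>_def by (intro span_sum span_scale \<Phi>_span)
    with k \<Phi>_span have "insert (\<Phi> k) (\<tau> ` J) \<subseteq> span (\<Phi> ` J)" by auto
    then have "card (insert (\<Phi> k) (\<tau> ` J)) \<le> card (\<Phi> ` J)"
      using independent_span_bound[OF finite_imageI[OF J] ind] by simp
    moreover have "\<Phi> k \<notin> \<tau> ` J" using no span_base[of "\<Phi> k" "\<tau> ` J"] by argo
    ultimately show False using J card_image[OF inj] card_image[OF inj\<Phi>] by simp
  qed
  have "\<exists>a. \<forall>j\<in>J. B (C a) \<bullet> \<Phi> j = (if k = j then 1 else 0)" if k: "k \<in> J" for k
  proof -
    obtain u where "\<Phi> k = (\<Sum>v\<in>\<tau> ` J. u v *\<^sub>R v)"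
      using in_span[OF k] J by (auto simp: span_finite)
    then have \<Phi>k: "\<Phi> k = (\<Sum>i\<in>J. (u \<circ> \<tau>) i *\<^sub>R \<tau> i)" by (simp add: sum.reindex[OF inj])
    have "B (C (u \<circ> \<tau>)) \<bullet> \<Phi> j = \<Phi> k \<bullet> \<Phi> j" if "j \<in> J" for j
      unfolding \<tau>[OF that, symmetric] \<Phi>k[symmetric] ..
    then show ?thesis by (intro exI[of _ "u \<circ> \<tau>"]) (simp add: orthonormal)
  qed
  then obtain a where a: "\<And>k j. k \<in> J \<Longrightarrow> j \<in> J \<Longrightarrow> B (C (a k)) \<bullet> \<Phi> j = (if k = j then 1 else 0)"
    by metis
  have "(norm (\<Sum>i\<in>J. c i *\<^sub>R B (C (a i))))\<^sup>2 \<le> \<kappa> * (\<Sum>i\<in>J. (c i)\<^sup>2)" for c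
  proof -
    \<comment> \<open>The combination equals \<open>B (C d)\<close>, and its squared norm is the
      pairing of \<open>d\<close> with \<open>c\<close>. Cauchy-Schwarz followed by coercivity for
      \<open>d\<close> reproduces one factor of that squared norm, which then cancels.\<close>
    define d where "d k = (\<Sum>i\<in>J. c i * a i k)" for k
    have Cd: "C d = (\<Sum>i\<in>J. c i *\<^sub>R C (a i))"
      unfolding C_def d_def scaleR_sum_left scaleR_sum_right by (subst sum.swap) simp
    have Bd: "B (C d) = (\<Sum>i\<in>J. c i *\<^sub>R B (C (a i)))"
      unfolding Cd using B(1) by (simp add: linear_sum linear_scale)
    have "B (C d) \<bullet> \<Phi> j = c j" if "j \<in> J" for j
    proof -
      have "B (C d) \<bullet> \<Phi> j = (\<Sum>i\<in>J. if i = j then c i else 0)"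
        unfolding Bd inner_sum_left by (intro sum.cong) (use a that in auto)
      then show ?thesis using J that by simp
    qed
    then have "(norm (B (C d)))\<^sup>2 = (\<Sum>i\<in>J. d i * c i)" by (simp add: norm_BC)
    then have "((norm (B (C d)))\<^sup>2)\<^sup>2 \<le> (\<Sum>i\<in>J. (d i)\<^sup>2) * (\<Sum>i\<in>J. (c i)\<^sup>2)"
      using Cauchy_Schwarz_ineq_sum[of d c J] by simp
    also have "\<dots> \<le> (\<kappa> * (norm (B (C d)))\<^sup>2) * (\<Sum>i\<in>J. (c i)\<^sup>2)"
      using coercive[of d] by (intro mult_right_mono) (auto simp: C_def sum_nonneg)
    finally have le: "(norm (B (C d)))\<^sup>2 * (norm (B (C d)))\<^sup>2 \<le> (norm (B (C d)))\<^sup>2 * (\<kappa> * (\<Sum>i\<in>J. (c i)\<^sup>2))"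
      by (simp add: power2_eq_square mult_ac)
    have "(norm (B (C d)))\<^sup>2 \<le> \<kappa> * (\<Sum>i\<in>J. (c i)\<^sup>2)"
    proof (cases "B (C d) = 0")
      case False
      then have "0 < (norm (B (C d)))\<^sup>2" by simp
      with le show ?thesis by (rule mult_left_le_imp_le)
    qed (use \<open>0 \<le> \<kappa>\<close> in \<open>simp add: sum_nonneg\<close>)
    then show ?thesis by (simp only: Bd)
  qed
  with a show thesis by (rule that)
qed

text \<open>The time profile makes the contribution of mode \<open>j\<close> at a later time \<open>t\<close>, namely
  \<open>exp (- \<mu> j * (t - s)) * exp (- \<mu> j * (s - a))\<close>, independent of \<open>s\<close>, so that only the measure of
  the active set \<open>S\<close> matters.\<close>

definition steering :: "nat set \<Rightarrow> (nat \<Rightarrow> 'h) \<Rightarrow> real \<Rightarrow> real set \<Rightarrow> 'h \<Rightarrow> real \<Rightarrow> 'h" where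
  "steering J r a S z s =
    - (indicator S s *\<^sub>R (\<Sum>j\<in>J. (exp (- \<mu> j * (s - a)) * (z \<bullet> \<Phi> j) / measure lebesgue S) *\<^sub>R r j))"

context
  fixes J :: "nat set" and r :: "nat \<Rightarrow> 'h" and a b \<kappa> e :: real and S :: "real set" and z :: 'h
  assumes J: "finite J"
    and dual: "\<And>i j. i \<in> J \<Longrightarrow> j \<in> J \<Longrightarrow> r i \<bullet> \<Phi> j = (if i = j then 1 else 0)"
    and norm_r: "\<And>c. (norm (\<Sum>i\<in>J. c i *\<^sub>R r i))\<^sup>2 \<le> \<kappa> * (\<Sum>i\<in>J. (c i)\<^sup>2)"
    and \<kappa>: "0 \<le> \<kappa>"
    and S: "S \<in> sets lebesgue" "S \<subseteq> {a<..b}" "0 < e" "measure lebesgue S = e"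
    and "a \<le> b"
begin

lemma emeasure_active: "emeasure lebesgue S = ennreal e"
  using S by (metis emeasure_eq_ennreal_measure less_irrefl measure_zero_top)

text \<open>By Bessel's inequality and decay of the exponentials, the coefficients form a vector of
  length at most \<open>norm z / e\<close>; the biorthogonal family costs the factor
  \<open>sqrt \<kappa>\<close>.\<close>

lemma norm_steering:
  "norm (steering J r a S z s) \<le> indicator S s * (sqrt \<kappa> / e * norm z)"
proof (cases "s \<in> S")
  case True
  then have s: "0 \<le> s - a" using S(2) by auto
  let ?c = "\<lambda>j. exp (- \<mu> j * (s - a)) * (z \<bullet> \<Phi> j) / e"
  have "(norm (steering J r a S z s))\<^sup>2 \<le> \<kappa> * (\<Sum>j\<in>J. (?c j)\<^sup>2)"
    using norm_r[of ?c] True S(4) by (simp add: steering_def)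
  also have "\<dots> \<le> \<kappa> * (\<Sum>j\<in>J. (z \<bullet> \<Phi> j)\<^sup>2 / e\<^sup>2)"
  proof (intro mult_left_mono sum_mono \<kappa>)
    fix j
    have "exp (- \<mu> j * (s - a)) \<le> 1" using s eigenvalue_nonneg[of j] by simp
    then have "\<bar>exp (- \<mu> j * (s - a)) * (z \<bullet> \<Phi> j)\<bar> \<le> \<bar>z \<bullet> \<Phi> j\<bar>"
      by (simp add: abs_mult mult_left_le_one_le)
    then have "(exp (- \<mu> j * (s - a)) * (z \<bullet> \<Phi> j))\<^sup>2 \<le> (z \<bullet> \<Phi> j)\<^sup>2"
      by (simp only: abs_le_square_iff)
    then show "(?c j)\<^sup>2 \<le> (z \<bullet> \<Phi> j)\<^sup>2 / e\<^sup>2"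
      unfolding power_divide by (intro divide_right_mono) auto
  qed
  also have "\<dots> \<le> \<kappa> * ((norm z)\<^sup>2 / e\<^sup>2)"
    unfolding sum_divide_distrib[symmetric]
    by (intro mult_left_mono divide_right_mono bessel J \<kappa>) auto
  also have "\<dots> = (sqrt \<kappa> / e * norm z)\<^sup>2"
    using \<kappa> by (simp add: power_mult_distrib power_divide)
  finally have "norm (steering J r a S z s) \<le> sqrt \<kappa> / e * norm z"
    by (rule power2_le_imp_le) (use \<kappa> S in auto)
  then show ?thesis using True by simp
qed (simp add: steering_def)

lemma integrable_steering: "integrable lebesgue (steering J r a S z)"
proof (rule Bochner_Integration.integrable_bound)
  show "integrable lebesgue (\<lambda>s. indicator S s * (sqrt \<kappa> / e * norm z))"
    using S emeasure_active by (intro integrable_mult_left integrable_real_indicator) auto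
  have *: "(\<lambda>s. exp (- \<mu> j * (s - a)) * (z \<bullet> \<Phi> j) / measure lebesgue S) \<in> borel_measurable lebesgue" for j
    by (rule measurable_completion) measurable
  show "steering J r a S z \<in> borel_measurable lebesgue"
    unfolding steering_def
    by (intro borel_measurable_uminus borel_measurable_scaleR borel_measurable_sum
        borel_measurable_indicator S(1) * borel_measurable_const)
  show "AE s in lebesgue. norm (steering J r a S z s) \<le> norm (indicator S s * (sqrt \<kappa> / e * norm z))"
    using norm_steering S(3) \<kappa> by (intro AE_I2) (simp add: abs_mult)
qed

text \<open>On \<open>S\<close> the integrand is the constant \<open>- 1 / e\<close> times the free
  coefficient of mode \<open>k\<close> at time \<open>b\<close>; as \<open>S\<close> has measure
  \<open>e\<close>, the integral cancels that coefficient exactly.\<close>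

lemma steering_low_modes:
  assumes k: "k \<in> J"
  shows "(heat \<mu> \<Phi> (b - a) z
    + (LINT s:{a<..b}|lebesgue. heat \<mu> \<Phi> (b - s) (steering J r a S z s))) \<bullet> \<Phi> k = 0"
proof -
  let ?c = "exp (- \<mu> k * (b - a)) * (z \<bullet> \<Phi> k)"
  have "(LINT s:{a<..b}|lebesgue. heat \<mu> \<Phi> (b - s) (steering J r a S z s)) \<bullet> \<Phi> k
      = (LINT s:{a<..b}|lebesgue. exp (- \<mu> k * (b - s)) * (steering J r a S z s \<bullet> \<Phi> k))"
    by (rule inner_duhamel[OF integrable_steering]) auto
  also have "\<dots> = (LINT s|lebesgue. indicator S s * (- ?c / e))"
    unfolding set_lebesgue_integral_def
  proof (rule Bochner_Integration.integral_cong[OF refl])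
    fix s
    show "indicator {a<..b} s *\<^sub>R (exp (- \<mu> k * (b - s)) * (steering J r a S z s \<bullet> \<Phi> k))
        = indicator S s * (- ?c / e)"
    proof (cases "s \<in> S")
      case True
      have "(\<Sum>j\<in>J. (exp (- \<mu> j * (s - a)) * (z \<bullet> \<Phi> j) / e) *\<^sub>R r j) \<bullet> \<Phi> k
          = (\<Sum>j\<in>J. if j = k then exp (- \<mu> j * (s - a)) * (z \<bullet> \<Phi> j) / e else 0)"
        unfolding inner_sum_left by (intro sum.cong) (use dual k in auto)
      also have "\<dots> = exp (- \<mu> k * (s - a)) * (z \<bullet> \<Phi> k) / e"
        using J k by simp
      finally have "steering J r a S z s \<bullet> \<Phi> k = - (exp (- \<mu> k * (s - a)) * (z \<bullet> \<Phi> k) / e)"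
        using True S(4) by (simp add: steering_def)
      moreover have "exp (- \<mu> k * (b - s)) * exp (- \<mu> k * (s - a)) = exp (- \<mu> k * (b - a))"
        unfolding exp_add[symmetric] by (simp add: algebra_simps)
      ultimately show ?thesis using True S(2) by (auto simp flip: mult.assoc)
    qed (simp add: steering_def)
  qed
  also have "\<dots> = - ?c"
    using S emeasure_active by simp
  finally show ?thesis using \<open>a \<le> b\<close> by (simp add: inner_add_left inner_heat)
qed

text \<open>One full cycle. Up to \<open>b\<close> the norm grows at most by the factor
  \<open>1 + sqrt \<kappa>\<close>: the pointwise bound has \<open>e\<close> in the denominator and
  is integrated over a set of measure \<open>e\<close>. From \<open>b\<close> to \<open>c\<close>
  there is no source and no mode below \<open>\<Lambda>\<close>, so the free decay applies.\<close>

lemma norm_steered_state: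
  assumes low: "\<And>j. \<mu> j \<le> \<Lambda> \<Longrightarrow> j \<in> J" and "b \<le> c"
  shows "norm (heat \<mu> \<Phi> (c - a) z
      + (LINT s:{a<..c}|lebesgue. heat \<mu> \<Phi> (c - s) (steering J r a S z s)))
    \<le> exp (- \<Lambda> * (c - b)) * ((1 + sqrt \<kappa>) * norm z)"
proof -
  define I where "I t = (LINT s:{a<..b}|lebesgue. heat \<mu> \<Phi> (t - s) (steering J r a S z s))" for t
  have "(LINT s:{a<..c}|lebesgue. heat \<mu> \<Phi> (c - s) (steering J r a S z s)) = I c"
  proof -
    have z: "steering J r a S z s = 0" if "\<not> s \<le> b" for s
      using that S(2) by (auto simp: steering_def indicator_def)
    show ?thesis unfolding I_def set_lebesgue_integral_def
      by (rule Bochner_Integration.integral_cong) (use \<open>b \<le> c\<close> z in \<open>auto simp: indicator_def heat_def\<close>)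
  qed
  also have "I c = heat \<mu> \<Phi> (c - b) (I b)"
    unfolding I_def using \<open>b \<le> c\<close> by (intro heat_duhamel[symmetric] integrable_steering) auto
  finally have eq: "heat \<mu> \<Phi> (c - a) z
      + (LINT s:{a<..c}|lebesgue. heat \<mu> \<Phi> (c - s) (steering J r a S z s))
      = heat \<mu> \<Phi> (c - b) (heat \<mu> \<Phi> (b - a) z + I b)"
    using \<open>a \<le> b\<close> \<open>b \<le> c\<close> linear_add[OF bounded_linear.linear[OF bounded_linear_heat[of "c - b"]]]
    by (simp add: heat_heat)
  have "norm (I b) \<le> (LINT s:{a<..b}|lebesgue. norm (steering J r a S z s))"
    unfolding I_def by (rule norm_duhamel[OF integrable_steering]) auto
  also have "\<dots> \<le> (LINT s|lebesgue. indicator S s * (sqrt \<kappa> / e * norm z))"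
    unfolding set_lebesgue_integral_def
  proof (rule integral_mono)
    show "integrable lebesgue (\<lambda>s. indicator {a<..b} s *\<^sub>R norm (steering J r a S z s))"
      by (rule integrable_mult_indicator) (auto intro: integrable_steering)
    show "integrable lebesgue (\<lambda>s. indicator S s * (sqrt \<kappa> / e * norm z))"
      using S emeasure_active by (intro integrable_mult_left integrable_real_indicator) auto
    show "indicator {a<..b} s *\<^sub>R norm (steering J r a S z s) \<le> indicator S s * (sqrt \<kappa> / e * norm z)" for s
      using norm_steering[of s] S(2) by (auto simp: indicator_def split: if_splits)
  qed
  also have "\<dots> = sqrt \<kappa> * norm z"
    using S emeasure_active by simp
  finally have "norm (heat \<mu> \<Phi> (b - a) z + I b) \<le> (1 + sqrt \<kappa>) * norm z"
    using norm_triangle_ineq[of "heat \<mu> \<Phi> (b - a) z" "I b"] heat_contraction[of "b - a" z] \<open>a \<le> b\<close>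
    by (simp add: algebra_simps)
  moreover have "(heat \<mu> \<Phi> (b - a) z + I b) \<bullet> \<Phi> j = 0" if "\<mu> j \<le> \<Lambda>" for j
    unfolding I_def by (rule steering_low_modes[OF low[OF that]])
  ultimately show ?thesis
    unfolding eq using \<open>b \<le> c\<close>
    by (intro order_trans[OF heat_decay[of "c - b" \<Lambda>]] mult_left_mono) auto
qed
end

end

section \<open>Quantile times and the cost of the control\<close>

text \<open>The function giving the measure of the part of E up to time \<open>t\<close> is
  1-Lipschitz. This yields both continuity, hence the existence of times with prescribed values, and
  the fact that a phase lasts at least as long as the measure it captures.\<close>

lemma quantile_times:
  fixes E :: "real set"
  assumes E: "E \<in> sets lebesgue" "E \<subseteq> {0<..T}" and "0 \<le> T"
    and pos: "0 < measure lebesgue E"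
  defines "m \<equiv> measure lebesgue E"
  obtains c where "c 0 = 0" "\<And>k. 0 \<le> c k" "\<And>k. c k \<le> T"
    and "\<And>k. measure lebesgue (E \<inter> {c k<..c (Suc k)}) = m / 2 ^ Suc k"
    and "\<And>k. c k + m / 2 ^ Suc k \<le> c (Suc k)"
proof -
  define \<phi> where "\<phi> t = measure lebesgue (E \<inter> {0..t})" for t
  have fin: "E \<inter> {a..b} \<in> lmeasurable" "E \<inter> {a<..b} \<in> lmeasurable" for a b :: real
    using E by (auto intro!: bounded_set_imp_lmeasurable bounded_Int)
  have diff: "\<phi> u - \<phi> t = measure lebesgue (E \<inter> {t<..u})" if "0 \<le> t" "t \<le> u" for t u
  proof -
    have "E \<inter> {0..u} = (E \<inter> {0..t}) \<union> (E \<inter> {t<..u})" using that by auto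
    moreover have "E \<inter> {t<..u} - E \<inter> {0..t} = E \<inter> {t<..u}" by auto
    ultimately show ?thesis
      unfolding \<phi>_def using measure_Un2[OF fin, of 0 t t u] by simp
  qed
  have le: "measure lebesgue (E \<inter> {t<..u}) \<le> u - t" if "t \<le> u" for t u
  proof -
    have "measure lebesgue (E \<inter> {t<..u}) \<le> measure lebesgue {t<..u}"
      by (rule measure_mono_fmeasurable) (use E in \<open>auto intro: bounded_set_imp_lmeasurable\<close>)
    also have "\<dots> = u - t" using that by simp
    finally show ?thesis .
  qed
  have \<phi>0: "\<phi> 0 = 0"
  proof -
    have "E \<inter> {0..0} = {}" using E by auto
    then show ?thesis by (simp add: \<phi>_def)
  qed
  have \<phi>T: "\<phi> T = m"
  proof -
    have "E \<inter> {0..T} = E" using E(2) by auto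
    then show ?thesis by (simp add: \<phi>_def m_def)
  qed
  have "1-lipschitz_on {0..T} \<phi>"
  proof (rule lipschitz_onI)
    show "dist (\<phi> t) (\<phi> u) \<le> 1 * dist t u" if "t \<in> {0..T}" "u \<in> {0..T}" for t u
    proof -
      have "\<bar>\<phi> u - \<phi> t\<bar> \<le> u - t" if "0 \<le> t" "t \<le> u" for t u
        using diff[OF that] le[OF that(2)] by simp
      from this[of t u] this[of u t] that show ?thesis
        by (cases "t \<le> u") (auto simp: dist_real_def abs_minus_commute)
    qed
  qed simp
  then have cont: "continuous_on {0..T} \<phi>" by (rule lipschitz_on_continuous_on)
  have "0 \<le> m" by (simp add: m_def)
  \<comment> \<open>The intermediate value theorem only supplies some time of the given level; at
    level 0 this might be any time before E has gained mass, so 0 is imposed.\<close>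
  have "\<exists>t\<ge>0. t \<le> T \<and> \<phi> t = m * (1 - 1 / 2 ^ k) \<and> (k = 0 \<longrightarrow> t = 0)" for k :: nat
  proof (cases "k = 0")
    case False
    have "\<phi> 0 \<le> m * (1 - 1 / 2 ^ k)" using \<open>0 \<le> m\<close> by (simp add: \<phi>0)
    moreover have "m * (1 - 1 / 2 ^ k) \<le> \<phi> T"
      unfolding \<phi>T using \<open>0 \<le> m\<close> by (intro mult_left_le) auto
    ultimately show ?thesis using IVT'[of \<phi> 0 _ T] cont \<open>0 \<le> T\<close> False by blast
  qed (use \<open>0 \<le> T\<close> \<phi>0 in auto)
  then obtain c where c: "\<And>k. 0 \<le> c k" "\<And>k. c k \<le> T" "\<And>k. \<phi> (c k) = m * (1 - 1 / 2 ^ k)"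
    and "\<And>k::nat. k = 0 \<longrightarrow> c k = 0"
    by metis
  then have c0: "c 0 = 0" by blast
  have step: "\<phi> (c (Suc k)) - \<phi> (c k) = m / 2 ^ Suc k" for k
    unfolding c by (simp add: field_simps)
  have meas: "measure lebesgue (E \<inter> {c k<..c (Suc k)}) = m / 2 ^ Suc k"
    and incr: "c k + m / 2 ^ Suc k \<le> c (Suc k)" for k
  proof -
    have "c k \<le> c (Suc k)"
    proof (rule ccontr)
      assume "\<not> c k \<le> c (Suc k)"
      then have "\<phi> (c k) - \<phi> (c (Suc k)) = measure lebesgue (E \<inter> {c (Suc k)<..c k})" "c (Suc k) < c k"
        by (auto intro: diff c)
      with step[of k] have "measure lebesgue (E \<inter> {c (Suc k)<..c k}) = - (m / 2 ^ Suc k)" by simp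
      moreover have "0 < m / 2 ^ Suc k" using pos by (simp add: m_def)
      ultimately show False using measure_nonneg[of lebesgue "E \<inter> {c (Suc k)<..c k}"] by linarith
    qed
    then show "measure lebesgue (E \<inter> {c k<..c (Suc k)}) = m / 2 ^ Suc k"
      using diff[OF c(1), of k "c (Suc k)"] step[of k] by simp
    then show "c k + m / 2 ^ Suc k \<le> c (Suc k)"
      using le[OF \<open>c k \<le> c (Suc k)\<close>] by simp
  qed
  show thesis by (rule that[OF c0 c(1,2) meas incr])
qed

text \<open>\<open>Y n\<close> stands for the norm of the state at the start of cycle
  \<open>n\<close>. The series is the total cost of the control, and its ratio test also yields the
  decay of the states.\<close>

lemma control_cost:
  fixes m C \<sigma> p q :: real and Y :: "nat \<Rightarrow> real"
  assumes "0 < m" "0 < C" "0 < \<sigma>" "\<sigma> < 1"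
  defines "p \<equiv> 8 powr (\<sigma> / (1 - \<sigma>))"
  defines "q \<equiv> 8 * p"
  defines "\<kappa> \<equiv> \<lambda>n. exp (C * (1 + (q ^ n) powr \<sigma>))"
  assumes Y: "\<And>n. 0 \<le> Y n"
    and Y_Suc: "\<And>n. Y (Suc n) \<le> exp (- (q ^ n) * (m / 2 ^ (2 * n + 2))) * ((1 + sqrt (\<kappa> n)) * Y n)"
  shows "summable (\<lambda>n. \<kappa> n / (m / 2 ^ (2 * n + 1)) * (Y n)\<^sup>2)" "Y \<longlonglongrightarrow> 0"
proof -
  have "1 \<le> p" unfolding p_def using assms by (intro ge_one_powr_ge_zero) auto
  \<comment> \<open>In this form \<open>q powr \<sigma> = p\<close> is visible, so the cost exponent
    of cycle \<open>n\<close> is \<open>C * (1 + p ^ n)\<close>.\<close>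
  have q: "q = 8 powr (1 / (1 - \<sigma>))"
  proof -
    have "1 / (1 - \<sigma>) = 1 + \<sigma> / (1 - \<sigma>)" using \<open>\<sigma> < 1\<close> by (simp add: field_simps)
    then show ?thesis by (simp add: q_def p_def powr_add)
  qed
  have "(q ^ n) powr \<sigma> = p ^ n" for n
  proof -
    have "0 < q" using \<open>1 \<le> p\<close> by (simp add: q_def)
    then have "(q ^ n) powr \<sigma> = (q powr \<sigma>) ^ n"
      by (simp add: powr_powr mult.commute flip: powr_realpow)
    also have "q powr \<sigma> = p" by (simp add: q p_def powr_powr)
    finally show ?thesis .
  qed
  then have \<kappa>: "\<kappa> n = exp (C * (1 + p ^ n))" for n by (simp add: \<kappa>_def)
  then have \<kappa>1: "1 \<le> \<kappa> n" for n using \<open>0 < C\<close> \<open>1 \<le> p\<close> by simp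
  \<comment> \<open>The squared space-time norm allowed for cycle \<open>n\<close>: the square of
    the pointwise bound \<open>sqrt (\<kappa> n) / e * Y n\<close>, times the active measure
    \<open>e = m / 2 ^ (2 * n + 1)\<close>.\<close>
  define x where "x n = \<kappa> n / (m / 2 ^ (2 * n + 1)) * (Y n)\<^sup>2" for n
  have x0: "0 \<le> x n" for n unfolding x_def using \<kappa>1[of n] \<open>0 < m\<close> by simp
  \<comment> \<open>Of the factor 16, one 4 is the square of the 2 in
    \<open>2 * sqrt (\<kappa> n)\<close>, the other the ratio of consecutive active measures. The
    exponent combines the next cost, \<open>C * (1 + p ^ Suc n)\<close>, with twice the gain;
    \<open>\<kappa> n\<close> has cancelled.\<close>
  define \<rho> where "\<rho> n = 16 * exp (C + p ^ n * (C * p - m / 2 * 2 ^ n))" for n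
  have ratio: "x (Suc n) \<le> \<rho> n * x n" for n
  proof -
    have "1 \<le> sqrt (\<kappa> n)" using \<kappa>1[of n] by simp
    then have "(1 + sqrt (\<kappa> n)) * Y n \<le> (2 * sqrt (\<kappa> n)) * Y n"
      using Y[of n] by (intro mult_right_mono) auto
    then have "Y (Suc n) \<le> exp (- (q ^ n) * (m / 2 ^ (2 * n + 2))) * ((2 * sqrt (\<kappa> n)) * Y n)"
      by (intro order_trans[OF Y_Suc] mult_left_mono) auto
    then have "(Y (Suc n))\<^sup>2 \<le> (exp (- (q ^ n) * (m / 2 ^ (2 * n + 2))) * ((2 * sqrt (\<kappa> n)) * Y n))\<^sup>2"
      using Y[of "Suc n"] by (intro power_mono)
    also have "\<dots> = 4 * \<kappa> n * exp (- 2 * (q ^ n) * (m / 2 ^ (2 * n + 2))) * (Y n)\<^sup>2"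
      using \<kappa>1[of n] by (simp add: power_mult_distrib exp_double[symmetric] flip: mult.assoc)
    also have "- 2 * (q ^ n) * (m / 2 ^ (2 * n + 2)) = - (m / 2 * 2 ^ n * p ^ n)"
    proof -
      have "(8::real) ^ n = 2 ^ n * 4 ^ n" unfolding power_mult_distrib[symmetric] by simp
      moreover have "(2::real) ^ (2 * n) = 4 ^ n" unfolding power_mult by simp
      ultimately show ?thesis by (simp add: q_def power_mult_distrib power_add)
    qed
    finally have "x (Suc n) \<le> \<kappa> (Suc n) / (m / 2 ^ (2 * Suc n + 1)) *
        (4 * \<kappa> n * exp (- (m / 2 * 2 ^ n * p ^ n)) * (Y n)\<^sup>2)"
      unfolding x_def using \<kappa>1[of "Suc n"] \<open>0 < m\<close> by (intro mult_left_mono) auto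
    also have "\<dots> = 16 * (\<kappa> (Suc n) * exp (- (m / 2 * 2 ^ n * p ^ n))) * x n"
      unfolding x_def using \<open>0 < m\<close> by (simp add: field_simps)
    also have "\<kappa> (Suc n) * exp (- (m / 2 * 2 ^ n * p ^ n)) = exp (C + p ^ n * (C * p - m / 2 * 2 ^ n))"
      unfolding \<kappa> exp_add[symmetric] by (simp add: algebra_simps)
    finally show ?thesis by (simp add: \<rho>_def)
  qed
  \<comment> \<open>From \<open>N\<close> on, the exponent is at most \<open>- 32\<close>; since
    \<open>exp (- 32)\<close> is at most 1/32, the factor 16 leaves a ratio of 1/2.\<close>
  obtain N :: nat where N: "(C * p + C + 32) / (m / 2) < 2 ^ N"
    using real_arch_pow[of 2] by auto
  have small: "\<rho> n \<le> 1 / 2" if "N \<le> n" for n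
  proof -
    have "(2::real) ^ N \<le> 2 ^ n" using that by (intro power_increasing) auto
    with N have "(C * p + C + 32) / (m / 2) < 2 ^ n" by linarith
    then have "C * p + C + 32 < 2 ^ n * (m / 2)"
      using \<open>0 < m\<close> by (subst (asm) pos_divide_less_eq) auto
    then have *: "C * p - m / 2 * 2 ^ n \<le> - (C + 32)" by (simp add: mult.commute)
    have "C + p ^ n * (C * p - m / 2 * 2 ^ n) \<le> C + p ^ n * (- (C + 32))"
      using * \<open>1 \<le> p\<close> by (intro add_left_mono mult_left_mono) auto
    also have "\<dots> \<le> C + 1 * (- (C + 32))"
      using \<open>0 < C\<close> \<open>1 \<le> p\<close> by (intro add_left_mono mult_right_mono_neg) auto
    finally have "exp (C + p ^ n * (C * p - m / 2 * 2 ^ n)) \<le> exp (- 32)" by simp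
    also have "exp (- 32) \<le> (1 / 32 :: real)"
      using exp_ge_add_one_self[of "32::real"] by (simp add: exp_minus field_simps)
    finally show ?thesis by (simp add: \<rho>_def)
  qed
  have "summable x"
  proof (rule summable_ratio_test[of "1 / 2" N])
    fix n assume "N \<le> n"
    have "x (Suc n) \<le> 1 / 2 * x n"
      using ratio[of n] mult_right_mono[OF small[OF \<open>N \<le> n\<close>] x0[of n]] by linarith
    then show "norm (x (Suc n)) \<le> 1 / 2 * norm (x n)" using x0 by simp
  qed simp
  then show "summable (\<lambda>n. \<kappa> n / (m / 2 ^ (2 * n + 1)) * (Y n)\<^sup>2)" by (simp add: x_def[abs_def])
  \<comment> \<open>Both \<open>\<kappa> n\<close> and \<open>2 ^ (2 * n + 1)\<close> are at least
    1, so convergence of the cost series forces the states to 0.\<close>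
  have "(Y n)\<^sup>2 \<le> m * x n" for n
  proof -
    have "1 * (Y n)\<^sup>2 \<le> (\<kappa> n * 2 ^ (2 * n + 1)) * (Y n)\<^sup>2"
      using mult_mono[of 1 "\<kappa> n" 1 "2 ^ (2 * n + 1)"] \<kappa>1[of n] one_le_power[of "2::real" "2 * n + 1"]
      by (intro mult_right_mono) auto
    also have "\<dots> = m * x n" using \<open>0 < m\<close> by (simp add: x_def)
    finally show ?thesis by simp
  qed
  then have "(\<lambda>n. (Y n)\<^sup>2) \<longlonglongrightarrow> 0"
    by (intro tendsto_sandwich[OF _ _ tendsto_const tendsto_mult_right_zero[OF summable_LIMSEQ_zero[OF \<open>summable x\<close>], of m]])
      auto
  then have "(\<lambda>n. sqrt ((Y n)\<^sup>2)) \<longlonglongrightarrow> sqrt 0" by (rule tendsto_real_sqrt)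
  then show "Y \<longlonglongrightarrow> 0" using Y by simp
qed

section \<open>Restriction of square-integrable functions\<close>

definition restrict_L2 :: "'a::euclidean_space set \<Rightarrow> 'a L2 \<Rightarrow> 'a L2" where
  "restrict_L2 \<omega> u = L2_of (\<lambda>x. indicator \<omega> x * rep_L2 u x)"

context
  fixes \<omega> :: "'a::euclidean_space set"
  assumes \<omega>[measurable]: "\<omega> \<in> sets borel"
begin

lemma square_integrable_restrict:
  assumes f: "square_integrable f"
  shows "square_integrable (\<lambda>x. indicator \<omega> x * f x)"
proof (rule square_integrable_bound[OF f])
  have [measurable]: "f \<in> borel_measurable lborel"
    using f by (rule square_integrable_measurable)
  show "(\<lambda>x. indicator \<omega> x * f x) \<in> borel_measurable lborel" by measurable
qed (auto simp: indicator_def)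

lemma restrict_L2_cong_AE:
  assumes "square_integrable f" "square_integrable g" "AE x in lborel. f x = g x"
  shows "L2_of (\<lambda>x. indicator \<omega> x * f x) = L2_of (\<lambda>x. indicator \<omega> x * g x)"
  using assms by (intro L2_of_cong_AE square_integrable_restrict) (auto elim: eventually_mono)

lemma restrict_L2_of:
  "square_integrable f \<Longrightarrow> restrict_L2 \<omega> (L2_of f) = L2_of (\<lambda>x. indicator \<omega> x * f x)"
  unfolding restrict_L2_def by (intro restrict_L2_cong_AE rep_L2_of) auto

lemma linear_restrict_L2: "linear (restrict_L2 \<omega> :: 'a L2 \<Rightarrow> 'a L2)"
proof (rule linearI)
  fix u v :: "'a L2" and c :: real
  have uv: "u + v = L2_of (\<lambda>x. rep_L2 u x + rep_L2 v x)" and cu: "c *\<^sub>R u = L2_of (\<lambda>x. c * rep_L2 u x)"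
    by (simp_all add: L2_of_add L2_of_scale)
  show "restrict_L2 \<omega> (u + v) = restrict_L2 \<omega> u + restrict_L2 \<omega> v"
    unfolding uv restrict_L2_of[OF square_integrable_add[OF square_integrable_rep square_integrable_rep]]
    unfolding distrib_left restrict_L2_def
    by (intro L2_of_add square_integrable_restrict square_integrable_rep)
  show "restrict_L2 \<omega> (c *\<^sub>R u) = c *\<^sub>R restrict_L2 \<omega> u"
    unfolding cu restrict_L2_of[OF square_integrable_scale[OF square_integrable_rep]]
    unfolding mult.left_commute[of _ c] restrict_L2_def
    by (intro L2_of_scale square_integrable_restrict square_integrable_rep)
qed

text \<open>Self-adjointness and idempotence of the restriction in one identity, in the form that
  \<open>dual_family\<close> asks for.\<close>

lemma inner_restrict_L2: "restrict_L2 \<omega> u \<bullet> v = restrict_L2 \<omega> u \<bullet> restrict_L2 \<omega> v"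
proof -
  have "restrict_L2 \<omega> u \<bullet> v = restrict_L2 \<omega> u \<bullet> L2_of (rep_L2 v)" by simp
  also have "\<dots> = (LINT x|lborel. indicator \<omega> x * rep_L2 u x * (indicator \<omega> x * rep_L2 v x))"
    unfolding restrict_L2_def
      inner_L2_of[OF square_integrable_restrict[OF square_integrable_rep] square_integrable_rep]
    by (intro Bochner_Integration.integral_cong) (auto simp: indicator_def)
  also have "\<dots> = restrict_L2 \<omega> u \<bullet> restrict_L2 \<omega> v"
    unfolding restrict_L2_def by (subst inner_L2_of) (auto intro!: square_integrable_restrict)
  finally show ?thesis .
qed

lemma norm_restrict_L2: "(norm (restrict_L2 \<omega> u))\<^sup>2 = (LINT x:\<omega>|lborel. \<bar>rep_L2 u x\<bar>\<^sup>2)"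
proof -
  have "(norm (restrict_L2 \<omega> u))\<^sup>2 = (LINT x|lborel. indicator \<omega> x * rep_L2 u x * (indicator \<omega> x * rep_L2 u x))"
    unfolding restrict_L2_def power2_norm_eq_inner
    by (subst inner_L2_of) (auto intro!: square_integrable_restrict)
  also have "\<dots> = (LINT x:\<omega>|lborel. \<bar>rep_L2 u x\<bar>\<^sup>2)"
    unfolding set_lebesgue_integral_def
    by (intro Bochner_Integration.integral_cong) (auto simp: indicator_def power2_eq_square)
  finally show ?thesis .
qed

lemma norm_on_eq: "norm_on \<omega> u = norm (restrict_L2 \<omega> u)"
  unfolding norm_on_def using norm_restrict_L2[of u] by (simp add: real_sqrt_unique)

lemma spectral_inequality_iff:
  "spectral_inequality \<omega> \<sigma> \<mu> \<Phi> \<longleftrightarrow> (\<exists>C>0. \<forall>\<Lambda>>0. \<forall>a.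
    (\<Sum>j | \<mu> j \<le> \<Lambda>. (a j)\<^sup>2) \<le> exp (C * (1 + \<Lambda> powr \<sigma>)) *
      (norm (restrict_L2 \<omega> (\<Sum>j | \<mu> j \<le> \<Lambda>. a j *\<^sub>R \<Phi> j)))\<^sup>2)"
  unfolding spectral_inequality_def norm_restrict_L2 by simp

end

section \<open>The spectral inequality from the other observability statements\<close>

text \<open>On finitely many modes the semigroup is invertible: its inverse multiplies coefficient
  \<open>j\<close> by \<open>exp (\<mu> j * t)\<close>.\<close>

lemma (in heat_system) backward_heat:
  assumes J: "finite J" "\<And>j. j \<in> J \<Longrightarrow> \<mu> j \<le> \<Lambda>" and t: "0 \<le> t"
  obtains v where "v \<in> state_space" "heat \<mu> \<Phi> t v = (\<Sum>j\<in>J. a j *\<^sub>R \<Phi> j)"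
    "norm v \<le> exp (\<Lambda> * t) * norm (\<Sum>j\<in>J. a j *\<^sub>R \<Phi> j)"
proof
  define v where "v = (\<Sum>j\<in>J. (a j * exp (\<mu> j * t)) *\<^sub>R \<Phi> j)"
  have "v \<in> span (range \<Phi>)"
    unfolding v_def by (intro span_sum span_scale span_base) simp
  then show "v \<in> state_space" unfolding state_space_def using closure_subset by blast
  show "heat \<mu> \<Phi> t v = (\<Sum>j\<in>J. a j *\<^sub>R \<Phi> j)"
    unfolding v_def heat_finite_sum[OF t] by (simp add: mult.assoc flip: exp_add)
  have "(norm v)\<^sup>2 = (\<Sum>j\<in>J. (exp (\<mu> j * t))\<^sup>2 * (a j)\<^sup>2)"
    unfolding v_def norm_sum_basis[OF J(1)] by (simp add: power_mult_distrib mult.commute)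
  also have "\<dots> \<le> (\<Sum>j\<in>J. (exp (\<Lambda> * t))\<^sup>2 * (a j)\<^sup>2)"
    using J(2) t by (intro sum_mono mult_right_mono power_mono) (auto intro: mult_right_mono)
  also have "\<dots> = (exp (\<Lambda> * t) * norm (\<Sum>j\<in>J. a j *\<^sub>R \<Phi> j))\<^sup>2"
    unfolding power_mult_distrib norm_sum_basis[OF J(1)] by (simp add: sum_distrib_left)
  finally show "norm v \<le> exp (\<Lambda> * t) * norm (\<Sum>j\<in>J. a j *\<^sub>R \<Phi> j)"
    by (rule power2_le_imp_le) simp
qed

text \<open>Each of the statements (ii)--(iv) is applied to the backward evolution, over the time
  \<open>\<Lambda>\<^bsup>\<sigma>-1\<^esup>\<close>, of a combination of eigenvectors with eigenvalues at most \<open>\<Lambda>\<close>; it is larger than that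
  combination by a factor of at most \<open>exp \<Lambda>\<^sup>\<sigma>\<close>.\<close>

lemma spectral_inequalityI:
  fixes \<omega> :: "'a::euclidean_space set" and \<mu> :: "nat \<Rightarrow> real" and \<Phi> :: "nat \<Rightarrow> 'a L2"
  assumes "heat_system \<mu> \<Phi>" and \<omega>: "\<omega> \<in> sets borel" and fin: "\<And>\<Lambda>. finite {j. \<mu> j \<le> \<Lambda>}"
    and "0 < \<sigma>" "\<sigma> < 1" "0 < K"
    and bound: "\<And>\<Lambda> t u v. 0 < \<Lambda> \<Longrightarrow> t = \<Lambda> powr (\<sigma> - 1) \<Longrightarrow> v \<in> closure (span (range \<Phi>)) \<Longrightarrow>
      u = heat \<mu> \<Phi> t v \<Longrightarrow> u \<noteq> 0 \<Longrightarrow> norm v \<le> exp (\<Lambda> powr \<sigma>) * norm u \<Longrightarrow>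
      (norm u)\<^sup>2 \<le> exp (K * (1 + \<Lambda> powr \<sigma>)) * (norm_on \<omega> u)\<^sup>2"
  shows "spectral_inequality \<omega> \<sigma> \<mu> \<Phi>"
  unfolding spectral_inequality_iff[OF \<omega>]
proof (intro exI conjI allI impI)
  interpret heat_system \<mu> \<Phi> by fact
  show "0 < K" by fact
  fix \<Lambda> :: real and a :: "nat \<Rightarrow> real"
  assume \<Lambda>: "0 < \<Lambda>"
  define u where "u = (\<Sum>j | \<mu> j \<le> \<Lambda>. a j *\<^sub>R \<Phi> j)"
  define t where "t = \<Lambda> powr (\<sigma> - 1)"
  have "\<Lambda> * t = \<Lambda> powr \<sigma>"
    using \<Lambda> powr_mult_base[of \<Lambda> "\<sigma> - 1"] by (simp add: t_def)
  then obtain v where v: "v \<in> state_space" "heat \<mu> \<Phi> t v = u" "norm v \<le> exp (\<Lambda> powr \<sigma>) * norm u"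
    using backward_heat[OF fin, of \<Lambda> \<Lambda> t a] unfolding u_def t_def by auto
  have "(norm u)\<^sup>2 \<le> exp (K * (1 + \<Lambda> powr \<sigma>)) * (norm_on \<omega> u)\<^sup>2"
    using bound[OF \<Lambda> t_def, of v u] v by (cases "u = 0") (auto simp: state_space_def)
  then show "(\<Sum>j | \<mu> j \<le> \<Lambda>. (a j)\<^sup>2) \<le> exp (K * (1 + \<Lambda> powr \<sigma>)) *
      (norm (restrict_L2 \<omega> (\<Sum>j | \<mu> j \<le> \<Lambda>. a j *\<^sub>R \<Phi> j)))\<^sup>2"
    unfolding norm_on_eq[OF \<omega>] unfolding u_def norm_sum_basis[OF fin] .
qed

context
  fixes \<Omega> \<omega> :: "'a::euclidean_space set" and \<mu> :: "nat \<Rightarrow> real" and \<Phi> :: "nat \<Rightarrow> 'a L2"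
    and \<sigma> :: real
  assumes hs: "heat_system \<mu> \<Phi>" and \<omega>: "\<omega> \<in> sets borel"
    and fin: "\<And>\<Lambda>. finite {j. \<mu> j \<le> \<Lambda>}" and \<sigma>: "0 < \<sigma>" "\<sigma> < 1"
    and \<Omega>: "closure (span (range \<Phi>)) = L2_on \<Omega>"
begin

text \<open>The time balances two losses: going backward costs the exponent
  \<open>\<Lambda> * t\<close> and the observability constants involve
  \<open>(1 / t) powr (\<sigma> / (1 - \<sigma>))\<close>; both become
  \<open>\<Lambda> powr \<sigma>\<close>. The last identity serves the logarithmic terms, whose
  argument is divided by \<open>t\<close> before the power \<sigma> is taken.\<close>

lemma inverse_time_powr:
  assumes "0 < \<Lambda>" "t = \<Lambda> powr (\<sigma> - 1)"
  shows "0 < t" "(1 / t) powr (\<sigma> / (1 - \<sigma>)) = \<Lambda> powr \<sigma>" "1 / t = \<Lambda> powr (1 - \<sigma>)"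
    "1 / t * \<Lambda> powr \<sigma> = \<Lambda>"
proof -
  show "0 < t" using assms by simp
  show t: "1 / t = \<Lambda> powr (1 - \<sigma>)"
    unfolding assms(2) by (simp add: powr_minus_divide[symmetric])
  show "(1 / t) powr (\<sigma> / (1 - \<sigma>)) = \<Lambda> powr \<sigma>" using \<sigma> by (simp add: t powr_powr)
  show "1 / t * \<Lambda> powr \<sigma> = \<Lambda>" using assms(1) unfolding t by (simp flip: powr_add)
qed

lemma norm_on_nonneg: "0 \<le> norm_on \<omega> u"
  by (simp add: norm_on_eq[OF \<omega>])

lemma spectral_inequality_if_interpolation:
  assumes "interpolation_observability \<Omega> \<omega> \<sigma> \<mu> \<Phi>"
  shows "spectral_inequality \<omega> \<sigma> \<mu> \<Phi>"
proof -
  obtain C where C: "0 < C" and obs: "\<And>\<theta> t v. v \<in> L2_on \<Omega> \<Longrightarrow> 0 < \<theta> \<Longrightarrow> \<theta> < 1 \<Longrightarrow> 0 < t \<Longrightarrow>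
      norm (heat \<mu> \<Phi> t v) \<le> exp (C * (1 + (1 / (\<theta> * t)) powr (\<sigma> / (1 - \<sigma>)))) *
        norm v powr \<theta> * norm_on \<omega> (heat \<mu> \<Phi> t v) powr (1 - \<theta>)"
    using assms unfolding interpolation_observability_def by blast
  \<comment> \<open>The inequality is used with \<theta> = 1/2, so \<open>1 / (\<theta> * t)\<close>
    is \<open>2 / t\<close> and \<open>b\<close> collects the power of 2.\<close>
  define b :: real where "b = 2 powr (\<sigma> / (1 - \<sigma>))"
  have b: "0 < b" by (simp add: b_def)
  show ?thesis
  proof (rule spectral_inequalityI[OF hs \<omega> fin \<sigma>, of "4 * C * b + 4 * C + 2"])
    show "0 < 4 * C * b + 4 * C + 2" using C b by (intro add_pos_pos mult_pos_pos) auto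
    fix \<Lambda> t :: real and u v :: "'a L2"
    assume \<Lambda>: "0 < \<Lambda>" "t = \<Lambda> powr (\<sigma> - 1)" and v: "v \<in> closure (span (range \<Phi>))"
      and u: "u = heat \<mu> \<Phi> t v" "u \<noteq> 0" and le: "norm v \<le> exp (\<Lambda> powr \<sigma>) * norm u"
    define L N A where "L = \<Lambda> powr \<sigma>" and "N = norm_on \<omega> u" and "A = exp (C * (1 + b * L))"
    have N: "0 \<le> N" by (simp add: N_def norm_on_nonneg)
    have "(2 * (1 / t)) powr (\<sigma> / (1 - \<sigma>)) = b * L"
      using inverse_time_powr[OF \<Lambda>] by (subst powr_mult) (simp_all add: b_def L_def)
    then have "norm u \<le> A * sqrt (norm v) * sqrt N"
      using obs[of v "1 / 2" t] v \<Omega> inverse_time_powr(1)[OF \<Lambda>] N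
      by (simp add: u(1) A_def N_def powr_half_sqrt)
    then have "(norm u)\<^sup>2 \<le> (A * sqrt (norm v) * sqrt N)\<^sup>2" by (intro power_mono) auto
    also have "\<dots> = A\<^sup>2 * norm v * N" using N by (simp add: power_mult_distrib)
    also have "\<dots> \<le> A\<^sup>2 * (exp L * norm u) * N"
      using le N by (intro mult_right_mono mult_left_mono) (auto simp: L_def)
    \<comment> \<open>The backward bound has traded \<open>norm v\<close> for \<open>norm u\<close>,
      one factor of which cancels. Squaring once more produces the fourth power of \<open>A\<close>,
      whence the constants 4 and 2.\<close>
    finally have "norm u * norm u \<le> norm u * (A\<^sup>2 * exp L * N)"
      by (simp add: power2_eq_square mult_ac)
    then have "norm u \<le> A\<^sup>2 * exp L * N"
      by (rule mult_left_le_imp_le) (use u(2) in simp)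
    then have "(norm u)\<^sup>2 \<le> (A\<^sup>2 * exp L * N)\<^sup>2" by (intro power_mono) auto
    also have "\<dots> = exp (4 * C + (4 * C * b + 2) * L) * N\<^sup>2"
      unfolding A_def by (simp add: power_mult_distrib algebra_simps flip: exp_add exp_double)
    also have "\<dots> \<le> exp ((4 * C * b + 4 * C + 2) * (1 + L)) * N\<^sup>2"
    proof -
      have "0 \<le> 4 * C * b + 2 + 4 * C * L" using C b by (simp add: L_def)
      then show ?thesis by (intro mult_right_mono) (auto simp: algebra_simps)
    qed
    finally show "(norm u)\<^sup>2 \<le> exp ((4 * C * b + 4 * C + 2) * (1 + \<Lambda> powr \<sigma>)) * (norm_on \<omega> u)\<^sup>2"
      by (simp add: L_def N_def)
  qed
qed

lemma spectral_inequality_if_approximate: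
  assumes "approximate_observability \<Omega> \<omega> \<sigma> \<mu> \<Phi>"
  shows "spectral_inequality \<omega> \<sigma> \<mu> \<Phi>"
proof -
  obtain C where C: "0 < C" and obs: "\<And>\<epsilon> t v. v \<in> L2_on \<Omega> \<Longrightarrow> 0 < \<epsilon> \<Longrightarrow> 0 < t \<Longrightarrow>
      (norm (heat \<mu> \<Phi> t v))\<^sup>2 \<le> exp (C * (1 + (1 / t) powr (\<sigma> / (1 - \<sigma>)))) *
        exp ((C / t * ln (exp 1 + 1 / \<epsilon>)) powr \<sigma>) *
        (norm_on \<omega> (heat \<mu> \<Phi> t v))\<^sup>2 + \<epsilon> * (norm v)\<^sup>2"
    using assms unfolding approximate_observability_def by blast
  define b where "b = (6 * C) powr \<sigma>"
  show ?thesis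
  proof (rule spectral_inequalityI[OF hs \<omega> fin \<sigma>, of "C + b + 1"])
    show "0 < C + b + 1" using C by (simp add: b_def add_pos_nonneg)
    fix \<Lambda> t :: real and u v :: "'a L2"
    assume \<Lambda>: "0 < \<Lambda>" "t = \<Lambda> powr (\<sigma> - 1)" and v: "v \<in> closure (span (range \<Phi>))"
      and u: "u = heat \<mu> \<Phi> t v" "u \<noteq> 0" and le: "norm v \<le> exp (\<Lambda> powr \<sigma>) * norm u"
    define L N where "L = \<Lambda> powr \<sigma>" and "N = norm_on \<omega> u"
    have L: "0 \<le> L" by (simp add: L_def)
    \<comment> \<open>Chosen so that the error term is at most half of the left-hand side and can be
      absorbed there.\<close>
    define \<epsilon> where "\<epsilon> = exp (- 2 * L) / 2"
    define B where "B = (C / t * ln (exp 1 + 1 / \<epsilon>)) powr \<sigma>"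
    have "\<epsilon> * (norm v)\<^sup>2 \<le> \<epsilon> * (exp L * norm u)\<^sup>2"
      using le by (intro mult_left_mono power_mono) (auto simp: L_def \<epsilon>_def)
    also have "\<dots> = (norm u)\<^sup>2 / 2"
      by (simp add: \<epsilon>_def power_mult_distrib exp_minus flip: exp_double)
    finally have *: "(norm u)\<^sup>2 \<le> 2 * (exp (C * (1 + L)) * exp B * N\<^sup>2)"
      using obs[of v \<epsilon> t] v \<Omega> inverse_time_powr[OF \<Lambda>]
      by (simp add: u(1) N_def B_def \<epsilon>_def L_def)
    have "exp 1 + 1 / \<epsilon> = exp 1 + 2 * exp (2 * L)" by (simp add: \<epsilon>_def exp_minus field_simps)
    also have "\<dots> \<le> exp 1 * exp (2 * L) + 2 * exp (2 * L)" using L by simp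
    also have "\<dots> \<le> exp 1 * exp 1 * exp (2 * L)"
    proof -
      have "(2::real) \<le> exp 1" using exp_ge_add_one_self[of 1] by simp
      then have "exp 1 + 2 \<le> 2 * (exp 1 :: real)" by simp
      also have "\<dots> \<le> exp 1 * exp 1" using \<open>2 \<le> exp 1\<close> by (intro mult_right_mono) auto
      finally have "exp 1 + 2 \<le> exp 1 * (exp 1 :: real)" .
      then show ?thesis unfolding distrib_right[symmetric] by (intro mult_right_mono) auto
    qed
    also have "\<dots> = exp (2 + 2 * L)" by (simp flip: exp_add)
    finally have "ln (exp 1 + 1 / \<epsilon>) \<le> ln (exp (2 + 2 * L))"
      by (subst ln_le_cancel_iff) (auto simp: \<epsilon>_def add_pos_pos)
    then have "C / t * ln (exp 1 + 1 / \<epsilon>) \<le> C / t * (2 + 2 * L)"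
      using C inverse_time_powr(1)[OF \<Lambda>] by (intro mult_left_mono) auto
    also have "\<dots> = 2 * C * (\<Lambda> powr (1 - \<sigma>) + \<Lambda>)"
      using inverse_time_powr(3,4)[OF \<Lambda>] unfolding L_def by (simp add: algebra_simps divide_inverse)
    \<comment> \<open>For \<open>\<Lambda> < 1\<close> the power
      \<open>\<Lambda> powr (1 - \<sigma>)\<close> exceeds \<open>\<Lambda>\<close>, hence the
      maximum. Raising this bound to the power \<sigma> explains \<open>b\<close>.\<close>
    also have "\<dots> \<le> 6 * C * max 1 \<Lambda>"
    proof -
      have "\<Lambda> powr (1 - \<sigma>) \<le> max 1 \<Lambda> powr (1 - \<sigma>)"
        using \<Lambda>(1) \<sigma> by (intro powr_mono2) auto
      also have "\<dots> \<le> max 1 \<Lambda> powr 1" using \<sigma> by (intro powr_mono) auto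
      finally have "\<Lambda> powr (1 - \<sigma>) + \<Lambda> \<le> 3 * max 1 \<Lambda>" by simp
      then show ?thesis using C mult_left_mono[of _ _ "2 * C"] by fastforce
    qed
    finally have "B \<le> (6 * C * max 1 \<Lambda>) powr \<sigma>"
      unfolding B_def using C \<sigma> inverse_time_powr(1)[OF \<Lambda>]
      by (intro powr_mono2 mult_nonneg_nonneg ln_ge_zero) (auto simp: \<epsilon>_def add_increasing2)
    also have "\<dots> = b * max 1 \<Lambda> powr \<sigma>" using C by (simp add: powr_mult b_def)
    also have "\<dots> \<le> b * (1 + L)"
      by (intro mult_left_mono) (auto simp: b_def L_def max_def)
    finally have "exp B \<le> exp (b * (1 + L))" by simp
    \<comment> \<open>This takes care of the factor 2 from the absorption and accounts for the
      summand 1 in \<open>C + b + 1\<close>.\<close>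
    moreover have "2 \<le> exp (1 + L)" using exp_ge_add_one_self[of "1 + L"] L by linarith
    ultimately have "2 * (exp (C * (1 + L)) * exp B * N\<^sup>2)
        \<le> exp (1 + L) * (exp (C * (1 + L)) * exp (b * (1 + L)) * N\<^sup>2)"
      by (intro mult_mono) auto
    also have "\<dots> = exp ((C + b + 1) * (1 + L)) * N\<^sup>2"
      by (simp add: algebra_simps flip: exp_add)
    finally show "(norm u)\<^sup>2 \<le> exp ((C + b + 1) * (1 + \<Lambda> powr \<sigma>)) * (norm_on \<omega> u)\<^sup>2"
      using * by (simp add: L_def N_def)
  qed
qed

lemma spectral_inequality_if_logarithmic:
  assumes "logarithmic_observability \<Omega> \<omega> \<sigma> \<mu> \<Phi>"
  shows "spectral_inequality \<omega> \<sigma> \<mu> \<Phi>"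
proof -
  obtain C where C: "0 < C" and obs: "\<And>t v. v \<in> L2_on \<Omega> - {0} \<Longrightarrow> 0 < t \<Longrightarrow>
      norm (heat \<mu> \<Phi> t v) \<le> exp (C * (1 + (1 / t) powr (\<sigma> / (1 - \<sigma>)))) *
        exp ((C / t * ln (norm v / norm (heat \<mu> \<Phi> t v))) powr \<sigma>) * norm_on \<omega> (heat \<mu> \<Phi> t v)"
    using assms unfolding logarithmic_observability_def by blast
  define b where "b = C powr \<sigma>"
  interpret heat_system \<mu> \<Phi> by (rule hs)
  show ?thesis
  proof (rule spectral_inequalityI[OF hs \<omega> fin \<sigma>, of "2 * C + 2 * b"])
    show "0 < 2 * C + 2 * b" using C by (simp add: b_def add_pos_nonneg)
    fix \<Lambda> t :: real and u v :: "'a L2"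
    assume \<Lambda>: "0 < \<Lambda>" "t = \<Lambda> powr (\<sigma> - 1)" and v: "v \<in> closure (span (range \<Phi>))"
      and u: "u = heat \<mu> \<Phi> t v" "u \<noteq> 0" and le: "norm v \<le> exp (\<Lambda> powr \<sigma>) * norm u"
    define L N where "L = \<Lambda> powr \<sigma>" and "N = norm_on \<omega> u"
    define R where "R = norm v / norm u"
    have t: "0 < t" by (rule inverse_time_powr(1)[OF \<Lambda>])
    \<comment> \<open>Contraction makes the logarithm nonnegative, as monotonicity of
      \<open>powr\<close> in its base demands.\<close>
    have "norm u \<le> norm v" using heat_contraction[of t v] t u(1) by simp
    then have R1: "1 \<le> R" using u(2) by (simp add: R_def)
    have "v \<noteq> 0" using \<open>norm u \<le> norm v\<close> u(2) by auto
    have "R \<le> exp L" using le u(2) by (simp add: R_def L_def divide_le_eq)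
    then have "ln R \<le> ln (exp L)" using R1 by (subst ln_le_cancel_iff) auto
    then have "ln R \<le> L" by simp
    then have "C / t * ln R \<le> C / t * L" using C t by (intro mult_left_mono) auto
    also have "\<dots> = C * \<Lambda>" using inverse_time_powr(4)[OF \<Lambda>] by (simp add: L_def divide_inverse mult.assoc)
    finally have "(C / t * ln R) powr \<sigma> \<le> (C * \<Lambda>) powr \<sigma>"
      using C t R1 \<sigma> by (intro powr_mono2) auto
    also have "\<dots> = b * L" using C \<Lambda>(1) by (simp add: powr_mult b_def L_def)
    finally have "exp ((C / t * ln R) powr \<sigma>) \<le> exp (b * L)" by simp
    then have le_b: "exp (C * (1 + L)) * exp ((C / t * ln R) powr \<sigma>) * N \<le> exp (C * (1 + L)) * exp (b * L) * N"
      by (intro mult_right_mono mult_left_mono) (auto simp: N_def norm_on_nonneg)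
    have "norm u \<le> exp (C * (1 + L)) * exp ((C / t * ln R) powr \<sigma>) * N"
      using obs[of v t] v \<Omega> t \<open>v \<noteq> 0\<close> inverse_time_powr(2)[OF \<Lambda>]
      by (simp add: u(1)[symmetric] L_def R_def N_def)
    also note le_b
    finally have "(norm u)\<^sup>2 \<le> (exp (C * (1 + L)) * exp (b * L) * N)\<^sup>2" by (intro power_mono) auto
    also have "\<dots> = exp (2 * C + (2 * C + 2 * b) * L) * N\<^sup>2"
      by (simp add: power_mult_distrib algebra_simps flip: exp_add exp_double)
    also have "\<dots> \<le> exp ((2 * C + 2 * b) * (1 + L)) * N\<^sup>2"
      by (intro mult_right_mono) (auto simp: algebra_simps b_def)
    finally show "(norm u)\<^sup>2 \<le> exp ((2 * C + 2 * b) * (1 + \<Lambda> powr \<sigma>)) * (norm_on \<omega> u)\<^sup>2"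
      by (simp add: L_def N_def)
  qed
qed

end

section \<open>Null controllability\<close>

lemma borel_measurable_lebesgue_AE:
  fixes f g :: "'a::euclidean_space \<Rightarrow> 'b::topological_space"
  assumes f: "f \<in> borel_measurable lebesgue" and eq: "AE x in lebesgue. g x = f x"
  shows "g \<in> borel_measurable lebesgue"
proof -
  define N where "N = {x. g x \<noteq> f x}"
  have N: "N \<in> null_sets lebesgue"
    using eq completion.AE_iff_null_sets[of "\<lambda>x. g x = f x" lborel] by (simp add: N_def)
  show ?thesis
  proof (rule measurableI)
    fix A :: "'b set" assume A: "A \<in> sets borel"
    have "g -` A \<inter> space lebesgue = (f -` A \<inter> space lebesgue - N) \<union> (g -` A \<inter> N)"
      by (auto simp: N_def)
    moreover have "f -` A \<inter> space lebesgue \<in> sets lebesgue" using f A by (rule measurable_sets)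
    moreover have "g -` A \<inter> N \<in> sets lebesgue"
      using completion.complete[OF _ N, of "g -` A \<inter> N"] by auto
    ultimately show "g -` A \<inter> space lebesgue \<in> sets lebesgue"
      using null_setsD2[OF N] by (simp only: sets.Un sets.Diff)
  qed simp
qed

text \<open>Tonelli's theorem turns integrability in time of the squared slice norms into square
  integrability of \<open>g\<close>. The representative chosen for its class then agrees with
  \<open>g\<close> almost everywhere on almost every time slice.\<close>

lemma
  fixes \<omega> :: "'a::euclidean_space set" and g :: "'a \<times> real \<Rightarrow> real"
  assumes \<omega>[measurable]: "\<omega> \<in> sets borel" and g: "g \<in> borel_measurable borel"
    and zero: "\<And>x s. (x, s) \<notin> \<omega> \<times> E \<Longrightarrow> g (x, s) = 0"
    and slice: "\<And>s. square_integrable (\<lambda>x. g (x, s))"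
    and fin: "(\<integral>\<^sup>+s. ennreal ((norm (L2_of (\<lambda>x. g (x, s))))\<^sup>2) \<partial>lborel) < \<infinity>"
  shows L2_of_in_L2_on: "L2_of g \<in> L2_on (\<omega> \<times> E)"
    and control_source_L2_of: "AE s in lborel. control_source \<omega> E (L2_of g) s = L2_of (\<lambda>x. g (x, s))"
proof -
  have [measurable]: "g \<in> borel_measurable (lborel \<Otimes>\<^sub>M lborel)"
    using g by (simp add: lborel_prod)
  have "(\<integral>\<^sup>+p. ennreal ((g p)\<^sup>2) \<partial>(lborel \<Otimes>\<^sub>M lborel))
      = (\<integral>\<^sup>+s. (\<integral>\<^sup>+x. ennreal ((g (x, s))\<^sup>2) \<partial>lborel) \<partial>lborel)"
    by (rule lborel_pair.nn_integral_snd[symmetric]) measurable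
  also have "\<dots> = (\<integral>\<^sup>+s. ennreal ((norm (L2_of (\<lambda>x. g (x, s))))\<^sup>2) \<partial>lborel)"
  proof (rule nn_integral_cong)
    fix s
    show "(\<integral>\<^sup>+x. ennreal ((g (x, s))\<^sup>2) \<partial>lborel) = ennreal ((norm (L2_of (\<lambda>x. g (x, s))))\<^sup>2)"
      using slice[of s] norm_L2_of[OF slice[of s]]
      by (subst nn_integral_eq_integral) (auto simp: square_integrable_def)
  qed
  finally have "(\<integral>\<^sup>+p. ennreal ((g p)\<^sup>2) \<partial>lborel) < \<infinity>" using fin by (simp add: lborel_prod)
  then have sq: "square_integrable g"
    unfolding square_integrable_def using g by (intro conjI integrableI_bounded) auto
  have AE: "AE p in lborel. rep_L2 (L2_of g) p = g p" by (rule rep_L2_of[OF sq])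
  show "L2_of g \<in> L2_on (\<omega> \<times> E)"
    unfolding L2_on_def mem_Collect_eq using AE
  proof eventually_elim
    case (elim p)
    then show ?case using zero[of "fst p" "snd p"] by simp
  qed
  define h where "h = rep_L2 (L2_of g)"
  have h: "h \<in> borel_measurable borel"
    using rep_L2_measurable[of "L2_of g"] by (simp add: h_def)
  then have [measurable]: "h \<in> borel_measurable (lborel \<Otimes>\<^sub>M lborel)" by (simp add: lborel_prod)
  have "AE p in lborel \<Otimes>\<^sub>M lborel. h p = g p"
    unfolding lborel_prod h_def by (rule AE)
  \<comment> \<open>Fubini yields the exceptional sets in this order; slices in time need the
    opposite one.\<close>
  then have "AE x in lborel. AE s in lborel. h (x, s) = g (x, s)"
    by (rule lborel_pair.AE_pair)
  then have "AE s in lborel. AE x in lborel. h (x, s) = g (x, s)"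
    by (subst (asm) lborel_pair.AE_commute) measurable
  then show "AE s in lborel. control_source \<omega> E (L2_of g) s = L2_of (\<lambda>x. g (x, s))"
  proof eventually_elim
    case (elim s)
    have "AE x in lborel. indicator (\<omega> \<times> E) (x, s) * h (x, s) = g (x, s)"
      using elim
    proof eventually_elim
      case (elim x)
      then show ?case using zero[of x s] by (cases "(x, s) \<in> \<omega> \<times> E") (auto simp: indicator_def)
    qed
    \<comment> \<open>For fixed \<open>s\<close> the indicator of the product splits, and its time
      factor is a constant.\<close>
    moreover have "(\<lambda>x. indicator (\<omega> \<times> E) (x, s) * h (x, s)) \<in> borel_measurable lborel"
    proof -
      have "(\<lambda>x. (x, s)) \<in> borel_measurable lborel" by (intro borel_measurable_Pair) auto
      then have "(\<lambda>x. h (x, s)) \<in> borel_measurable lborel" using h by (rule measurable_compose)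
      then show ?thesis
        unfolding indicator_times fst_conv snd_conv
        by (intro borel_measurable_times borel_measurable_indicator borel_measurable_const) auto
    qed
    ultimately show ?case
      unfolding control_source_def h_def[symmetric]
      by (intro L2_of_cong_AE slice square_integrable_bound[OF slice[of s]]) (auto elim: eventually_mono)
  qed
qed

lemma suminf_single:
  fixes f :: "nat \<Rightarrow> 'b::{comm_monoid_add, t2_space}"
  assumes "\<And>k. k \<noteq> n \<Longrightarrow> f k = 0"
  shows "(\<Sum>k. f k) = f n"
  using suminf_finite[of "{n}" f] assms by auto

text \<open>The active times enter a function of (x, s) that has to be jointly Borel, so the
  construction works on a Borel subset of E of full measure.\<close>

lemma borel_part:
  assumes "E \<in> sets lebesgue"
  obtains S where "S \<in> sets lborel" "S \<subseteq> E" "emeasure lebesgue S = emeasure lebesgue E"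
proof
  let ?S = "main_part lborel E"
  show S: "?S \<in> sets lborel" using assms by (rule main_part_sets)
  show "?S \<subseteq> E" using main_part_null_part_Un[OF assms] by blast
  show "emeasure lebesgue ?S = emeasure lebesgue E"
    using assms S by simp
qed

lemma L2_of_linear_combination:
  assumes "finite J" "\<And>j. square_integrable (f j)"
  shows "square_integrable (\<lambda>x. \<Sum>j\<in>J. c j * f j x)"
    and "L2_of (\<lambda>x. \<Sum>j\<in>J. c j * f j x) = (\<Sum>j\<in>J. c j *\<^sub>R L2_of (f j))"
proof -
  have "square_integrable (\<lambda>x. \<Sum>j\<in>J. c j * f j x) \<and>
    L2_of (\<lambda>x. \<Sum>j\<in>J. c j * f j x) = (\<Sum>j\<in>J. c j *\<^sub>R L2_of (f j))"
    using assms(1)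
    by induction (auto simp: L2_of_add L2_of_scale assms(2) square_integrable_add square_integrable_scale)
  then show "square_integrable (\<lambda>x. \<Sum>j\<in>J. c j * f j x)"
    "L2_of (\<lambda>x. \<Sum>j\<in>J. c j * f j x) = (\<Sum>j\<in>J. c j *\<^sub>R L2_of (f j))" by auto
qed

section \<open>Construction of the control\<close>

lemma null_controllable:
  fixes \<omega> :: "'a::euclidean_space set" and \<mu> :: "nat \<Rightarrow> real" and \<Phi> :: "nat \<Rightarrow> 'a L2"
    and \<sigma> T :: real and E :: "real set"
  assumes "heat_system \<mu> \<Phi>" and fin: "\<And>\<Lambda>. finite {j. \<mu> j \<le> \<Lambda>}"
    and \<omega>: "\<omega> \<in> sets borel" and \<sigma>: "0 < \<sigma>" "\<sigma> < 1" and T: "0 < T"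
    and E: "E \<subseteq> {0<..<T}" "E \<in> sets lebesgue" "emeasure lebesgue E > 0"
    and "spectral_inequality \<omega> \<sigma> \<mu> \<Phi>"
    and y0: "y0 \<in> closure (span (range \<Phi>))"
  shows "\<exists>f\<in>L2_on (\<omega> \<times> E). \<exists>y.
    duhamel_solution (closure (span (range \<Phi>))) \<mu> \<Phi> T y0 (control_source \<omega> E f) y \<and> y T = 0"
proof -
  interpret heat_system \<mu> \<Phi> by fact
  obtain C where "0 < C" and spec: "\<And>\<Lambda> a. 0 < \<Lambda> \<Longrightarrow>
      (\<Sum>j | \<mu> j \<le> \<Lambda>. (a j)\<^sup>2) \<le> exp (C * (1 + \<Lambda> powr \<sigma>)) *
        (norm (restrict_L2 \<omega> (\<Sum>j | \<mu> j \<le> \<Lambda>. a j *\<^sub>R \<Phi> j)))\<^sup>2"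
    using \<open>spectral_inequality \<omega> \<sigma> \<mu> \<Phi>\<close> unfolding spectral_inequality_iff[OF \<omega>] by blast

  obtain S where S: "S \<in> sets lborel" "S \<subseteq> E" "emeasure lebesgue S = emeasure lebesgue E"
    using borel_part[OF E(2)] .
  define m where "m = measure lebesgue S"
  have SL: "S \<in> sets lebesgue" using S(1) by (rule sets_completionI_sets)
  have S0T: "S \<subseteq> {0<..T}" using S(2) E(1) by auto
  have "E \<in> lmeasurable"
    by (rule bounded_set_imp_lmeasurable[OF bounded_subset[OF _ E(1)] E(2)]) simp
  then have "emeasure lebesgue E \<noteq> \<infinity>" by (auto simp: fmeasurable_def)
  then have "0 < m"
    using E(3) S(3) unfolding m_def measure_def by (simp add: enn2real_positive_iff less_top[symmetric])
  obtain c :: "nat \<Rightarrow> real" where c: "c 0 = 0" "\<And>k. 0 \<le> c k" "\<And>k. c k \<le> T"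
    "\<And>k. measure lebesgue (S \<inter> {c k<..c (Suc k)}) = m / 2 ^ Suc k"
    "\<And>k. c k + m / 2 ^ Suc k \<le> c (Suc k)"
  proof (rule quantile_times[OF SL S0T less_imp_le[OF T], folded m_def, OF \<open>0 < m\<close>])
    fix c :: "nat \<Rightarrow> real"
    assume c: "c 0 = 0" "\<And>k. 0 \<le> c k" "\<And>k. c k \<le> T"
      "\<And>k. measure lebesgue (S \<inter> {c k<..c (Suc k)}) = m / 2 ^ Suc k"
      "\<And>k. c k + m / 2 ^ Suc k \<le> c (Suc k)"
    show thesis by (rule that[OF c])
  qed
  \<comment> \<open>A cycle consists of two quantile steps: the control acts on \<open>A n\<close>
    between \<open>a n\<close> and \<open>b n\<close>, and from \<open>b n\<close> to
    \<open>a (Suc n)\<close> the system is left free for a time at least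
    \<open>m / 2 ^ (2 * n + 2)\<close>.\<close>
  define a b A e where "a n = c (2 * n)" and "b n = c (2 * n + 1)"
    and "A n = S \<inter> {a n<..b n}" and "e n = m / 2 ^ (2 * n + 1)" for n :: nat
  have c_Suc: "c k \<le> c (Suc k)" for k
    using c(5)[of k] \<open>0 < m\<close> by (smt (verit) divide_nonneg_pos zero_less_power)
  have ab: "a n \<le> b n" and ba: "b n \<le> a (Suc n)" for n
    using c_Suc[of "2 * n"] c_Suc[of "2 * n + 1"] by (simp_all add: a_def b_def)
  have a_mono: "incseq a"
    by (rule incseq_SucI) (rule order_trans[OF ab ba])
  have A: "A n \<in> sets lborel" "A n \<in> sets lebesgue" "A n \<subseteq> {a n<..b n}" "A n \<subseteq> S" for n
    using S(1) SL by (auto simp: A_def)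
  have e: "0 < e n" "measure lebesgue (A n) = e n" for n
    using \<open>0 < m\<close> c(4)[of "2 * n"] by (auto simp: A_def a_def b_def e_def)
  have emeasure_A: "emeasure lborel (A n) = ennreal (e n)" for n
  proof -
    have "emeasure lebesgue (A n) = ennreal (e n)"
      using e[of n] by (metis emeasure_eq_ennreal_measure less_irrefl measure_zero_top)
    then show ?thesis using A(1)[of n] by simp
  qed
  have tau: "a (Suc n) - b n \<ge> m / 2 ^ (2 * n + 2)" for n
    using c(5)[of "2 * n + 1"] by (simp add: a_def b_def)

  define p q :: real where "p = 8 powr (\<sigma> / (1 - \<sigma>))" and "q = 8 * p"
  define \<kappa> where "\<kappa> n = exp (C * (1 + (q ^ n) powr \<sigma>))" for n :: nat
  define J where "J n = {j. \<mu> j \<le> q ^ n}" for n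
  have "0 < q" by (simp add: q_def p_def)
  have J: "finite (J n)" for n unfolding J_def by (rule fin)
  have \<kappa>: "0 \<le> \<kappa> n" for n by (simp add: \<kappa>_def)
  \<comment> \<open>Bundling both properties of a dual family allows one choice of \<open>w\<close>
    for all cycles.\<close>
  define Q where "Q n w \<longleftrightarrow>
      (\<forall>i\<in>J n. \<forall>j\<in>J n. restrict_L2 \<omega> (w i) \<bullet> \<Phi> j = (if i = j then 1 else 0)) \<and>
      (\<forall>c. (norm (\<Sum>i\<in>J n. c i *\<^sub>R restrict_L2 \<omega> (w i)))\<^sup>2 \<le> \<kappa> n * (\<Sum>i\<in>J n. (c i)\<^sup>2))" for n w
  have "\<exists>w. Q n w" for n
  proof -
    have le: "(\<Sum>j\<in>J n. (a j)\<^sup>2) \<le> \<kappa> n * (norm (restrict_L2 \<omega> (\<Sum>j\<in>J n. a j *\<^sub>R \<Phi> j)))\<^sup>2" for a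
      unfolding J_def \<kappa>_def using \<open>0 < q\<close> by (intro spec) simp
    show ?thesis
    proof (rule dual_family[OF J linear_restrict_L2[OF \<omega>] inner_restrict_L2[OF \<omega>] \<kappa> le])
      fix w
      assume "\<And>i j. i \<in> J n \<Longrightarrow> j \<in> J n \<Longrightarrow> restrict_L2 \<omega> (w i) \<bullet> \<Phi> j = (if i = j then 1 else 0)"
        "\<And>c. (norm (\<Sum>i\<in>J n. c i *\<^sub>R restrict_L2 \<omega> (w i)))\<^sup>2 \<le> \<kappa> n * (\<Sum>i\<in>J n. (c i)\<^sup>2)"
      then have "Q n w" unfolding Q_def by blast
      then show "\<exists>w. Q n w" by (intro exI[of _ w])
    qed
  qed
  then obtain w where w: "\<And>n. Q n (w n)" by metis
  have dual: "restrict_L2 \<omega> (w n i) \<bullet> \<Phi> j = (if i = j then 1 else 0)" if "i \<in> J n" "j \<in> J n" for n i j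
    using w[of n] that unfolding Q_def by blast
  have norm_r: "(norm (\<Sum>i\<in>J n. c i *\<^sub>R restrict_L2 \<omega> (w n i)))\<^sup>2 \<le> \<kappa> n * (\<Sum>i\<in>J n. (c i)\<^sup>2)" for n c
    using w[of n] unfolding Q_def by blast
  define r where "r n i = restrict_L2 \<omega> (w n i)" for n i
  note step = J dual[folded r_def] norm_r[folded r_def] \<kappa> A(2,3) e ab

  \<comment> \<open>The control of a cycle depends on the state at its start, so the states are
    defined by recursion and the controls \<open>G n\<close> read off from them.\<close>
  define z where "z = rec_nat y0 (\<lambda>n v. heat \<mu> \<Phi> (a (Suc n) - a n) v
    + (LINT s:{a n<..a (Suc n)}|lebesgue. heat \<mu> \<Phi> (a (Suc n) - s) (steering (J n) (r n) (a n) (A n) v s)))"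
  define G where "G n = steering (J n) (r n) (a n) (A n) (z n)" for n
  have z_Suc: "z (Suc n) = heat \<mu> \<Phi> (a (Suc n) - a n) (z n)
    + (LINT s:{a n<..a (Suc n)}|lebesgue. heat \<mu> \<Phi> (a (Suc n) - s) (G n s))" for n
    by (simp add: z_def G_def)
  have G_int: "integrable lebesgue (G n)" for n
    unfolding G_def by (rule integrable_steering[OF step])
  have norm_z: "norm (z (Suc n)) \<le> exp (- (q ^ n) * (m / 2 ^ (2 * n + 2))) * ((1 + sqrt (\<kappa> n)) * norm (z n))" for n
  proof -
    have "norm (z (Suc n)) \<le> exp (- (q ^ n) * (a (Suc n) - b n)) * ((1 + sqrt (\<kappa> n)) * norm (z n))"
      unfolding z_Suc G_def by (rule norm_steered_state[OF step]) (auto simp: J_def ba)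
    also have "\<dots> \<le> exp (- (q ^ n) * (m / 2 ^ (2 * n + 2))) * ((1 + sqrt (\<kappa> n)) * norm (z n))"
    proof (intro mult_right_mono)
      have "q ^ n * (m / 2 ^ (2 * n + 2)) \<le> q ^ n * (a (Suc n) - b n)"
        using tau[of n] \<open>0 < q\<close> by (intro mult_left_mono) auto
      then show "exp (- (q ^ n) * (a (Suc n) - b n)) \<le> exp (- (q ^ n) * (m / 2 ^ (2 * n + 2)))"
        by (simp only: exp_le_cancel_iff mult_minus_left neg_le_iff_le)
    qed (use \<kappa>[of n] in auto)
    finally show ?thesis .
  qed
  note cost = control_cost[OF \<open>0 < m\<close> \<open>0 < C\<close> \<sigma>, of "\<lambda>n. norm (z n)", folded p_def, folded q_def, folded \<kappa>_def e_def,
      OF norm_ge_zero norm_z]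
  have z_lim: "z \<longlonglongrightarrow> 0" using cost(2) by (simp add: tendsto_norm_zero_iff)

  define F0 where "F0 s = (\<Sum>n. G n s)" for s
  \<comment> \<open>For each time, \<open>G n s\<close> is only a class. \<open>gn n\<close> is the
    same control written with explicit representatives, which makes it jointly measurable and lets
    the space-time element be formed.\<close>
  define gn where "gn n = (\<lambda>(x, s). - (indicator (A n) s *
    (\<Sum>j\<in>J n. (exp (- \<mu> j * (s - a n)) * (z n \<bullet> \<Phi> j) / measure lebesgue (A n)) * (indicator \<omega> x * rep_L2 (w n j) x))))" for n
  define g where "g p = (\<Sum>n. gn n p)" for p
  have G0: "G n s = 0" if "s \<notin> A n" for n s using that by (simp add: G_def steering_def)
  have gn0: "gn n (x, s) = 0" if "s \<notin> A n" for n x s using that by (simp add: gn_def)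
  have A_other: "s \<notin> A k" if "s \<in> {a n<..a (Suc n)}" "k \<noteq> n" for s k n
  proof (cases "k < n")
    case True
    then have "a (Suc k) \<le> a n" by (intro incseqD[OF a_mono]) simp
    then show ?thesis using A(3)[of k] ba[of k] that(1) by force
  next
    case False
    then have "a (Suc n) \<le> a k" using that(2) by (intro incseqD[OF a_mono]) simp
    then show ?thesis using A(3)[of k] that(1) by force
  qed
  \<comment> \<open>Active sets of different cycles are disjoint, so at each time the series
    defining \<open>F0\<close>, \<open>g\<close> and \<open>B\<close> have at most one nonzero
    term.\<close>
  have single: "\<exists>n. \<forall>k. k \<noteq> n \<longrightarrow> s \<notin> A k" for s
  proof (cases "\<exists>n. s \<in> A n")
    case True
    then obtain n where "s \<in> A n" by blast
    then have "s \<in> {a n<..a (Suc n)}" using A(3)[of n] ba[of n] by force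
    then show ?thesis using A_other by blast
  qed auto
  have slice_n: "square_integrable (\<lambda>x. gn n (x, s))" "L2_of (\<lambda>x. gn n (x, s)) = G n s" for n s
  proof -
    let ?c = "\<lambda>j. - (indicator (A n) s * (exp (- \<mu> j * (s - a n)) * (z n \<bullet> \<Phi> j) / measure lebesgue (A n)))"
    have eq: "gn n (x, s) = (\<Sum>j\<in>J n. ?c j * (indicator \<omega> x * rep_L2 (w n j) x))" for x
      by (simp add: gn_def sum_distrib_left sum_negf mult.assoc)
    have sq: "square_integrable (\<lambda>x. indicator \<omega> x * rep_L2 (w n j) x)" for j
      by (intro square_integrable_restrict[OF \<omega>] square_integrable_rep)
    show "square_integrable (\<lambda>x. gn n (x, s))"
      unfolding eq by (rule L2_of_linear_combination[OF J sq])
    have "L2_of (\<lambda>x. gn n (x, s)) = (\<Sum>j\<in>J n. ?c j *\<^sub>R r n j)"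
      unfolding eq L2_of_linear_combination(2)[OF J sq] r_def restrict_L2_def ..
    also have "\<dots> = G n s"
      by (simp add: G_def steering_def scaleR_sum_right sum_negf)
    finally show "L2_of (\<lambda>x. gn n (x, s)) = G n s" .
  qed
  have slice: "square_integrable (\<lambda>x. g (x, s))" "L2_of (\<lambda>x. g (x, s)) = F0 s" for s
  proof -
    obtain n where n: "\<And>k. k \<noteq> n \<Longrightarrow> s \<notin> A k" using single by blast
    have "(\<lambda>x. g (x, s)) = (\<lambda>x. gn n (x, s))" "F0 s = G n s"
      unfolding g_def F0_def using n by (auto intro!: suminf_single gn0 G0)
    then show "square_integrable (\<lambda>x. g (x, s))" "L2_of (\<lambda>x. g (x, s)) = F0 s"
      using slice_n by simp_all
  qed
  \<comment> \<open>The square of the pointwise bound on the control; multiplied by the active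
    measure \<open>e n\<close> it is the summand of the cost series.\<close>
  define d where "d n = (sqrt (\<kappa> n) / e n * norm (z n))\<^sup>2" for n
  define B where "B s = (\<Sum>n. ennreal (d n) * indicator (A n) s)" for s
  have F0_le: "ennreal ((norm (F0 s))\<^sup>2) \<le> B s" for s
  proof -
    obtain n where n: "\<And>k. k \<noteq> n \<Longrightarrow> s \<notin> A k" using single by blast
    have F0: "F0 s = G n s" and B: "B s = ennreal (d n) * indicator (A n) s"
      unfolding F0_def B_def using n by (auto intro!: suminf_single G0)
    show ?thesis
    proof (cases "s \<in> A n")
      case True
      have "norm (G n s) \<le> indicator (A n) s * (sqrt (\<kappa> n) / e n * norm (z n))"
        unfolding G_def by (rule norm_steering[OF step])
      then have "(norm (G n s))\<^sup>2 \<le> d n"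
        unfolding d_def using True by (intro power_mono) simp_all
      then show ?thesis using True by (simp add: F0 B ennreal_leI)
    qed (simp add: F0 G0)
  qed
  have B_int: "(\<integral>\<^sup>+s. B s \<partial>lborel) < \<infinity>"
  proof -
    have "(\<integral>\<^sup>+s. B s \<partial>lborel) = (\<Sum>n. \<integral>\<^sup>+s. ennreal (d n) * indicator (A n) s \<partial>lborel)"
      unfolding B_def using A(1) by (intro nn_integral_suminf) auto
    also have "\<dots> = (\<Sum>n. ennreal (\<kappa> n / e n * (norm (z n))\<^sup>2))"
    proof (rule arg_cong[where f=suminf], rule ext)
      fix n
      have "(\<integral>\<^sup>+s. ennreal (d n) * indicator (A n) s \<partial>lborel) = ennreal (d n) * ennreal (e n)"
        using A(1)[of n] emeasure_A[of n] by (simp add: nn_integral_cmult)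
      also have "\<dots> = ennreal (d n * e n)"
        using e(1)[of n] by (intro ennreal_mult[symmetric]) (auto simp: d_def)
      also have "d n * e n = \<kappa> n / e n * (norm (z n))\<^sup>2"
        using e(1)[of n] \<kappa>[of n] by (simp add: d_def power_mult_distrib power_divide power2_eq_square)
      finally show "(\<integral>\<^sup>+s. ennreal (d n) * indicator (A n) s \<partial>lborel) = ennreal (\<kappa> n / e n * (norm (z n))\<^sup>2)" .
    qed
    also have "\<dots> = ennreal (\<Sum>n. \<kappa> n / e n * (norm (z n))\<^sup>2)"
      using e(1) \<kappa> by (intro suminf_ennreal2 cost(1)) (auto simp: less_imp_le)
    finally show ?thesis by simp
  qed
  have B_meas: "B \<in> borel_measurable lborel"
    unfolding B_def using A(1) by (intro borel_measurable_suminf_order) auto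
  have F0_int: "integrable lebesgue F0"
  proof (rule integrableI_bounded)
    show "F0 \<in> borel_measurable lebesgue"
      unfolding F0_def by (intro borel_measurable_suminf borel_measurable_integrable G_int)
    \<comment> \<open>On a bounded time interval square integrability gives integrability, through
      the fact that a number is at most 1 plus its square.\<close>
    have "ennreal (norm (F0 s)) \<le> indicator {0..T} s + B s" for s
    proof (cases "s \<in> S")
      case True
      have "norm (F0 s) \<le> 1 + (norm (F0 s))\<^sup>2"
        using sum_squares_bound[of 1 "norm (F0 s)"] norm_ge_zero[of "F0 s"]
        by (simp only: power_one mult_1_right)
      then have "ennreal (norm (F0 s)) \<le> ennreal (1 + (norm (F0 s))\<^sup>2)" by (rule ennreal_leI)
      also have "\<dots> = 1 + ennreal ((norm (F0 s))\<^sup>2)" by (subst ennreal_plus) auto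
      also have "\<dots> \<le> 1 + B s" by (intro add_left_mono F0_le)
      finally show ?thesis using True S0T by (auto simp: indicator_def split: if_splits)
    next
      case False
      then have "G n s = 0" for n using A(4)[of n] by (intro G0) auto
      then have "F0 s = 0" by (simp add: F0_def)
      then show ?thesis by simp
    qed
    then have "(\<integral>\<^sup>+s. ennreal (norm (F0 s)) \<partial>lebesgue) \<le> (\<integral>\<^sup>+s. indicator {0..T} s + B s \<partial>lborel)"
      unfolding nn_integral_completion by (rule nn_integral_mono)
    also have "\<dots> = ennreal T + (\<integral>\<^sup>+s. B s \<partial>lborel)"
      using B_meas T by (subst nn_integral_add) auto
    also have "\<dots> < \<infinity>" using B_int by (simp add: less_top[symmetric])
    finally show "(\<integral>\<^sup>+s. ennreal (norm (F0 s)) \<partial>lebesgue) < \<infinity>" .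
  qed

  have g_meas: "g \<in> borel_measurable borel"
  proof -
    have "gn n \<in> borel_measurable borel" for n
    proof -
      have [measurable]: "A n \<in> sets borel" "\<omega> \<in> sets borel" using A(1)[of n] \<omega> by auto
      have [measurable]: "rep_L2 u \<in> borel_measurable borel" for u :: "'a L2"
        using rep_L2_measurable[of u] by simp
      show ?thesis
        unfolding gn_def borel_prod[symmetric] by measurable
    qed
    then show ?thesis unfolding g_def by (intro borel_measurable_suminf)
  qed
  have g_zero: "g (x, s) = 0" if "(x, s) \<notin> \<omega> \<times> E" for x s
  proof -
    have "gn n (x, s) = 0" for n
    proof (cases "s \<in> A n")
      case True
      then have "x \<notin> \<omega>" using that A(4) S(2) by blast
      then show ?thesis by (simp add: gn_def)
    qed (rule gn0)
    then show ?thesis by (simp add: g_def)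
  qed
  have g_fin: "(\<integral>\<^sup>+s. ennreal ((norm (L2_of (\<lambda>x. g (x, s))))\<^sup>2) \<partial>lborel) < \<infinity>"
    unfolding slice(2) by (rule le_less_trans[OF nn_integral_mono[OF F0_le] B_int])
  \<comment> \<open>Forming the class of \<open>g\<close> replaces it by an arbitrary
    representative, so \<open>F\<close> equals \<open>F0\<close> only for almost every time; its
    measurability rests on completeness of Lebesgue measure.\<close>
  define F where "F = control_source \<omega> E (L2_of g)"
  have F: "AE s in lebesgue. F s = F0 s"
    unfolding F_def using AE_completion[OF control_source_L2_of[OF \<omega> g_meas g_zero slice(1) g_fin]]
    by (simp add: slice(2))
  have F_int: "integrable lebesgue F"
  proof (rule iffD1[OF integrable_cong_AE F0_int])
    show "F0 \<in> borel_measurable lebesgue" using F0_int by (rule borel_measurable_integrable)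
    then show "F \<in> borel_measurable lebesgue" using F by (rule borel_measurable_lebesgue_AE)
    show "AE s in lebesgue. F0 s = F s" using F by eventually_elim simp
  qed
  have "duhamel (z 0) F T = 0"
  proof (rule null_control[OF F_int G_int, of a])
    show "a 0 = 0" "\<And>n. a n \<le> T" by (simp_all add: a_def c)
    show "incseq a" by (rule a_mono)
    show "AE s in lebesgue. s \<in> {a n<..a (Suc n)} \<longrightarrow> F s = G n s" for n
      using F
    proof eventually_elim
      case (elim s)
      show ?case
      proof
        assume "s \<in> {a n<..a (Suc n)}"
        then show "F s = G n s"
          unfolding elim F0_def by (intro suminf_single G0 A_other)
      qed
    qed
    show "AE s in lebesgue. (\<forall>n. a n < s) \<longrightarrow> F s = 0"
      using F
    proof eventually_elim
      case (elim s)
      show ?case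
      proof
        assume *: "\<forall>n. a n < s"
        have "s \<notin> A n" for n using A(3)[of n] ba[of n] *[rule_format, of "Suc n"] by force
        then show "F s = 0" by (simp add: elim F0_def G0)
      qed
    qed
    show "z 0 \<in> state_space" using y0 by (simp add: z_def state_space_def)
  qed (rule z_Suc z_lim)+
  moreover have "z 0 = y0" by (simp add: z_def)
  moreover have "duhamel_solution (closure (span (range \<Phi>))) \<mu> \<Phi> T y0 F (duhamel y0 F)"
    unfolding duhamel_solution_def
  proof (intro conjI ballI)
    show "continuous_on {0..T} (duhamel y0 F)"
      by (rule continuous_on_subset[OF continuous_on_duhamel[OF F_int]]) auto
    show "duhamel y0 F ` {0..T} \<subseteq> closure (span (range \<Phi>))"
      using duhamel_in_state_space[OF F_int] by (auto simp: state_space_def)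
    show "set_integrable lebesgue {0..t} (\<lambda>s. heat \<mu> \<Phi> (t - s) (F s))" for t
      by (rule set_integrable_duhamel[OF F_int]) auto
    show "duhamel y0 F t = heat \<mu> \<Phi> t y0 + (LINT s:{0..t}|lebesgue. heat \<mu> \<Phi> (t - s) (F s))" for t
      by (rule duhamel_def)
  qed
  moreover have "L2_of g \<in> L2_on (\<omega> \<times> E)"
    by (rule L2_of_in_L2_on[OF \<omega> g_meas g_zero slice(1) g_fin])
  ultimately show ?thesis unfolding F_def by auto
qed

section \<open>Spectral data of the operator and conclusion\<close>

lemma eigenbasis_finite:
  assumes "eigenbasis H D P \<mu> \<Phi>"
  shows "finite {j. \<mu> j \<le> \<Lambda>}"
proof -
  have "\<forall>\<^sub>F j in sequentially. \<Lambda> < \<mu> j"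
    using assms unfolding eigenbasis_def filterlim_at_top_dense by blast
  then obtain N where "\<And>j. N \<le> j \<Longrightarrow> \<Lambda> < \<mu> j" by (auto simp: eventually_sequentially)
  then have "{j. \<mu> j \<le> \<Lambda>} \<subseteq> {..<N}" by (auto simp: not_less[symmetric])
  then show ?thesis by (rule finite_subset) simp
qed

lemma eigenbasis_heat_system:
  fixes \<Phi> :: "nat \<Rightarrow> 'h::{real_inner, banach, second_countable_topology}"
  assumes "eigenbasis H D P \<mu> \<Phi>"
  shows "heat_system \<mu> \<Phi>"
proof
  show "\<Phi> i \<bullet> \<Phi> j = (if i = j then 1 else 0)" for i j
    using assms by (auto simp: eigenbasis_def)
  show "0 \<le> \<mu> j" for j
    using assms monoD[of \<mu> 0 j] by (simp add: eigenbasis_def)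
qed

theorem theorem3p4:
  fixes \<Omega> \<omega> :: "'a::euclidean_space set"
    and D :: "'a L2 set" and P :: "'a L2 \<Rightarrow> 'a L2"
    and \<mu> :: "nat \<Rightarrow> real" and \<Phi> :: "nat \<Rightarrow> 'a L2"
    and \<sigma> T :: real and E :: "real set"
  assumes "bounded_C2_domain \<Omega>"
    and "admissible_operator (L2_on \<Omega>) D P"
    and "eigenbasis (L2_on \<Omega>) D P \<mu> \<Phi>"
    and "open \<omega>" and "\<omega> \<noteq> {}" and "\<omega> \<subseteq> \<Omega>"
    and "0 < \<sigma>" and "\<sigma> < 1"
    and "0 < T"
    and "E \<subseteq> {0<..<T}" and "E \<in> sets lebesgue" and "emeasure lebesgue E > 0"
    and "spectral_inequality \<omega> \<sigma> \<mu> \<Phi> \<or> interpolation_observability \<Omega> \<omega> \<sigma> \<mu> \<Phi> \<or>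
         approximate_observability \<Omega> \<omega> \<sigma> \<mu> \<Phi> \<or> logarithmic_observability \<Omega> \<omega> \<sigma> \<mu> \<Phi>"
  shows "\<forall>y0\<in>L2_on \<Omega>. \<exists>f\<in>L2_on (\<omega> \<times> E). \<exists>y.
           duhamel_solution (L2_on \<Omega>) \<mu> \<Phi> T y0 (control_source \<omega> E f) y \<and> y T = 0"
proof
  fix y0 assume y0: "y0 \<in> L2_on \<Omega>"
  note eb = \<open>eigenbasis (L2_on \<Omega>) D P \<mu> \<Phi>\<close>
  \<comment> \<open>The eigenbasis identifies the state space of the diagonal semigroup with the
    square-integrable functions on the domain.\<close>
  have \<Omega>: "closure (span (range \<Phi>)) = L2_on \<Omega>" using eb by (simp add: eigenbasis_def)
  have \<omega>: "\<omega> \<in> sets borel" using \<open>open \<omega>\<close> by simp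
  note spectral = eigenbasis_heat_system[OF eb] \<omega> eigenbasis_finite[OF eb] \<open>0 < \<sigma>\<close> \<open>\<sigma> < 1\<close> \<Omega>
  have "spectral_inequality \<omega> \<sigma> \<mu> \<Phi>"
    using assms(13) spectral_inequality_if_interpolation[OF spectral]
      spectral_inequality_if_approximate[OF spectral] spectral_inequality_if_logarithmic[OF spectral]
    by blast
  then show "\<exists>f\<in>L2_on (\<omega> \<times> E). \<exists>y.
      duhamel_solution (L2_on \<Omega>) \<mu> \<Phi> T y0 (control_source \<omega> E f) y \<and> y T = 0"
    using null_controllable[OF eigenbasis_heat_system[OF eb] eigenbasis_finite[OF eb] \<omega>
        \<open>0 < \<sigma>\<close> \<open>\<sigma> < 1\<close> \<open>0 < T\<close> \<open>E \<subseteq> {0<..<T}\<close> \<open>E \<in> sets lebesgue\<close> \<open>emeasure lebesgue E > 0\<close>, of y0]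
      y0 unfolding \<Omega> by blast
qed

end
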